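(* Let $\Omega\subset\mathbb{R}^{n}$ be non-empty, open and convex, and suppose that the set of exposed points of the closure $\overline{\Omega}$ is infinite. Then the Nehari theorem fails for $\Omega$ (i.e. it is not the case that the Nehari theorem is true for $\Omega$).
   Context: Fourier transform: $\widehat{f}(x)=\int_{\mathbb{R}^{n}}f(y)e^{-2\pi i x\cdot y}\,dy$, extended as usual to $L^{2}(\mathbb{R}^{n})$ and to the tempered distributions $S'(\mathbb{R}^{n})$. For $\Omega\subset\mathbb{R}^{n}$ non-empty, open and convex, the Paley-Wiener space $\mathrm{PW}(\Omega)$ is the closed subspace of $L^{2}(\mathbb{R}^{n})$ of functions $f$ whose Fourier transform is supported in $\Omega$, i.e. $\widehat{f}=0$ almost everywhere outside $\Omega$. For $\phi\in S'(\mathbb{R}^{n})$ the Hankel operator $\mathrm{H}_{\phi}$ on $\mathrm{PW}(\Omega)$ is given by $$\widehat{\mathrm{H}_{\phi}f}(x)=\int_{\Omega}\widehat{f}(y)\,\widehat{\phi}(x+y)\,dy,\qquad x\in\Omega,$$ densely defined on those $f$ with $\widehat{f}$ smooth and compactly supported in $\Omega$ (the integral being understood as a distributional pairing); it depends only on the restriction of $\widehat\phi$ to $2\Omega=\{2x:x\in\Omega\}$. One says $\phi$ generates a bounded Hankel operator if $\mathrm{H}_{\phi}$ extends to a bounded operator on $\mathrm{PW}(\Omega)$. The Nehari theorem is true for $\Omega$ if for every $\phi\in S'(\mathbb{R}^{n})$ that generates a bounded Hankel operator on $\mathrm{PW}(\Omega)$ there exists $\psi\in L^{\infty}(\mathbb{R}^{n})$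 such that $\widehat{\phi}=\widehat{\psi}$ in $2\Omega$ (as distributions on $2\Omega$). A supporting hyperplane of a closed set $K$ through $x\in\partial K$ is a hyperplane $H=\{y\in\mathbb{R}^n:\langle y,a\rangle=t\}$ ($a\in\mathbb{R}^{n}\setminus\{0\}$, $t\in\mathbb{R}$) with $x\in H$ and $K\subset\{y:\langle y,a\rangle\le t\}$. A point $x\in\partial K$ is an exposed point of $K$ if $K\cap H=\{x\}$ for some supporting hyperplane $H$ of $K$ through $x$. *)

theory Defs
  imports "HOL-Analysis.Analysis"
begin

primrec iter_partial :: "'a::euclidean_space list \<Rightarrow> ('a \<Rightarrow> complex) \<Rightarrow> 'a \<Rightarrow> complex" where
  "iter_partial [] f = f"
| "iter_partial (v # vs) f = (\<lambda>x. frechet_derivative (iter_partial vs f) (at x) v)"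

text \<open>Iterated partial derivatives of order \<open>m\<close> are indexed by lists of \<open>m\<close> basis vectors rather
  than by multi-indices. If all of them are differentiable, they are all continuous, so the
  function is of class \<open>C\<close>-infinity.\<close>

definition smooth :: "('a::euclidean_space \<Rightarrow> complex) \<Rightarrow> bool" where
  "smooth f \<longleftrightarrow> (\<forall>vs. set vs \<subseteq> Basis \<longrightarrow> iter_partial vs f differentiable_on UNIV)"

definition test_function :: "'a::euclidean_space set \<Rightarrow> ('a \<Rightarrow> complex) \<Rightarrow> bool" where
  "test_function U g \<longleftrightarrow>
     smooth g \<and> compact (closure {x. g x \<noteq> 0}) \<and> closure {x. g x \<noteq> 0} \<subseteq> U"

definition schwartz :: "('a::euclidean_space \<Rightarrow> complex) set" where
  "schwartz = {f. smooth f \<and>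
     (\<forall>k::nat. \<forall>vs. set vs \<subseteq> Basis \<longrightarrow> bdd_above (range (\<lambda>x. norm x ^ k * norm (iter_partial vs f x))))}"

definition schwartz_seminorm :: "nat \<Rightarrow> 'a::euclidean_space list \<Rightarrow> ('a \<Rightarrow> complex) \<Rightarrow> real" where
  "schwartz_seminorm k vs f = (SUP x. norm x ^ k * norm (iter_partial vs f x))"

text \<open>A distribution is a functional on all functions of which only the values on Schwartz
  functions are meaningful. Continuity is domination by finitely many seminorms.\<close>

definition tempered_distribution :: "(('a::euclidean_space \<Rightarrow> complex) \<Rightarrow> complex) \<Rightarrow> bool" where
  "tempered_distribution u \<longleftrightarrow>
     (\<forall>f\<in>schwartz. \<forall>g\<in>schwartz. \<forall>a b. u (\<lambda>x. a * f x + b * g x) = a * u f + b * u g) \<and>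
     (\<exists>C N. \<forall>f\<in>schwartz.
        norm (u f) \<le> C * (\<Sum>k\<le>N. \<Sum>vs | set vs \<subseteq> Basis \<and> length vs \<le> N. schwartz_seminorm k vs f))"

definition regular_distribution ::
    "('a::euclidean_space \<Rightarrow> complex) \<Rightarrow> ('a \<Rightarrow> complex) \<Rightarrow> complex" where
  "regular_distribution \<psi> f = (\<integral>x. \<psi> x * f x \<partial>lborel)"

definition distribution_eq_on ::
    "'a::euclidean_space set \<Rightarrow> (('a \<Rightarrow> complex) \<Rightarrow> complex) \<Rightarrow> (('a \<Rightarrow> complex) \<Rightarrow> complex) \<Rightarrow> bool" where
  "distribution_eq_on U u v \<longleftrightarrow> (\<forall>g. test_function U g \<longrightarrow> u g = v g)"

text \<open>Elements are functions, not classes modulo equality almost everywhere.\<close>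

definition L2 :: "('a::euclidean_space \<Rightarrow> complex) set" where
  "L2 = {f \<in> borel_measurable lborel. integrable lborel (\<lambda>x. (norm (f x))\<^sup>2)}"

definition L2_norm :: "('a::euclidean_space \<Rightarrow> complex) \<Rightarrow> real" where
  "L2_norm f = sqrt (\<integral>x. (norm (f x))\<^sup>2 \<partial>lborel)"

definition Linfty :: "('a::euclidean_space \<Rightarrow> complex) set" where
  "Linfty = {f \<in> borel_measurable lborel. \<exists>C. AE x in lborel. norm (f x) \<le> C}"

definition fourier :: "('a::euclidean_space \<Rightarrow> complex) \<Rightarrow> 'a \<Rightarrow> complex" where
  "fourier f x = (\<integral>y. f y * exp (- 2 * of_real pi * \<i> * of_real (x \<bullet> y)) \<partial>lborel)"

text \<open>The extension by continuity from integrable square-integrable functions. The value is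
  determined up to equality almost everywhere only. All functions
  involved are required to be square-integrable because \<^const>\<open>L2_norm\<close> is \<open>0\<close> on functions
  whose squared modulus is not integrable.\<close>

definition is_fourier_L2 :: "('a::euclidean_space \<Rightarrow> complex) \<Rightarrow> ('a \<Rightarrow> complex) \<Rightarrow> bool" where
  "is_fourier_L2 f g \<longleftrightarrow> f \<in> L2 \<and> g \<in> L2 \<and>
     (\<exists>F. (\<forall>k::nat. F k \<in> L2 \<and> integrable lborel (F k) \<and> fourier (F k) \<in> L2) \<and>
          (\<lambda>k. L2_norm (\<lambda>x. F k x - f x)) \<longlonglongrightarrow> 0 \<and>
          (\<lambda>k. L2_norm (\<lambda>x. fourier (F k) x - g x)) \<longlonglongrightarrow> 0)"

definition fourier_L2 :: "('a::euclidean_space \<Rightarrow> complex) \<Rightarrow> 'a \<Rightarrow> complex" where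
  "fourier_L2 f = (SOME g. is_fourier_L2 f g)"

definition fourier_distribution ::
    "(('a::euclidean_space \<Rightarrow> complex) \<Rightarrow> complex) \<Rightarrow> ('a \<Rightarrow> complex) \<Rightarrow> complex" where
  "fourier_distribution u f = u (fourier f)"

definition paley_wiener :: "'a::euclidean_space set \<Rightarrow> ('a \<Rightarrow> complex) set" where
  "paley_wiener \<Omega> = {f \<in> L2. AE x in lborel. x \<notin> \<Omega> \<longrightarrow> fourier_L2 f x = 0}"

definition hankel_domain :: "'a::euclidean_space set \<Rightarrow> ('a \<Rightarrow> complex) set" where
  "hankel_domain \<Omega> = {f \<in> paley_wiener \<Omega>.
     \<exists>g. test_function \<Omega> g \<and> (AE x in lborel. fourier_L2 f x = g x)}"

text \<open>For \<open>g\<close> smooth with compact support in \<open>\<Omega>\<close>, the integral of \<open>g y * u (x + y)\<close> over \<open>y \<in> \<Omega>\<close> is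
  the pairing of \<open>u\<close> with the translate \<open>z \<mapsto> g (z - x)\<close>, by the substitution \<open>z = x + y\<close>.\<close>

definition hankel_integral ::
    "(('a::euclidean_space \<Rightarrow> complex) \<Rightarrow> complex) \<Rightarrow> ('a \<Rightarrow> complex) \<Rightarrow> 'a \<Rightarrow> complex" where
  "hankel_integral u g x = u (\<lambda>z. g (z - x))"

text \<open>The Hankel operator as a relation: \<open>h\<close> is the image of \<open>f\<close>. A given \<open>f\<close> in the domain has
  no image if its Hankel integral is not square-integrable on \<open>\<Omega>\<close>. The function \<open>g\<close> is the smooth
  representative of the Fourier transform of \<open>f\<close>, which is unique.\<close>

definition is_hankel ::
    "'a::euclidean_space set \<Rightarrow> (('a \<Rightarrow> complex) \<Rightarrow> complex) \<Rightarrow> ('a \<Rightarrow> complex) \<Rightarrow> ('a \<Rightarrow> complex) \<Rightarrow> bool" where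
  "is_hankel \<Omega> \<phi> f h \<longleftrightarrow> h \<in> paley_wiener \<Omega> \<and>
     (\<exists>g. test_function \<Omega> g \<and> (AE x in lborel. fourier_L2 f x = g x) \<and>
          (AE x in lborel. x \<in> \<Omega> \<longrightarrow>
             fourier_L2 h x = hankel_integral (fourier_distribution \<phi>) g x))"

definition bounded_operator_on ::
    "('a::euclidean_space \<Rightarrow> complex) set \<Rightarrow> (('a \<Rightarrow> complex) \<Rightarrow> 'a \<Rightarrow> complex) \<Rightarrow> bool" where
  "bounded_operator_on V T \<longleftrightarrow>
     (\<forall>f\<in>V. T f \<in> V) \<and>
     (\<forall>f\<in>V. \<forall>g\<in>V. \<forall>a b. AE x in lborel. T (\<lambda>y. a * f y + b * g y) x = a * T f x + b * T g x) \<and>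
     (\<exists>C. \<forall>f\<in>V. L2_norm (T f) \<le> C * L2_norm f)"

definition generates_bounded_hankel ::
    "'a::euclidean_space set \<Rightarrow> (('a \<Rightarrow> complex) \<Rightarrow> complex) \<Rightarrow> bool" where
  "generates_bounded_hankel \<Omega> \<phi> \<longleftrightarrow>
     (\<exists>T. bounded_operator_on (paley_wiener \<Omega>) T \<and> (\<forall>f\<in>hankel_domain \<Omega>. is_hankel \<Omega> \<phi> f (T f)))"

definition nehari_true :: "'a::euclidean_space set \<Rightarrow> bool" where
  "nehari_true \<Omega> \<longleftrightarrow>
     (\<forall>\<phi>. tempered_distribution \<phi> \<and> generates_bounded_hankel \<Omega> \<phi> \<longrightarrow>
        (\<exists>\<psi>\<in>Linfty. distribution_eq_on ((\<lambda>x. 2 *\<^sub>R x) ` \<Omega>)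
            (fourier_distribution \<phi>) (fourier_distribution (regular_distribution \<psi>))))"

definition supporting_hyperplane_at :: "'a::euclidean_space set \<Rightarrow> 'a \<Rightarrow> 'a set \<Rightarrow> bool" where
  "supporting_hyperplane_at K x H \<longleftrightarrow>
     (\<exists>a t. a \<noteq> 0 \<and> H = {y. y \<bullet> a = t} \<and> x \<in> H \<and> K \<subseteq> {y. y \<bullet> a \<le> t})"

definition exposed_points :: "'a::euclidean_space set \<Rightarrow> 'a set" where
  "exposed_points K = {x \<in> frontier K. \<exists>H. supporting_hyperplane_at K x H \<and> K \<inter> H = {x}}"

end

theory Submission
  imports Defs "HOL-Probability.Characteristic_Functions" "HOL-Probability.Sinc_Integral"
begin

text \<open>Choose exposed points \<open>p\<^sub>j\<close> of the closure of \<open>\<Omega>\<close> with disjoint neighbourhoods, and points \<open>z\<^sub>j\<close> of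
  \<open>\<Omega>\<close> so close to \<open>p\<^sub>j\<close> that the sets \<open>\<Omega> \<inter> (2 z\<^sub>j - \<Omega>)\<close> are disjoint. The symbol with transform
  \<open>\<Sum>\<^sub>j (\<delta>\<^bsub>2 z\<^sub>j\<^esub> - \<delta>\<^bsub>2 p\<^sub>j\<^esub>)\<close> is a tempered distribution because \<open>|z\<^sub>j - p\<^sub>j| \<le> 2\<^sup>-\<^sup>j\<close>; the masses at \<open>2 p\<^sub>j\<close>
  are there only for convergence and are invisible in \<open>2 \<Omega>\<close>. On the Fourier side its Hankel
  operator reflects each of the disjoint sets about its centre \<open>z\<^sub>j\<close>, so it has norm at most 1.
  If there were a bounded symbol \<open>\<psi>\<close>, testing it against the sum of \<open>N\<close> equal tiny bumps centred at
  \<open>2 z\<^sub>0, \<dots>, 2 z\<^bsub>N-1\<^esub>\<close> would give a multiple of \<open>N\<close>, while the \<open>L\<^sup>1\<close> norm of the Fourier transform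
  of that sum is only of order \<open>\<surd>N\<close>, uniformly in the size of the bumps.\<close>

subsection \<open>Integration over Euclidean space\<close>

text \<open>A mass at 2 z interacts only with pairs of points of \<Omega> whose midpoint is z, so
  \<open>overlap\<close> is what one mass sees. The square-root saving is an orthogonality effect.
  The transform of a sum of translated bumps is one exponential sum S times the transform of a
  single bump. One derivative per coordinate bounds the latter by a fixed square-integrable weight
  times the transform of some g supported in the same ball. After multiplication by S,
  Cauchy-Schwarz and Plancherel reduce the L1 norm to the L2 norm of a sum of disjoint translates of
  g. Dilation preserves the L1 norm of a transform, so the bumps may shrink with N at no cost. Two
  features of the definitions shape the rest. A symbol meets a test function only through
  \<open>fourier\<close>, so the symbol is built on an inversion valid for the transform of every
  bounded continuous integrable function, whatever its decay. And \<open>fourier_L2\<close> is an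
  arbitrary choice, fixed only almost everywhere, so isometry, existence, uniqueness and
  surjectivity on L2 have to be in place before the reflection on the Fourier side becomes an
  operator on the Paley-Wiener space.\<close>

lemma
  fixes f :: "'a::euclidean_space \<Rightarrow> real \<Rightarrow> 'b::{real_normed_field,banach,second_countable_topology}"
  assumes int: "\<And>b. b \<in> Basis \<Longrightarrow> integrable lborel (f b)"
  shows integrable_lborel_prod_Basis: "integrable lborel (\<lambda>x. \<Prod>b\<in>Basis. f b (x \<bullet> b))"
    and integral_lborel_prod_Basis:
      "(\<integral>x. (\<Prod>b\<in>Basis. f b (x \<bullet> b)) \<partial>lborel) = (\<Prod>b\<in>Basis. \<integral>t. f b t \<partial>lborel)"
proof -
  interpret product_sigma_finite "\<lambda>_::'a. lborel :: real measure"
    by standard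
  have [measurable]: "b \<in> Basis \<Longrightarrow> f b \<in> borel_measurable borel" for b
    using int by (auto dest: borel_measurable_integrable)
  have [measurable]: "(\<lambda>x::'a. \<Prod>b\<in>Basis. f b (x \<bullet> b)) \<in> borel_measurable borel"
    by (intro borel_measurable_prod) measurable
  have T: "(\<lambda>u. \<Sum>b\<in>Basis. u b *\<^sub>R b) \<in> (\<Pi>\<^sub>M b\<in>(Basis::'a set). lborel) \<rightarrow>\<^sub>M borel"
    by measurable
  have comp: "(\<Prod>b\<in>Basis. f b ((\<Sum>c\<in>Basis. u c *\<^sub>R c) \<bullet> b)) = (\<Prod>b\<in>(Basis::'a set). f b (u b))" for u
    by (intro prod.cong refl) simp
  have "integrable (\<Pi>\<^sub>M b\<in>(Basis::'a set). lborel) (\<lambda>u. \<Prod>b\<in>Basis. f b (u b))"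
    by (rule product_integrable_prod) (use int in auto)
  then show "integrable lborel (\<lambda>x. \<Prod>b\<in>Basis. f b (x \<bullet> b))"
    by (subst lborel_eq, subst integrable_distr_eq[OF T]) (simp_all add: comp)
  have "(\<integral>u. (\<Prod>b\<in>Basis. f b (u b)) \<partial>(\<Pi>\<^sub>M b\<in>(Basis::'a set). lborel)) = (\<Prod>b\<in>Basis. \<integral>t. f b t \<partial>lborel)"
    by (rule product_integral_prod) (use int in auto)
  then show "(\<integral>x. (\<Prod>b\<in>Basis. f b (x \<bullet> b)) \<partial>lborel) = (\<Prod>b\<in>Basis. \<integral>t. f b t \<partial>lborel)"
    by (subst lborel_eq, subst integral_distr[OF T]) (simp_all add: comp)
qed

lemma
  fixes f :: "'a::euclidean_space \<Rightarrow> 'b::{banach,second_countable_topology}"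
  assumes c: "c \<noteq> 0" and [measurable]: "f \<in> borel_measurable borel"
  shows integrable_lborel_affine: "integrable lborel (\<lambda>x. f (t + c *\<^sub>R x)) \<longleftrightarrow> integrable lborel f"
    and integral_lborel_affine:
      "\<bar>c\<bar> ^ DIM('a) *\<^sub>R (\<integral>x. f (t + c *\<^sub>R x) \<partial>lborel) = (\<integral>x. f x \<partial>lborel)"
proof -
  have eq: "(lborel :: 'a measure) = density (distr lborel borel (\<lambda>x. t + c *\<^sub>R x)) (\<lambda>_. ennreal (\<bar>c\<bar> ^ DIM('a)))"
    using lborel_affine[OF c, of t] by (simp add: ennreal_power)
  have "integrable lborel f \<longleftrightarrow>
      integrable (density (distr lborel borel (\<lambda>x. t + c *\<^sub>R x)) (\<lambda>_. ennreal (\<bar>c\<bar> ^ DIM('a)))) f"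
    by (simp only: eq[symmetric])
  then show "integrable lborel (\<lambda>x. f (t + c *\<^sub>R x)) \<longleftrightarrow> integrable lborel f"
    using c integrable_scaleR_right[of "\<bar>c\<bar> ^ DIM('a)" lborel "\<lambda>x. f (t + c *\<^sub>R x)"]
      integrable_scaleR_right[of "inverse (\<bar>c\<bar> ^ DIM('a))" lborel "\<lambda>x. \<bar>c\<bar> ^ DIM('a) *\<^sub>R f (t + c *\<^sub>R x)"]
    by (auto simp: integrable_density integrable_distr_eq)
  have "integral\<^sup>L lborel f =
      integral\<^sup>L (density (distr lborel borel (\<lambda>x. t + c *\<^sub>R x)) (\<lambda>_. ennreal (\<bar>c\<bar> ^ DIM('a)))) f"
    by (simp only: eq[symmetric])
  then show "\<bar>c\<bar> ^ DIM('a) *\<^sub>R (\<integral>x. f (t + c *\<^sub>R x) \<partial>lborel) = (\<integral>x. f x \<partial>lborel)"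
    using c by (simp add: integral_density integral_distr)
qed

lemma nn_integral_lborel_reflect:
  fixes t :: "'a::euclidean_space"
  assumes [measurable]: "f \<in> borel_measurable borel"
  shows "(\<integral>\<^sup>+x. f (t - x) \<partial>lborel) = (\<integral>\<^sup>+x. f x \<partial>lborel)"
proof -
  have eq: "(lborel :: 'a measure) = distr lborel borel (\<lambda>x. t - x)"
    using lborel_affine[of "-1" t] by (simp add: density_1)
  show ?thesis
    by (subst (2) eq) (simp add: nn_integral_distr)
qed

lemma integrable_mult_bounded:
  fixes f g :: "'a \<Rightarrow> complex"
  assumes "integrable M f" and [measurable]: "g \<in> borel_measurable M" and "\<And>x. norm (g x) \<le> B"
  shows "integrable M (\<lambda>x. f x * g x)"
proof (rule Bochner_Integration.integrable_bound)
  show "integrable M (\<lambda>x. B * norm (f x))"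
    using assms by auto
  show "AE x in M. norm (f x * g x) \<le> norm (B * norm (f x))"
  proof (rule AE_I2)
    fix x
    have "0 \<le> B" using assms(3)[of x] norm_ge_zero order_trans by blast
    then show "norm (f x * g x) \<le> norm (B * norm (f x))"
      using mult_right_mono[OF assms(3)[of x], of "norm (f x)"] by (simp add: norm_mult mult.commute)
  qed
  show "(\<lambda>x. f x * g x) \<in> borel_measurable M"
    using assms by auto
qed

lemma integrable_product_fst_snd:
  fixes f :: "'a::euclidean_space \<Rightarrow> complex" and g :: "'b::euclidean_space \<Rightarrow> complex"
  assumes f: "integrable lborel f" and g: "integrable lborel g"
  shows "integrable (lborel \<Otimes>\<^sub>M lborel) (\<lambda>(x, y). f x * g y)"
proof (rule lborel_pair.Fubini_integrable)
  have [measurable]: "f \<in> borel_measurable borel" "g \<in> borel_measurable borel"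
    using f g by (auto dest: borel_measurable_integrable)
  show "(\<lambda>(x, y). f x * g y) \<in> borel_measurable (lborel \<Otimes>\<^sub>M lborel)"
    by measurable
  show "integrable lborel (\<lambda>x. \<integral>y. norm (case (x, y) of (x, y) \<Rightarrow> f x * g y) \<partial>lborel)"
    using f by (simp add: norm_mult)
  show "AE x in lborel. integrable lborel (\<lambda>y. case (x, y) of (x, y) \<Rightarrow> f x * g y)"
    using g by simp
qed

lemma integrable_product_bounded:
  fixes f :: "'a::euclidean_space \<Rightarrow> complex" and g :: "'b::euclidean_space \<Rightarrow> complex"
  assumes f: "integrable lborel f" and g: "integrable lborel g"
    and [measurable]: "case_prod h \<in> borel_measurable (borel \<Otimes>\<^sub>M borel)"
    and "\<And>x y. norm (h x y) \<le> B"
  shows "integrable (lborel \<Otimes>\<^sub>M lborel) (\<lambda>(x, y). f x * g y * h x y)"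
proof -
  have "integrable (lborel \<Otimes>\<^sub>M lborel) (\<lambda>p. (case p of (x, y) \<Rightarrow> f x * g y) * case_prod h p)"
    by (rule integrable_mult_bounded[OF integrable_product_fst_snd[OF f g], where B=B])
      (use assms in auto)
  then show ?thesis
    by (simp add: case_prod_unfold)
qed

lemma integrable_inverse_one_plus_square: "integrable lborel (\<lambda>t::real. inverse (1 + t\<^sup>2))"
  using integrable_inverse_1_plus_square by (simp add: set_integrable_def)

text \<open>A product over coordinates: its integral splits into one-dimensional ones, and its
  inverse is a product of factors that first derivatives in the coordinate directions can
  supply.\<close>

definition decay_weight :: "'a::euclidean_space \<Rightarrow> real" where
  "decay_weight x = (\<Prod>b\<in>Basis. inverse (1 + (x \<bullet> b)\<^sup>2))"

lemma integrable_decay_weight: "integrable lborel decay_weight"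
  unfolding decay_weight_def[abs_def]
  by (rule integrable_lborel_prod_Basis) (rule integrable_inverse_one_plus_square)

lemma one_plus_square_pos: "0 < 1 + (t::real)\<^sup>2"
  by (simp add: add_pos_nonneg)

lemma decay_weight_pos: "0 < decay_weight x"
  unfolding decay_weight_def by (intro prod_pos) (simp add: one_plus_square_pos)

lemma borel_measurable_decay_weight[measurable]: "decay_weight \<in> borel_measurable borel"
  using borel_measurable_integrable[OF integrable_decay_weight] by simp

text \<open>Each of the n = \<open>DIM('a)\<close> factors is controlled by |x . b| <= |x|.
  Splitting at norm 1 leaves only the powers 0 and 2 n + 1 of the norm, that is, the two Schwartz
  seminorms that later bound \<open>dipole_sum\<close>.\<close>

lemma polynomial_le_inverse_decay_weight:
  fixes x :: "'a::euclidean_space"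
  shows "(1 + norm x) * inverse (decay_weight x) \<le> 2 ^ (DIM('a) + 1) * (1 + norm x ^ (2 * DIM('a) + 1))"
proof -
  have "inverse (decay_weight x) = (\<Prod>b\<in>Basis. 1 + (x \<bullet> b)\<^sup>2)"
    unfolding decay_weight_def by (simp add: prod_inversef[symmetric])
  also have "\<dots> \<le> (\<Prod>b\<in>(Basis::'a set). 1 + (norm x)\<^sup>2)"
    by (intro prod_mono) (auto intro!: abs_le_square_iff[THEN iffD1] simp: Basis_le_norm)
  also have "\<dots> = (1 + (norm x)\<^sup>2) ^ DIM('a)"
    by simp
  finally have 1: "inverse (decay_weight x) \<le> (1 + (norm x)\<^sup>2) ^ DIM('a)" .
  show ?thesis
  proof (cases "norm x \<le> 1")
    case True
    then have "(1 + (norm x)\<^sup>2) ^ DIM('a) \<le> 2 ^ DIM('a)"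
      by (intro power_mono) (auto simp: power_le_one)
    then have "(1 + norm x) * inverse (decay_weight x) \<le> 2 * 2 ^ DIM('a)"
      using order_trans[OF 1] True by (intro mult_mono) (auto intro: less_imp_le[OF decay_weight_pos])
    also have "\<dots> \<le> 2 ^ (DIM('a) + 1) * (1 + norm x ^ (2 * DIM('a) + 1))"
      by simp
    finally show ?thesis .
  next
    case False
    then have "1 \<le> (norm x)\<^sup>2" by (simp add: one_le_power)
    then have "(1 + (norm x)\<^sup>2) ^ DIM('a) \<le> (2 * (norm x)\<^sup>2) ^ DIM('a)"
      by (intro power_mono) auto
    then have "(1 + norm x) * inverse (decay_weight x) \<le> (2 * norm x) * (2 * (norm x)\<^sup>2) ^ DIM('a)"
      using 1 False by (intro mult_mono) (auto intro: less_imp_le[OF decay_weight_pos])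
    also have "\<dots> = 2 ^ (DIM('a) + 1) * norm x ^ (2 * DIM('a) + 1)"
      by (simp add: power_mult_distrib power_mult)
    also have "\<dots> \<le> 2 ^ (DIM('a) + 1) * (1 + norm x ^ (2 * DIM('a) + 1))"
      by simp
    finally show ?thesis .
  qed
qed

subsection \<open>Plane waves and Gaussians\<close>

definition wave :: "'a::euclidean_space \<Rightarrow> 'a \<Rightarrow> complex" where
  "wave a x = cis (2 * pi * (a \<bullet> x))"

lemma norm_wave[simp]: "norm (wave a x) = 1"
  by (simp add: wave_def)

lemma wave_commute: "wave a x = wave x a"
  by (simp add: wave_def inner_commute)

lemma wave_0[simp]: "wave 0 x = 1" "wave a 0 = 1"
  by (simp_all add: wave_def)

lemma wave_add_left: "wave (a + b) x = wave a x * wave b x"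
  by (simp add: wave_def cis_mult inner_add_left distrib_left)

lemma wave_add_right: "wave a (x + y) = wave a x * wave a y"
  by (simp add: wave_def cis_mult inner_add_right distrib_left)

lemma wave_minus_left: "wave (- a) x = cnj (wave a x)"
  by (simp add: wave_def cis_cnj)

lemma wave_minus_right: "wave a (- x) = cnj (wave a x)"
  by (simp add: wave_def cis_cnj)

lemma wave_diff_left: "wave (a - b) x = wave a x * cnj (wave b x)"
  using wave_add_left[of a "- b"] by (simp add: wave_minus_left)

lemma wave_scaleR: "wave (c *\<^sub>R a) x = wave a (c *\<^sub>R x)"
  by (simp add: wave_def)

lemma borel_measurable_wave[measurable (raw)]:
  "f \<in> borel_measurable M \<Longrightarrow> g \<in> borel_measurable M \<Longrightarrow> (\<lambda>x. wave (f x) (g x)) \<in> borel_measurable M"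
  unfolding wave_def cis_conv_exp by measurable

lemma norm_wave_diff_le: "norm (wave a x - wave b x) \<le> 2 * pi * norm (a - b) * norm x"
proof -
  have "wave a x - wave b x = wave b x * (cis (2 * pi * ((a - b) \<bullet> x)) - 1)"
    by (simp add: wave_def cis_mult algebra_simps)
  then have "norm (wave a x - wave b x) = norm (cis (2 * pi * ((a - b) \<bullet> x)) - 1)"
    by (simp add: norm_mult)
  also have "\<dots> \<le> \<bar>2 * pi * ((a - b) \<bullet> x)\<bar>"
    using iexp_approx1[of "2 * pi * ((a - b) \<bullet> x)" 0]
    by (simp add: cis_conv_exp)
  also have "\<dots> = 2 * pi * \<bar>(a - b) \<bullet> x\<bar>"
    by (simp add: abs_mult)
  also have "\<dots> \<le> 2 * pi * (norm (a - b) * norm x)"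
    by (intro mult_left_mono Cauchy_Schwarz_ineq2) auto
  finally show ?thesis by (simp add: mult.assoc)
qed

lemma fourier_eq_wave: "fourier f x = (\<integral>y. f y * wave (- x) y \<partial>lborel)"
  unfolding fourier_def wave_def cis_conv_exp by (simp add: algebra_simps)

lemma sum_Basis_inner_squared: "(\<Sum>b\<in>Basis. (x \<bullet> b)\<^sup>2) = (norm x)\<^sup>2"
  unfolding power2_norm_eq_inner by (subst euclidean_inner) (simp add: power2_eq_square)

text \<open>The standard normal density has mass 1, and its characteristic function is known in each
  coordinate; \<open>gaussian_window\<close> is that characteristic function.\<close>

definition gaussian :: "'a::euclidean_space \<Rightarrow> real" where
  "gaussian x = (\<Prod>b\<in>Basis. std_normal_density (x \<bullet> b))"

definition gaussian_window :: "'a::euclidean_space \<Rightarrow> real" where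
  "gaussian_window x = exp (- (norm x)\<^sup>2 / 2)"

lemma gaussian_eq_window:
  fixes x :: "'a::euclidean_space"
  shows "gaussian x = (1 / sqrt (2 * pi)) ^ DIM('a) * gaussian_window x"
proof -
  have "(\<Prod>b\<in>Basis. exp (- (x \<bullet> b)\<^sup>2 / 2)) = exp (\<Sum>b\<in>Basis. - (x \<bullet> b)\<^sup>2 / 2)"
    by (simp add: exp_sum)
  also have "(\<Sum>b\<in>Basis. - (x \<bullet> b)\<^sup>2 / 2) = - (norm x)\<^sup>2 / 2"
    by (simp add: sum_negf sum_divide_distrib[symmetric] sum_Basis_inner_squared)
  finally show ?thesis
    unfolding gaussian_def gaussian_window_def std_normal_density_def prod.distrib by simp
qed

lemma borel_measurable_gaussian[measurable]: "gaussian \<in> borel_measurable borel"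
  unfolding gaussian_def[abs_def] by measurable

lemma gaussian_nonneg: "0 \<le> gaussian x"
  unfolding gaussian_def by (intro prod_nonneg) auto

lemma gaussian_window_pos: "0 < gaussian_window x"
  by (simp add: gaussian_window_def)

lemma gaussian_window_le_1: "gaussian_window x \<le> 1"
  by (simp add: gaussian_window_def)

lemma borel_measurable_gaussian_window[measurable]: "gaussian_window \<in> borel_measurable borel"
  unfolding gaussian_window_def[abs_def] by measurable

lemma integrable_gaussian: "integrable lborel (gaussian :: 'a::euclidean_space \<Rightarrow> real)"
  and integral_gaussian: "integral\<^sup>L lborel (gaussian :: 'a::euclidean_space \<Rightarrow> real) = 1"
proof -
  have 1: "integrable lborel std_normal_density" "(\<integral>x. std_normal_density x \<partial>lborel) = 1"
    by (auto intro: integrable_normal_density simp: integral_normal_density)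
  then show "integrable lborel (gaussian :: 'a \<Rightarrow> real)"
    unfolding gaussian_def[abs_def] by (intro integrable_lborel_prod_Basis) auto
  show "integral\<^sup>L lborel (gaussian :: 'a \<Rightarrow> real) = 1"
    unfolding gaussian_def[abs_def] using 1 by (subst integral_lborel_prod_Basis) auto
qed

lemma integral_gaussian_cis:
  fixes s :: "'a::euclidean_space"
  shows "(\<integral>u. complex_of_real (gaussian u) * cis (s \<bullet> u) \<partial>lborel) = complex_of_real (gaussian_window s)"
proof -
  have cis_int: "integrable lborel (\<lambda>t. complex_of_real (std_normal_density t) * cis (r * t))" for r
    by (rule integrable_mult_bounded[where B=1])
      (auto intro: integrable_normal_density simp: cis_conv_exp)
  have cis: "(\<integral>t. complex_of_real (std_normal_density t) * cis (r * t) \<partial>lborel) = exp (- r\<^sup>2 / 2)" for r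
  proof -
    have "char std_normal_distribution r = exp (- r\<^sup>2 / 2)"
      by (simp add: char_std_normal_distribution)
    then show ?thesis
      unfolding char_def
      by (subst (asm) integral_density) (auto simp: scaleR_conv_of_real cis_conv_exp)
  qed
  have "complex_of_real (gaussian u) * cis (s \<bullet> u) =
      (\<Prod>b\<in>Basis. complex_of_real (std_normal_density (u \<bullet> b)) * cis ((s \<bullet> b) * (u \<bullet> b)))" for u
    unfolding gaussian_def prod.distrib euclidean_inner[of s u]
    by (simp add: cis_conv_exp sum_distrib_left exp_sum)
  then have "(\<integral>u. complex_of_real (gaussian u) * cis (s \<bullet> u) \<partial>lborel) =
      (\<Prod>b\<in>Basis. \<integral>t. complex_of_real (std_normal_density t) * cis ((s \<bullet> b) * t) \<partial>lborel)"
    by (simp only:, subst integral_lborel_prod_Basis) (auto simp: cis_int)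
  also have "\<dots> = (\<Prod>b\<in>Basis. complex_of_real (exp (- (s \<bullet> b)\<^sup>2 / 2)))"
    by (simp add: cis)
  also have "\<dots> = complex_of_real (exp (\<Sum>b\<in>Basis. - (s \<bullet> b)\<^sup>2 / 2))"
    by (simp add: exp_sum)
  also have "(\<Sum>b\<in>Basis. - (s \<bullet> b)\<^sup>2 / 2) = - (norm s)\<^sup>2 / 2"
    by (simp add: sum_negf sum_divide_distrib[symmetric] sum_Basis_inner_squared)
  finally show ?thesis
    by (simp add: gaussian_window_def)
qed

subsection \<open>Gauss-Weierstrass summation of the Fourier integral\<close>

abbreviation gaussian_mean :: "('a::euclidean_space \<Rightarrow> complex) \<Rightarrow> real \<Rightarrow> 'a \<Rightarrow> complex" where
  "gaussian_mean g e x \<equiv> (\<integral>w. g (x - e *\<^sub>R w) * complex_of_real (gaussian w) \<partial>lborel)"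

lemma integrable_window:
  assumes "c \<noteq> 0"
  shows "integrable lborel (\<lambda>y::'a::euclidean_space. complex_of_real (gaussian_window (c *\<^sub>R y)))"
proof -
  have eq: "gaussian_window = (\<lambda>u::'a. sqrt (2 * pi) ^ DIM('a) * gaussian u)"
    by (simp add: gaussian_eq_window power_divide)
  have "integrable lborel (gaussian_window :: 'a \<Rightarrow> real)"
    by (subst eq) (simp add: integrable_gaussian)
  then show ?thesis
    using integrable_lborel_affine[OF assms, of "gaussian_window :: 'a \<Rightarrow> real" 0] by simp
qed

text \<open>Window and density differ by the factor \<open>sqrt (2 * pi) ^ DIM('a)\<close>, so the
  characteristic function of the density can be used with the roles exchanged. In the Jacobian of u
  = 2 pi e y, the power of 2 pi cancels the two square roots and the power of e normalises the
  density at scale e.\<close>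

lemma integral_gaussian_window_wave:
  fixes v :: "'a::euclidean_space"
  assumes e: "0 < e"
  shows "(\<integral>y. complex_of_real (gaussian_window ((2 * pi * e) *\<^sub>R y)) * wave v y \<partial>lborel) =
    complex_of_real (gaussian ((1 / e) *\<^sub>R v) / e ^ DIM('a))"
proof -
  let ?n = "DIM('a)"
  define F where "F u = complex_of_real (gaussian_window u) * cis (((1 / e) *\<^sub>R v) \<bullet> u)" for u
  have [measurable]: "F \<in> borel_measurable borel"
    unfolding F_def[abs_def] cis_conv_exp by measurable
  have window: "gaussian_window u = sqrt (2 * pi) ^ ?n * gaussian u" for u :: 'a
    by (simp add: gaussian_eq_window power_divide)
  have "(\<integral>u. F u \<partial>lborel) =
      complex_of_real (sqrt (2 * pi) ^ ?n) * (\<integral>u. complex_of_real (gaussian u) * cis (((1 / e) *\<^sub>R v) \<bullet> u) \<partial>lborel)"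
    unfolding F_def window by (simp add: mult.assoc)
  also have "\<dots> = complex_of_real (sqrt (2 * pi) ^ ?n * (sqrt (2 * pi) ^ ?n * gaussian ((1 / e) *\<^sub>R v)))"
    unfolding integral_gaussian_cis window by simp
  also have "sqrt (2 * pi) ^ ?n * (sqrt (2 * pi) ^ ?n * gaussian ((1 / e) *\<^sub>R v)) =
      (sqrt (2 * pi) * sqrt (2 * pi)) ^ ?n * gaussian ((1 / e) *\<^sub>R v)"
    by (simp only: power_mult_distrib mult.assoc)
  also have "\<dots> = (2 * pi) ^ ?n * gaussian ((1 / e) *\<^sub>R v)"
    by simp
  finally have F_int: "(\<integral>u. F u \<partial>lborel) = complex_of_real ((2 * pi) ^ ?n * gaussian ((1 / e) *\<^sub>R v))" .
  have "\<bar>2 * pi * e\<bar> ^ ?n *\<^sub>R (\<integral>y. F (0 + (2 * pi * e) *\<^sub>R y) \<partial>lborel) = (\<integral>u. F u \<partial>lborel)"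
    by (rule integral_lborel_affine) (use e in auto)
  moreover have "F (0 + (2 * pi * e) *\<^sub>R y) = complex_of_real (gaussian_window ((2 * pi * e) *\<^sub>R y)) * wave v y" for y
    using e by (simp add: F_def wave_def mult.assoc)
  ultimately have "complex_of_real ((2 * pi * e) ^ ?n) *
      (\<integral>y. complex_of_real (gaussian_window ((2 * pi * e) *\<^sub>R y)) * wave v y \<partial>lborel) =
      complex_of_real ((2 * pi) ^ ?n * gaussian ((1 / e) *\<^sub>R v))"
    using F_int e by (simp add: scaleR_conv_of_real)
  then show ?thesis
    using e by (simp add: field_simps power_mult_distrib)
qed

lemma borel_measurable_fourier[measurable]:
  assumes [measurable]: "f \<in> borel_measurable borel"
  shows "fourier f \<in> borel_measurable borel"
  unfolding fourier_eq_wave[abs_def] by measurable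

lemma norm_fourier_le: "norm (fourier f x) \<le> (\<integral>y. norm (f y) \<partial>lborel)"
  unfolding fourier_eq_wave using integral_norm_bound[of lborel "\<lambda>y. f y * wave (- x) y"]
  by (simp add: norm_mult)

lemma integrable_mult_wave:
  "integrable lborel f \<Longrightarrow> integrable lborel (\<lambda>y. f y * wave x y)"
  by (rule integrable_mult_bounded[where B=1]) auto

text \<open>Once \<open>fourier g\<close> is unfolded, the double integral of g against the
  integrable window converges absolutely, even when \<open>fourier g\<close> is not integrable.
  Integrating the window first leaves the convolution of g with a Gaussian of width e.\<close>

lemma integral_fourier_window:
  fixes g :: "'a::euclidean_space \<Rightarrow> complex"
  assumes g: "integrable lborel g" and e: "0 < e"
  shows "(\<integral>y. fourier g y * complex_of_real (gaussian_window ((2 * pi * e) *\<^sub>R y)) * wave x y \<partial>lborel) =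
    (gaussian_mean g e x)"
proof -
  let ?n = "DIM('a)" and ?W = "\<lambda>y::'a. complex_of_real (gaussian_window ((2 * pi * e) *\<^sub>R y))"
  have [measurable]: "g \<in> borel_measurable borel"
    using g by (auto dest: borel_measurable_integrable)
  have e': "2 * pi * e \<noteq> 0" using e by simp
  have W: "integrable lborel ?W"
    by (rule integrable_window[OF e'])
  have int: "integrable (lborel \<Otimes>\<^sub>M lborel) (\<lambda>(v, y). g v * ?W y * wave (x - v) y)"
    by (rule integrable_product_bounded[OF g W, where B=1]) auto
  have "(\<integral>y. fourier g y * ?W y * wave x y \<partial>lborel) = (\<integral>y. (\<integral>v. g v * ?W y * wave (x - v) y \<partial>lborel) \<partial>lborel)"
  proof (rule Bochner_Integration.integral_cong[OF refl])
    fix y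
    have "fourier g y * ?W y * wave x y = (\<integral>v. g v * wave (- y) v * (?W y * wave x y) \<partial>lborel)"
      unfolding fourier_eq_wave by (subst integral_mult_left_zero) (simp only: mult.assoc)
    also have "\<dots> = (\<integral>v. g v * ?W y * wave (x - v) y \<partial>lborel)"
      by (intro Bochner_Integration.integral_cong refl)
        (simp add: wave_diff_left wave_minus_left wave_commute[of y])
    finally show "fourier g y * ?W y * wave x y = (\<integral>v. g v * ?W y * wave (x - v) y \<partial>lborel)" .
  qed
  also have "\<dots> = (\<integral>v. (\<integral>y. g v * ?W y * wave (x - v) y \<partial>lborel) \<partial>lborel)"
    using int by (rule lborel_pair.Fubini_integral)
  also have "\<dots> = (\<integral>v. g v * complex_of_real (gaussian ((1 / e) *\<^sub>R (x - v)) / e ^ ?n) \<partial>lborel)"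
    unfolding mult.assoc integral_gaussian_window_wave[OF e, symmetric]
    by (intro Bochner_Integration.integral_cong refl) simp
  also have "\<dots> = \<bar>- e\<bar> ^ ?n *\<^sub>R
      (\<integral>w. g (x + (- e) *\<^sub>R w) * complex_of_real (gaussian ((1 / e) *\<^sub>R (x - (x + (- e) *\<^sub>R w))) / e ^ ?n) \<partial>lborel)"
    by (rule integral_lborel_affine[symmetric]) (use e in auto)
  also have "\<dots> = (gaussian_mean g e x)"
    using e by (simp add: scaleR_conv_of_real)
  finally show ?thesis .
qed

lemma gaussian_mean_tendsto:
  fixes g :: "'a::euclidean_space \<Rightarrow> complex"
  assumes cont: "continuous_on UNIV g" and bound: "\<And>x. norm (g x) \<le> B" and e: "e \<longlonglongrightarrow> 0"
  shows "(\<lambda>k. gaussian_mean g (e k) x) \<longlonglongrightarrow> g x"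
proof -
  have [measurable]: "g \<in> borel_measurable borel"
    using cont by (rule borel_measurable_continuous_onI)
  have "(\<lambda>k. gaussian_mean g (e k) x) \<longlonglongrightarrow>
      (\<integral>w. g x * complex_of_real (gaussian (w::'a)) \<partial>lborel)"
  proof (rule integral_dominated_convergence)
    show "integrable lborel (\<lambda>w::'a. B * gaussian w)"
      by (simp add: integrable_gaussian)
    show "AE w in lborel. (\<lambda>k. g (x - e k *\<^sub>R w) * complex_of_real (gaussian w)) \<longlonglongrightarrow> g x * complex_of_real (gaussian w)"
    proof (intro AE_I2 tendsto_mult tendsto_const)
      fix w
      have "(\<lambda>k. x - e k *\<^sub>R w) \<longlonglongrightarrow> x"
        using e by (auto intro!: tendsto_eq_intros)
      then show "(\<lambda>k. g (x - e k *\<^sub>R w)) \<longlonglongrightarrow> g x"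
        using cont by (intro isCont_tendsto_compose[of x g]) (auto simp: continuous_on_eq_continuous_at)
    qed
    show "AE w in lborel. norm (g (x - e k *\<^sub>R w) * complex_of_real (gaussian w)) \<le> B * gaussian w" for k
      by (intro AE_I2) (simp add: norm_mult gaussian_nonneg mult_right_mono bound)
  qed measurable
  moreover have "(\<integral>w. g x * complex_of_real (gaussian (w::'a)) \<partial>lborel) = g x"
    by (simp add: integral_gaussian)
  ultimately show ?thesis by (simp only:)
qed

abbreviation window :: "nat \<Rightarrow> 'a::euclidean_space \<Rightarrow> real" where
  "window k y \<equiv> gaussian_window ((2 * pi * inverse (real (Suc k))) *\<^sub>R y)"

text \<open>Gauss-Weierstrass summation instead of the plain integral. It agrees with the integral
  for integrable F, and it also inverts transforms whose integrability is not known.\<close>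

definition fourier_inverse :: "('a::euclidean_space \<Rightarrow> complex) \<Rightarrow> 'a \<Rightarrow> complex" where
  "fourier_inverse F x =
    lim (\<lambda>k. \<integral>y. F y * complex_of_real (window k y) * wave x y \<partial>lborel)"

text \<open>The transform of \<open>g\<close> need not be integrable here; this is what the window is for.\<close>

lemma fourier_inverse_fourier:
  assumes "continuous_on UNIV g" "\<And>x. norm (g x) \<le> B" "integrable lborel g"
  shows "fourier_inverse (fourier g) x = g x"
  unfolding fourier_inverse_def
  using gaussian_mean_tendsto[OF assms(1,2) LIMSEQ_inverse_real_of_nat]
  by (intro limI) (simp add: integral_fourier_window[OF assms(3)])

lemma window_tendsto:
  "(\<lambda>k. window k y) \<longlonglongrightarrow> 1"
proof -
  have "(\<lambda>k. exp (- (2 * pi * inverse (real (Suc k)) * norm y)\<^sup>2 / 2)) \<longlonglongrightarrow> exp (- (2 * pi * 0 * norm y)\<^sup>2 / 2)"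
    by (intro tendsto_intros LIMSEQ_inverse_real_of_nat) auto
  then show ?thesis
    by (simp add: gaussian_window_def abs_mult)
qed

lemma fourier_inverse_eq_integral:
  fixes F :: "'a::euclidean_space \<Rightarrow> complex"
  assumes "integrable lborel F"
  shows "fourier_inverse F x = (\<integral>y. F y * wave x y \<partial>lborel)"
  unfolding fourier_inverse_def
proof (rule limI, rule integral_dominated_convergence)
  have [measurable]: "F \<in> borel_measurable borel"
    using assms by (auto dest: borel_measurable_integrable)
  show "(\<lambda>y. F y * wave x y) \<in> borel_measurable lborel"
    "(\<lambda>y. F y * complex_of_real (window k y) * wave x y)
      \<in> borel_measurable lborel" for k
    by measurable
  show "integrable lborel (\<lambda>y. norm (F y))"
    using assms by auto
  show "AE y in lborel. (\<lambda>k. F y * complex_of_real (window k y) * wave x y)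
      \<longlonglongrightarrow> F y * wave x y"
  proof (rule AE_I2)
    fix y :: 'a
    have "(\<lambda>k. F y * complex_of_real (window k y) * wave x y)
        \<longlonglongrightarrow> F y * complex_of_real 1 * wave x y"
      by (intro tendsto_intros window_tendsto)
    then show "(\<lambda>k. F y * complex_of_real (window k y) * wave x y)
        \<longlonglongrightarrow> F y * wave x y" by simp
  qed
  show "AE y in lborel. norm (F y * complex_of_real (window k y) * wave x y)
      \<le> norm (F y)" for k
  proof (rule AE_I2)
    fix y :: 'a
    have "0 \<le> window k y"
      by (rule less_imp_le[OF gaussian_window_pos])
    then show "norm (F y * complex_of_real (window k y) * wave x y)
        \<le> norm (F y)"
      by (simp add: norm_mult mult_left_le gaussian_window_le_1 del: of_nat_Suc)
  qed
qed

subsection \<open>Plancherel for bounded continuous integrable functions\<close>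

definition nice :: "('a::euclidean_space \<Rightarrow> complex) \<Rightarrow> bool" where
  "nice g \<longleftrightarrow> continuous_on UNIV g \<and> (\<exists>B. \<forall>x. norm (g x) \<le> B) \<and> integrable lborel g"

text \<open>The windowed energy of \<open>fourier g\<close> equals, by Fubini, the pairing of g with
  its Gaussian means. As the window opens, the first increases to the energy of the transform and
  the second tends to that of g. Monotone convergence therefore gives square-integrability and the
  identity at once.\<close>

lemma
  assumes "nice g"
  shows nice_measurable: "g \<in> borel_measurable borel"
    and nice_L2: "g \<in> L2"
    and plancherel_nice: "fourier g \<in> L2" "(\<integral>y. (norm (fourier g y))\<^sup>2 \<partial>lborel) = (\<integral>x. (norm (g x))\<^sup>2 \<partial>lborel)"
proof -
  obtain B where cont: "continuous_on UNIV g" and B: "\<And>x. norm (g x) \<le> B" and g: "integrable lborel g"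
    using assms unfolding nice_def by auto
  have B0: "0 \<le> B" using B norm_ge_zero order_trans by blast
  have gm[measurable]: "g \<in> borel_measurable borel"
    using cont by (rule borel_measurable_continuous_onI)
  show "g \<in> borel_measurable borel" by fact
  have int2: "integrable lborel (\<lambda>x. (norm (g x))\<^sup>2)"
  proof (rule Bochner_Integration.integrable_bound[where f="\<lambda>x. B * norm (g x)"])
    show "AE x in lborel. norm ((norm (g x))\<^sup>2) \<le> norm (B * norm (g x))"
      using B B0 by (intro AE_I2) (simp add: power2_eq_square mult_right_mono)
  qed (use g in auto)
  then show "g \<in> L2"
    by (simp add: L2_def)
  define W where "W k y = window k y" for k and y :: 'a
  have [measurable]: "W k \<in> borel_measurable borel" for k
    unfolding W_def[abs_def] by measurable
  have Wb: "0 \<le> W k y" "W k y \<le> 1" for k y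
    by (simp_all add: W_def gaussian_window_le_1 less_imp_le[OF gaussian_window_pos])
  have W: "integrable lborel (\<lambda>y. complex_of_real (W k y))" for k
    unfolding W_def by (rule integrable_window) auto
  define M where "M = (\<integral>y. norm (g y) \<partial>lborel)"
  have M: "norm (fourier g y) \<le> M" for y
    unfolding M_def by (rule norm_fourier_le)
  have FW: "integrable lborel (\<lambda>y. fourier g y * complex_of_real (W k y))" for k
    using integrable_mult_bounded[OF W[of k], of "fourier g" M] M by (simp add: mult.commute)
  have cnj_int: "integrable lborel (\<lambda>x. cnj (g x))"
    using g by simp
  have [measurable]: "(\<lambda>x. cnj (g x)) \<in> borel_measurable borel"
    using borel_measurable_integrable[OF cnj_int] by simp
  have eq: "(\<integral>y. complex_of_real ((norm (fourier g y))\<^sup>2 * W k y) \<partial>lborel) =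
      (\<integral>x. cnj (g x) * (gaussian_mean g (inverse (real (Suc k))) x) \<partial>lborel)" for k
  proof -
    have int: "integrable (lborel \<Otimes>\<^sub>M lborel) (\<lambda>(x, y). cnj (g x) * (fourier g y * complex_of_real (W k y)) * wave x y)"
      by (rule integrable_product_bounded[OF cnj_int FW, where B=1]) auto
    have "(\<integral>y. complex_of_real ((norm (fourier g y))\<^sup>2 * W k y) \<partial>lborel) =
        (\<integral>y. (\<integral>x. cnj (g x) * (fourier g y * complex_of_real (W k y)) * wave x y \<partial>lborel) \<partial>lborel)"
    proof (rule Bochner_Integration.integral_cong[OF refl])
      fix y
      have "(\<integral>x. cnj (g x) * (fourier g y * complex_of_real (W k y)) * wave x y \<partial>lborel) =
          (\<integral>x. (fourier g y * complex_of_real (W k y)) * cnj (g x * wave (- y) x) \<partial>lborel)"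
        by (intro Bochner_Integration.integral_cong refl) (simp add: wave_minus_left wave_commute[of y])
      also have "\<dots> = fourier g y * complex_of_real (W k y) * cnj (fourier g y)"
        unfolding fourier_eq_wave[of g y] by (simp only: integral_mult_right_zero Bochner_Integration.integral_cnj)
      also have "\<dots> = complex_of_real ((norm (fourier g y))\<^sup>2 * W k y)"
        using complex_norm_square[of "fourier g y"] by (simp add: algebra_simps)
      finally show "complex_of_real ((norm (fourier g y))\<^sup>2 * W k y) =
          (\<integral>x. cnj (g x) * (fourier g y * complex_of_real (W k y)) * wave x y \<partial>lborel)" by simp
    qed
    also have "\<dots> = (\<integral>x. (\<integral>y. cnj (g x) * (fourier g y * complex_of_real (W k y)) * wave x y \<partial>lborel) \<partial>lborel)"
      using int by (rule lborel_pair.Fubini_integral)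
    also have "\<dots> = (\<integral>x. cnj (g x) * (\<integral>y. fourier g y * complex_of_real (W k y) * wave x y \<partial>lborel) \<partial>lborel)"
      by (simp add: mult.assoc)
    also have "\<dots> = (\<integral>x. cnj (g x) * (gaussian_mean g (inverse (real (Suc k))) x) \<partial>lborel)"
      unfolding W_def by (subst integral_fourier_window[OF g]) auto
    finally show ?thesis .
  qed
  have "(\<lambda>k. \<integral>x. cnj (g x) * (gaussian_mean g (inverse (real (Suc k))) x) \<partial>lborel)
      \<longlonglongrightarrow> (\<integral>x. cnj (g x) * g x \<partial>lborel)"
  proof (rule integral_dominated_convergence)
    show "integrable lborel (\<lambda>x. norm (g x) * B)"
      using g by auto
    show "AE x in lborel. (\<lambda>k. cnj (g x) * (gaussian_mean g (inverse (real (Suc k))) x))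
        \<longlonglongrightarrow> cnj (g x) * g x"
      by (intro AE_I2 tendsto_mult tendsto_const gaussian_mean_tendsto[OF cont B LIMSEQ_inverse_real_of_nat])
    show "AE x in lborel. norm (cnj (g x) * (gaussian_mean g (inverse (real (Suc k))) x))
        \<le> norm (g x) * B" for k
    proof (rule AE_I2)
      fix x
      have "norm (gaussian_mean g (inverse (real (Suc k))) x) \<le>
          (\<integral>w. B * gaussian (w::'a) \<partial>lborel)"
      proof (rule Bochner_Integration.integral_norm_bound_integral)
        have le: "norm (g (x - inverse (real (Suc k)) *\<^sub>R w) * complex_of_real (gaussian w)) \<le> B * gaussian w" for w
          by (simp add: norm_mult gaussian_nonneg mult_right_mono B)
        show int_B: "integrable lborel (\<lambda>w::'a. B * gaussian w)"
          by (simp add: integrable_gaussian)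
        show "integrable lborel (\<lambda>w. g (x - inverse (real (Suc k)) *\<^sub>R w) * complex_of_real (gaussian w))"
          by (rule Bochner_Integration.integrable_bound[OF int_B], measurable)
            (use le B0 in \<open>auto simp: gaussian_nonneg abs_mult intro!: AE_I2\<close>)
      qed (simp add: norm_mult gaussian_nonneg mult_right_mono B)
      then show "norm (cnj (g x) * (gaussian_mean g (inverse (real (Suc k))) x)) \<le> norm (g x) * B"
        by (simp add: norm_mult mult_left_mono integral_gaussian)
    qed
  qed measurable
  also have "(\<integral>x. cnj (g x) * g x \<partial>lborel) = complex_of_real (\<integral>x. (norm (g x))\<^sup>2 \<partial>lborel)"
    unfolding integral_complex_of_real[symmetric]
    by (intro Bochner_Integration.integral_cong refl) (simp only: complex_norm_square mult.commute)
  finally have "(\<lambda>k. complex_of_real (\<integral>y. (norm (fourier g y))\<^sup>2 * W k y \<partial>lborel))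
      \<longlonglongrightarrow> complex_of_real (\<integral>x. (norm (g x))\<^sup>2 \<partial>lborel)"
    unfolding eq[symmetric] by (simp only: integral_complex_of_real)
  then have lim: "(\<lambda>k. \<integral>y. (norm (fourier g y))\<^sup>2 * W k y \<partial>lborel) \<longlonglongrightarrow> (\<integral>x. (norm (g x))\<^sup>2 \<partial>lborel)"
    by (rule tendsto_of_real_iff[THEN iffD1])
  have int_k: "integrable lborel (\<lambda>y. (norm (fourier g y))\<^sup>2 * W k y)" for k
  proof (rule Bochner_Integration.integrable_bound[where f="\<lambda>y. M\<^sup>2 * W k y"])
    show "integrable lborel (\<lambda>y. M\<^sup>2 * W k y)"
      using integrable_norm[OF W[of k]] Wb by simp
    show "AE y in lborel. norm ((norm (fourier g y))\<^sup>2 * W k y) \<le> norm (M\<^sup>2 * W k y)"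
      using M Wb by (intro AE_I2) (simp add: abs_mult mult_right_mono power_mono)
  qed measurable
  \<comment> \<open>The widths \<open>inverse (real (Suc k))\<close> decrease, so the windows
    increase with k.\<close>
  have mono: "AE y in lborel. mono (\<lambda>k. (norm (fourier g y))\<^sup>2 * W k y)"
  proof (intro AE_I2 monoI mult_left_mono)
    fix y :: 'a and i j :: nat assume "i \<le> j"
    then have "inverse (real (Suc j)) \<le> inverse (real (Suc i))"
      by (intro le_imp_inverse_le) auto
    then show "W i y \<le> W j y"
      unfolding W_def gaussian_window_def by (simp add: abs_mult power_mono mult_right_mono)
  qed auto
  have pt: "AE y in lborel. (\<lambda>k. (norm (fourier g y))\<^sup>2 * W k y) \<longlonglongrightarrow> (norm (fourier g y))\<^sup>2"
  proof (rule AE_I2)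
    fix y :: 'a
    show "(\<lambda>k. (norm (fourier g y))\<^sup>2 * W k y) \<longlonglongrightarrow> (norm (fourier g y))\<^sup>2"
      using tendsto_mult[OF tendsto_const[of "(norm (fourier g y))\<^sup>2"] window_tendsto[of y]]
      unfolding W_def by simp
  qed
  have meas: "(\<lambda>y. (norm (fourier g y))\<^sup>2) \<in> borel_measurable lborel"
    by measurable
  show "fourier g \<in> L2"
    using integrable_monotone_convergence[OF int_k mono pt lim meas] by (simp add: L2_def)
  show "(\<integral>y. (norm (fourier g y))\<^sup>2 \<partial>lborel) = (\<integral>x. (norm (g x))\<^sup>2 \<partial>lborel)"
    by (rule integral_monotone_convergence[OF int_k mono pt lim meas])
qed

subsection \<open>Square-integrable functions\<close>

lemma L2_iff: "f \<in> L2 \<longleftrightarrow> f \<in> borel_measurable borel \<and> integrable lborel (\<lambda>x. (norm (f x))\<^sup>2)"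
  by (simp add: L2_def)

lemma L2_measurable: "f \<in> L2 \<Longrightarrow> f \<in> borel_measurable borel"
  by (simp add: L2_iff)

lemma L2_norm_nonneg: "0 \<le> L2_norm f"
  by (simp add: L2_norm_def)

lemma L2_norm_power2: "(L2_norm f)\<^sup>2 = (\<integral>x. (norm (f x))\<^sup>2 \<partial>lborel)"
  by (simp add: L2_norm_def)

lemma L2_bounded_by:
  fixes w :: "'a::euclidean_space \<Rightarrow> real"
  assumes "f \<in> borel_measurable borel" "integrable lborel (\<lambda>x. (w x)\<^sup>2)" "AE x in lborel. norm (f x) \<le> w x"
  shows "f \<in> L2"
proof -
  have "integrable lborel (\<lambda>x. (norm (f x))\<^sup>2)"
  proof (rule Bochner_Integration.integrable_bound[OF assms(2)])
    show "AE x in lborel. norm ((norm (f x))\<^sup>2) \<le> norm ((w x)\<^sup>2)"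
      using assms(3) by eventually_elim (simp add: power_mono)
  qed (use assms(1) in measurable)
  then show ?thesis using assms(1) by (simp add: L2_iff)
qed

lemma L2_add:
  assumes "f \<in> L2" "g \<in> L2"
  shows "(\<lambda>x. f x + g x) \<in> L2"
proof -
  have [measurable]: "f \<in> borel_measurable borel" "g \<in> borel_measurable borel"
    using assms by (auto simp: L2_iff)
  have le: "(norm (f x + g x))\<^sup>2 \<le> 2 * (norm (f x))\<^sup>2 + 2 * (norm (g x))\<^sup>2" for x
  proof -
    have "(norm (f x + g x))\<^sup>2 \<le> (norm (f x) + norm (g x))\<^sup>2"
      by (intro power_mono norm_triangle_ineq) auto
    also have "\<dots> \<le> 2 * (norm (f x))\<^sup>2 + 2 * (norm (g x))\<^sup>2"
      using sum_squares_bound[of "norm (f x)" "norm (g x)"] by (simp add: power2_sum)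
    finally show ?thesis .
  qed
  have "integrable lborel (\<lambda>x. (norm (f x + g x))\<^sup>2)"
  proof (rule Bochner_Integration.integrable_bound)
    show "integrable lborel (\<lambda>x. 2 * (norm (f x))\<^sup>2 + 2 * (norm (g x))\<^sup>2)"
      using assms by (auto simp: L2_iff)
    show "AE x in lborel. norm ((norm (f x + g x))\<^sup>2) \<le> norm (2 * (norm (f x))\<^sup>2 + 2 * (norm (g x))\<^sup>2)"
      by (intro AE_I2) (use le in simp)
  qed measurable
  then show ?thesis by (simp add: L2_iff)
qed

lemma L2_cmult: "f \<in> L2 \<Longrightarrow> (\<lambda>x. c * f x) \<in> L2"
  by (auto simp: L2_iff norm_mult power_mult_distrib)

lemma L2_lincomb: "f \<in> L2 \<Longrightarrow> g \<in> L2 \<Longrightarrow> (\<lambda>x. a * f x + b * g x) \<in> L2"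
  by (intro L2_add L2_cmult)

lemma L2_diff: "f \<in> L2 \<Longrightarrow> g \<in> L2 \<Longrightarrow> (\<lambda>x. f x - g x) \<in> L2"
  using L2_lincomb[of f g 1 "- 1"] by simp

lemma L2_norm_cmult: "L2_norm (\<lambda>x. c * f x) = norm c * L2_norm f"
  by (simp add: L2_norm_def norm_mult power_mult_distrib real_sqrt_mult)

abbreviation L2_dist :: "('a::euclidean_space \<Rightarrow> complex) \<Rightarrow> ('a \<Rightarrow> complex) \<Rightarrow> real" where
  "L2_dist f g \<equiv> L2_norm (\<lambda>x. f x - g x)"

lemma L2_norm_minus_commute: "L2_dist f g = L2_dist g f"
  by (simp add: L2_norm_def norm_minus_commute)

lemma L2_norm_cong_AE:
  assumes "AE x in lborel. f x = g x" "f \<in> borel_measurable borel" "g \<in> borel_measurable borel"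
  shows "L2_norm f = L2_norm g"
  unfolding L2_norm_def
  by (intro arg_cong[where f=sqrt] integral_cong_AE) (use assms in auto)

lemma L2_norm_eq_0:
  assumes "f \<in> L2" "L2_norm f = 0"
  shows "AE x in lborel. f x = 0"
proof -
  have "(\<integral>x. (norm (f x))\<^sup>2 \<partial>lborel) = 0"
    using assms(2) L2_norm_power2[of f] by simp
  then have "AE x in lborel. (norm (f x))\<^sup>2 = 0"
    using assms(1) by (subst integral_nonneg_eq_0_iff_AE[symmetric]) (auto simp: L2_iff)
  then show ?thesis by simp
qed

lemma
  assumes "f \<in> L2" "g \<in> L2"
  shows integrable_mult_L2: "integrable lborel (\<lambda>x. f x * g x)"
    and Cauchy_Schwarz_L2: "(\<integral>x. norm (f x) * norm (g x) \<partial>lborel) \<le> L2_norm f * L2_norm g"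
proof -
  have [measurable]: "f \<in> borel_measurable borel" "g \<in> borel_measurable borel"
    using assms by (auto simp: L2_iff)
  have int: "integrable lborel (\<lambda>x. norm (f x) * norm (g x))"
  proof (rule Bochner_Integration.integrable_bound)
    show "integrable lborel (\<lambda>x. (norm (f x))\<^sup>2 + (norm (g x))\<^sup>2)"
      using assms by (auto simp: L2_iff)
    show "AE x in lborel. norm (norm (f x) * norm (g x)) \<le> norm ((norm (f x))\<^sup>2 + (norm (g x))\<^sup>2)"
    proof (rule AE_I2)
      fix x
      have "2 * (norm (f x) * norm (g x)) \<le> (norm (f x))\<^sup>2 + (norm (g x))\<^sup>2"
        using sum_squares_bound[of "norm (f x)" "norm (g x)"] by simp
      moreover have "0 \<le> norm (f x) * norm (g x)" by simp
      ultimately have "norm (f x) * norm (g x) \<le> (norm (f x))\<^sup>2 + (norm (g x))\<^sup>2" by linarith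
      then show "norm (norm (f x) * norm (g x)) \<le> norm ((norm (f x))\<^sup>2 + (norm (g x))\<^sup>2)"
        by simp
    qed
  qed measurable
  then show "integrable lborel (\<lambda>x. f x * g x)"
    by (subst integrable_norm_iff[symmetric]) (simp_all add: norm_mult)
  let ?I = "\<integral>x. norm (f x) * norm (g x) \<partial>lborel"
  have "(\<integral>\<^sup>+x. ennreal (norm (f x)) * ennreal (norm (g x)) \<partial>lborel)\<^sup>2 \<le>
      (\<integral>\<^sup>+x. ennreal (norm (f x)) ^ 2 \<partial>lborel) * (\<integral>\<^sup>+x. ennreal (norm (g x)) ^ 2 \<partial>lborel)"
    by (rule Cauchy_Schwarz_nn_integral) auto
  then have "ennreal (?I\<^sup>2) \<le> ennreal ((\<integral>x. (norm (f x))\<^sup>2 \<partial>lborel) * (\<integral>x. (norm (g x))\<^sup>2 \<partial>lborel))"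
    using assms int
    by (simp add: ennreal_mult[symmetric] ennreal_power nn_integral_eq_integral L2_iff integral_nonneg_AE)
  then have "?I\<^sup>2 \<le> (L2_norm f * L2_norm g)\<^sup>2"
    by (simp add: power_mult_distrib L2_norm_power2 ennreal_le_iff)
  then show "?I \<le> L2_norm f * L2_norm g"
    by (rule power2_le_imp_le) (simp add: L2_norm_nonneg)
qed

lemma L2_norm_triangle:
  assumes "f \<in> L2" "g \<in> L2"
  shows "L2_norm (\<lambda>x. f x + g x) \<le> L2_norm f + L2_norm g"
proof (rule power2_le_imp_le)
  have int: "integrable lborel (\<lambda>x. norm (f x) * norm (g x))"
    using integrable_norm[OF integrable_mult_L2[OF assms]] by (simp add: norm_mult)
  have "(L2_norm (\<lambda>x. f x + g x))\<^sup>2 \<le>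
      (\<integral>x. (norm (f x))\<^sup>2 + 2 * (norm (f x) * norm (g x)) + (norm (g x))\<^sup>2 \<partial>lborel)"
    unfolding L2_norm_power2
  proof (rule integral_mono)
    show "integrable lborel (\<lambda>x. (norm (f x + g x))\<^sup>2)"
      using L2_add[OF assms] by (simp add: L2_iff)
    show "integrable lborel (\<lambda>x. (norm (f x))\<^sup>2 + 2 * (norm (f x) * norm (g x)) + (norm (g x))\<^sup>2)"
      using assms int by (auto simp: L2_iff)
    show "(norm (f x + g x))\<^sup>2 \<le> (norm (f x))\<^sup>2 + 2 * (norm (f x) * norm (g x)) + (norm (g x))\<^sup>2" for x
      using power_mono[OF norm_triangle_ineq[of "f x" "g x"], of 2] by (simp add: power2_sum)
  qed
  also have "\<dots> = (L2_norm f)\<^sup>2 + 2 * (\<integral>x. norm (f x) * norm (g x) \<partial>lborel) + (L2_norm g)\<^sup>2"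
    using assms int by (simp add: L2_norm_power2 L2_iff)
  also have "\<dots> \<le> (L2_norm f + L2_norm g)\<^sup>2"
    using Cauchy_Schwarz_L2[OF assms] by (simp add: power2_sum)
  finally show "(L2_norm (\<lambda>x. f x + g x))\<^sup>2 \<le> (L2_norm f + L2_norm g)\<^sup>2" .
qed (simp add: L2_norm_nonneg)

lemma L2_norm_triangle_diff:
  assumes "f \<in> L2" "g \<in> L2" "h \<in> L2"
  shows "L2_dist f h \<le> L2_dist f g + L2_dist g h"
  using L2_norm_triangle[OF L2_diff[OF assms(1,2)] L2_diff[OF assms(2,3)]] by simp

lemma L2_norm_le_dist:
  assumes "f \<in> L2" "g \<in> L2"
  shows "\<bar>L2_norm f - L2_norm g\<bar> \<le> L2_dist f g"
proof -
  have "L2_norm f \<le> L2_dist f g + L2_norm g"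
    using L2_norm_triangle[OF L2_diff[OF assms] assms(2)] by simp
  moreover have "L2_norm g \<le> L2_dist f g + L2_norm f"
    using L2_norm_triangle[OF L2_diff[OF assms(2,1)] assms(1)] L2_norm_minus_commute[of f g] by simp
  ultimately show ?thesis by linarith
qed

lemma L2_norm_tendsto:
  assumes "\<And>k. F k \<in> L2" "f \<in> L2" "(\<lambda>k. L2_dist (F k) f) \<longlonglongrightarrow> 0"
  shows "(\<lambda>k. L2_norm (F k)) \<longlonglongrightarrow> L2_norm f"
proof (rule LIM_zero_cancel, rule tendsto_rabs_zero_cancel, rule tendsto_sandwich[OF _ _ tendsto_const assms(3)])
  show "\<forall>\<^sub>F k in sequentially. \<bar>L2_norm (F k) - L2_norm f\<bar> \<le> L2_dist (F k) f"
    using L2_norm_le_dist[OF assms(1,2)] by simp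
qed simp

lemma L2_dominated_convergence:
  fixes s :: "nat \<Rightarrow> 'a::euclidean_space \<Rightarrow> complex"
  assumes [measurable]: "\<And>k. s k \<in> borel_measurable borel" "f \<in> borel_measurable borel"
    and w: "integrable lborel (\<lambda>x. (w x)\<^sup>2)"
    and lim: "AE x in lborel. (\<lambda>k. s k x) \<longlonglongrightarrow> f x"
    and bound: "\<And>k. AE x in lborel. norm (s k x) \<le> w x"
  shows "(\<lambda>k. L2_dist (s k) f) \<longlonglongrightarrow> 0"
proof -
  have "(\<lambda>k. \<integral>x. (norm (s k x - f x))\<^sup>2 \<partial>lborel) \<longlonglongrightarrow> integral\<^sup>L (lborel :: 'a measure) (\<lambda>_. 0)"
  proof (rule integral_dominated_convergence)
    show "integrable lborel (\<lambda>x. 4 * (w x)\<^sup>2)"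
      using w by simp
    show "AE x in lborel. (\<lambda>k. (norm (s k x - f x))\<^sup>2) \<longlonglongrightarrow> 0"
      using lim
    proof eventually_elim
      case (elim x)
      have "(\<lambda>k. (norm (s k x - f x))\<^sup>2) \<longlonglongrightarrow> (norm (f x - f x))\<^sup>2"
        by (intro tendsto_intros elim)
      then show ?case by simp
    qed
    have "AE x in lborel. \<forall>k. norm (s k x) \<le> w x"
      using bound by (simp add: AE_all_countable)
    then show "AE x in lborel. norm ((norm (s k x - f x))\<^sup>2) \<le> 4 * (w x)\<^sup>2" for k
      using lim
    proof eventually_elim
      case (elim x)
      then have "norm (f x) \<le> w x"
        by (intro tendsto_upperbound[OF tendsto_norm[OF elim(2)]]) auto
      then have "norm (s k x - f x) \<le> 2 * w x"
        using norm_triangle_ineq4[of "s k x" "f x"] elim(1) by (auto dest: spec[of _ k])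
      then have "(norm (s k x - f x))\<^sup>2 \<le> (2 * w x)\<^sup>2"
        by (intro power_mono) auto
      then show ?case by simp
    qed
  qed measurable
  then have "(\<lambda>k. sqrt (\<integral>x. (norm (s k x - f x))\<^sup>2 \<partial>lborel)) \<longlonglongrightarrow> sqrt 0"
    by (intro tendsto_real_sqrt) simp
  then show ?thesis by (simp add: L2_norm_def)
qed

text \<open>The norm bound is asked for only from K on, so that the Cauchy criterion can supply it
  directly.\<close>

lemma
  assumes s: "\<And>k. s k \<in> L2" and [measurable]: "f \<in> borel_measurable borel"
    and lim: "AE x in lborel. (\<lambda>k. s k x) \<longlonglongrightarrow> f x"
    and bound: "\<And>k. k \<ge> K \<Longrightarrow> L2_norm (s k) \<le> C"
  shows L2_Fatou: "f \<in> L2" and L2_norm_Fatou: "L2_norm f \<le> C"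
proof -
  have [measurable]: "s k \<in> borel_measurable borel" for k
    using s by (simp add: L2_iff)
  have C: "0 \<le> C" using bound[of K] L2_norm_nonneg[of "s K"] by simp
  have "(\<integral>\<^sup>+x. ennreal ((norm (f x))\<^sup>2) \<partial>lborel) = (\<integral>\<^sup>+x. liminf (\<lambda>k. ennreal ((norm (s k x))\<^sup>2)) \<partial>lborel)"
  proof (rule nn_integral_cong_AE)
    show "AE x in lborel. ennreal ((norm (f x))\<^sup>2) = liminf (\<lambda>k. ennreal ((norm (s k x))\<^sup>2))"
      using lim
    proof eventually_elim
      case (elim x)
      have "(\<lambda>k. ennreal ((norm (s k x))\<^sup>2)) \<longlonglongrightarrow> ennreal ((norm (f x))\<^sup>2)"
        by (intro tendsto_ennrealI tendsto_intros elim)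
      then show ?case
        using lim_imp_Liminf[OF sequentially_bot] by metis
    qed
  qed
  also have "\<dots> \<le> liminf (\<lambda>k. \<integral>\<^sup>+x. ennreal ((norm (s k x))\<^sup>2) \<partial>lborel)"
    by (rule nn_integral_liminf) measurable
  also have "\<dots> \<le> ennreal (C\<^sup>2)"
  proof (rule Liminf_le)
    have "(\<integral>\<^sup>+x. ennreal ((norm (s k x))\<^sup>2) \<partial>lborel) \<le> ennreal (C\<^sup>2)" if "k \<ge> K" for k
    proof -
      have "(\<integral>\<^sup>+x. ennreal ((norm (s k x))\<^sup>2) \<partial>lborel) = ennreal ((L2_norm (s k))\<^sup>2)"
        unfolding L2_norm_power2 by (rule nn_integral_eq_integral) (use s in \<open>auto simp: L2_iff\<close>)
      also have "\<dots> \<le> ennreal (C\<^sup>2)"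
        using bound[OF that] by (intro ennreal_leI power_mono L2_norm_nonneg)
      finally show ?thesis .
    qed
    then show "\<forall>\<^sub>F k in sequentially. (\<integral>\<^sup>+x. ennreal ((norm (s k x))\<^sup>2) \<partial>lborel) \<le> ennreal (C\<^sup>2)"
      by (auto simp: eventually_sequentially)
  qed simp
  finally have le: "(\<integral>\<^sup>+x. ennreal ((norm (f x))\<^sup>2) \<partial>lborel) \<le> ennreal (C\<^sup>2)" .
  then have int: "integrable lborel (\<lambda>x. (norm (f x))\<^sup>2)"
    by (intro integrableI_bounded) (auto intro: le_less_trans)
  then show "f \<in> L2" by (simp add: L2_iff)
  have "ennreal ((L2_norm f)\<^sup>2) \<le> ennreal (C\<^sup>2)"
    using le int unfolding L2_norm_power2 by (simp add: nn_integral_eq_integral)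
  then have "(L2_norm f)\<^sup>2 \<le> C\<^sup>2"
    by (simp add: ennreal_le_iff)
  then show "L2_norm f \<le> C"
    using C by (rule power2_le_imp_le)
qed

definition L2_Cauchy :: "(nat \<Rightarrow> 'a::euclidean_space \<Rightarrow> complex) \<Rightarrow> bool" where
  "L2_Cauchy s \<longleftrightarrow> (\<forall>e>0. \<exists>K. \<forall>i\<ge>K. \<forall>j\<ge>K. L2_dist (s i) (s j) \<le> e)"

lemma L2_convergent_imp_Cauchy:
  assumes "\<And>k. s k \<in> L2" "f \<in> L2" "(\<lambda>k. L2_dist (s k) f) \<longlonglongrightarrow> 0"
  shows "L2_Cauchy s"
  unfolding L2_Cauchy_def
proof (intro allI impI)
  fix e :: real assume "0 < e"
  then have "\<forall>\<^sub>F k in sequentially. L2_dist (s k) f < e / 2"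
    using assms(3) by (intro order_tendstoD(2)) auto
  then obtain K where K: "\<And>k. k \<ge> K \<Longrightarrow> L2_dist (s k) f < e / 2"
    by (auto simp: eventually_sequentially)
  have "L2_dist (s i) (s j) \<le> e" if "i \<ge> K" "j \<ge> K" for i j
    using L2_norm_triangle_diff[OF assms(1)[of i] assms(2) assms(1)[of j]] K[OF that(1)] K[OF that(2)]
    by (simp add: L2_norm_minus_commute[of f])
  then show "\<exists>K. \<forall>i\<ge>K. \<forall>j\<ge>K. L2_dist (s i) (s j) \<le> e" by blast
qed

text \<open>Fatou's lemma, applied to the differences with one index fixed, turns the Cauchy bound
  into a bound on the distance to the pointwise limit. This is how an L2 limit is identified with a
  function given by a formula, such as \<open>fourier f\<close>.\<close>

lemma
  assumes s: "\<And>k. s k \<in> L2" and [measurable]: "f \<in> borel_measurable borel"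
    and lim: "AE x in lborel. (\<lambda>k. s k x) \<longlonglongrightarrow> f x" and cauchy: "L2_Cauchy s"
  shows L2_Cauchy_limit: "f \<in> L2"
    and L2_Cauchy_tendsto: "(\<lambda>k. L2_dist (s k) f) \<longlonglongrightarrow> 0"
proof -
  have [measurable]: "s k \<in> borel_measurable borel" for k
    using s by (simp add: L2_iff)
  have Fatou: "(\<lambda>x. f x - s i x) \<in> L2 \<and> L2_dist (s i) f \<le> e"
    if K: "\<And>i j. i \<ge> K \<Longrightarrow> j \<ge> K \<Longrightarrow> L2_dist (s i) (s j) \<le> e" and "i \<ge> K" for e K i
  proof -
    have lim': "AE x in lborel. (\<lambda>j. s j x - s i x) \<longlonglongrightarrow> f x - s i x"
      using lim by eventually_elim (intro tendsto_intros)
    have bound: "L2_dist (s j) (s i) \<le> e" if "j \<ge> K" for j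
      using K that \<open>i \<ge> K\<close> by blast
    show ?thesis
      using L2_Fatou[OF L2_diff[OF s s] _ lim' bound] L2_norm_Fatou[OF L2_diff[OF s s] _ lim' bound]
      by (simp add: L2_norm_minus_commute)
  qed
  obtain K where K: "\<And>i j. i \<ge> K \<Longrightarrow> j \<ge> K \<Longrightarrow> L2_dist (s i) (s j) \<le> 1"
    using cauchy unfolding L2_Cauchy_def by (meson zero_less_one)
  have "(\<lambda>x. (f x - s K x) + s K x) \<in> L2"
    using Fatou[OF K, of K] s by (intro L2_add) auto
  then show "f \<in> L2" by simp
  show "(\<lambda>k. L2_dist (s k) f) \<longlonglongrightarrow> 0"
  proof (rule tendstoI)
    fix e :: real assume "0 < e"
    then obtain K where K: "\<And>i j. i \<ge> K \<Longrightarrow> j \<ge> K \<Longrightarrow> L2_dist (s i) (s j) \<le> e / 2"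
      using cauchy unfolding L2_Cauchy_def by (meson half_gt_zero)
    have "dist (L2_dist (s k) f) 0 < e" if "k \<ge> K" for k
      using Fatou[OF K that] \<open>0 < e\<close> by (simp add: L2_norm_nonneg)
    then show "\<forall>\<^sub>F k in sequentially. dist (L2_dist (s k) f) 0 < e"
      by (auto simp: eventually_sequentially)
  qed
qed

text \<open>The weights \<open>2 ^ k\<close> turn summability of squares into geometric decay, hence into pointwise
  convergence almost everywhere.\<close>

lemma L2_complete:
  fixes s :: "nat \<Rightarrow> 'a::euclidean_space \<Rightarrow> complex"
  assumes s: "\<And>k. s k \<in> L2" and step: "\<And>k. L2_dist (s (Suc k)) (s k) \<le> C * (1 / 2) ^ k"
  obtains f where "f \<in> L2" "(\<lambda>k. L2_dist (s k) f) \<longlonglongrightarrow> 0"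
proof -
  have [measurable]: "s k \<in> borel_measurable borel" for k
    using s by (simp add: L2_iff)
  have C: "0 \<le> C" using step[of 0] L2_norm_nonneg[of "\<lambda>x. s (Suc 0) x - s 0 x"] by simp
  define f where "f x = lim (\<lambda>k. s k x)" for x
  have fm: "f \<in> borel_measurable borel"
    unfolding f_def[abs_def] by (rule borel_measurable_lim_metric) measurable
  define d where "d k x = norm (s (Suc k) x - s k x)" for k x
  have [measurable]: "d k \<in> borel_measurable borel" for k
    unfolding d_def[abs_def] by measurable
  have "(\<integral>\<^sup>+x. (\<Sum>k. ennreal (2 ^ k * (d k x)\<^sup>2)) \<partial>lborel) = (\<Sum>k. \<integral>\<^sup>+x. ennreal (2 ^ k * (d k x)\<^sup>2) \<partial>lborel)"
    by (rule nn_integral_suminf) measurable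
  also have "\<dots> \<le> (\<Sum>k. ennreal (C\<^sup>2 * (1 / 2) ^ k))"
  proof (rule suminf_le)
    fix k
    have int: "integrable lborel (\<lambda>x. (d k x)\<^sup>2)"
      using L2_diff[OF s s, of "Suc k" k] by (simp add: L2_iff d_def)
    have "(\<integral>\<^sup>+x. ennreal (2 ^ k * (d k x)\<^sup>2) \<partial>lborel) = ennreal (\<integral>x. 2 ^ k * (d k x)\<^sup>2 \<partial>lborel)"
      by (rule nn_integral_eq_integral) (use int in auto)
    also have "(\<integral>x. 2 ^ k * (d k x)\<^sup>2 \<partial>lborel) = 2 ^ k * (L2_dist (s (Suc k)) (s k))\<^sup>2"
      by (simp add: L2_norm_power2 d_def)
    also have "\<dots> \<le> 2 ^ k * (C * (1 / 2) ^ k)\<^sup>2"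
      by (intro mult_left_mono power_mono step L2_norm_nonneg) auto
    also have "\<dots> = C\<^sup>2 * (1 / 2) ^ k"
      by (simp add: power_mult_distrib power2_eq_square power_divide field_simps)
    finally show "(\<integral>\<^sup>+x. ennreal (2 ^ k * (d k x)\<^sup>2) \<partial>lborel) \<le> ennreal (C\<^sup>2 * (1 / 2) ^ k)"
      by (simp add: ennreal_leI)
  qed auto
  also have "\<dots> < \<infinity>"
    by (subst suminf_ennreal2) (auto intro!: summable_mult summable_geometric)
  finally have "AE x in lborel. (\<Sum>k. ennreal (2 ^ k * (d k x)\<^sup>2)) \<noteq> \<infinity>"
    by (intro nn_integral_noteq_infinite) auto
  then have lim: "AE x in lborel. (\<lambda>k. s k x) \<longlonglongrightarrow> f x"
  proof eventually_elim
    case (elim x)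
    then have "summable (\<lambda>k. 2 ^ k * (d k x)\<^sup>2)"
      by (intro summable_suminf_not_top) auto
    then have "Bseq (\<lambda>k. 2 ^ k * (d k x)\<^sup>2)"
      by (intro convergent_imp_Bseq) (auto simp: convergent_def intro: summable_LIMSEQ_zero)
    then obtain B where B: "B > 0" "\<And>k. norm (2 ^ k * (d k x)\<^sup>2) \<le> B"
      by (auto simp: Bseq_def)
    have le: "norm (s (Suc k) x - s k x) \<le> sqrt B * (sqrt (1 / 2)) ^ k" for k
    proof -
      have "(d k x)\<^sup>2 \<le> B * (1 / 2) ^ k"
        using B(2)[of k] by (simp add: power_divide field_simps)
      then have "d k x \<le> sqrt (B * (1 / 2) ^ k)"
        by (rule real_le_rsqrt)
      then show ?thesis
        by (simp add: d_def real_sqrt_mult real_sqrt_power)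
    qed
    have "summable (\<lambda>k. sqrt B * (sqrt (1 / 2)) ^ k)"
      by (intro summable_mult summable_geometric) (auto simp: real_sqrt_divide)
    then have "summable (\<lambda>k. s (Suc k) x - s k x)"
      by (rule summable_comparison_test') (rule le)
    then have "convergent (\<lambda>n. \<Sum>k<n. s (Suc k) x - s k x)"
      by (simp add: summable_iff_convergent)
    then have "convergent (\<lambda>n. s n x - s 0 x)"
      by (simp only: sum_lessThan_telescope[of "\<lambda>n. s n x"])
    then have "convergent (\<lambda>n. (s n x - s 0 x) + s 0 x)"
      by (intro convergent_add convergent_const)
    then have "convergent (\<lambda>n. s n x)"
      by simp
    then show ?case
      unfolding f_def by (rule convergent_LIMSEQ_iff[THEN iffD1])
  qed
  \<comment> \<open>The exact value of the finite geometric sum is carried along, because the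
    induction does not close with the limiting bound 2 C (1/2)^m.\<close>
  have tail: "L2_norm (\<lambda>x. s (m + i) x - s m x) \<le> 2 * C * (1 / 2) ^ m * (1 - (1 / 2) ^ i)" for m i
  proof (induction i)
    case 0
    then show ?case by (simp add: L2_norm_def)
  next
    case (Suc i)
    have "L2_norm (\<lambda>x. s (m + Suc i) x - s m x) \<le> C * (1 / 2) ^ (m + i) + 2 * C * (1 / 2) ^ m * (1 - (1 / 2) ^ i)"
      using L2_norm_triangle_diff[OF s[of "Suc (m + i)"] s[of "m + i"] s[of m]] step[of "m + i"] Suc
      by simp
    also have "\<dots> = 2 * C * (1 / 2) ^ m * (1 - (1 / 2) ^ Suc i)"
      by (simp add: power_add algebra_simps)
    finally show ?case .
  qed
  have tail': "L2_dist (s i) (s m) \<le> 2 * C * (1 / 2) ^ m" if "i \<ge> m" for i m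
  proof -
    have "L2_dist (s i) (s m) \<le> 2 * C * (1 / 2) ^ m * (1 - (1 / 2) ^ (i - m))"
      using tail[of m "i - m"] that by simp
    also have "\<dots> \<le> 2 * C * (1 / 2) ^ m * 1"
      using C by (intro mult_left_mono) auto
    finally show ?thesis by simp
  qed
  have "L2_Cauchy s"
    unfolding L2_Cauchy_def
  proof (intro allI impI)
    fix e :: real assume e: "0 < e"
    have "(\<lambda>m. 4 * C * (1 / 2) ^ m) \<longlonglongrightarrow> 4 * C * 0"
      by (intro tendsto_intros LIMSEQ_power_zero) auto
    then have "\<forall>\<^sub>F m in sequentially. 4 * C * (1 / 2) ^ m < e"
      using e by (intro order_tendstoD(2)) auto
    then obtain K where K: "4 * C * (1 / 2) ^ K < e"
      by (auto simp: eventually_sequentially)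
    have "L2_dist (s i) (s j) \<le> e" if "i \<ge> K" "j \<ge> K" for i j
      using L2_norm_triangle_diff[OF s[of i] s[of K] s[of j]] tail'[OF that(1)] tail'[OF that(2)] K
      by (simp add: L2_norm_minus_commute[of "s K"])
    then show "\<exists>K. \<forall>i\<ge>K. \<forall>j\<ge>K. L2_dist (s i) (s j) \<le> e" by blast
  qed
  then show ?thesis
    using that L2_Cauchy_limit[OF s fm lim] L2_Cauchy_tendsto[OF s fm lim] by blast
qed

subsection \<open>Density of bounded continuous integrable functions\<close>

definition cutoff :: "real \<Rightarrow> 'a::euclidean_space \<Rightarrow> real" where
  "cutoff M x = max 0 (min 1 (M + 1 - norm x))"

text \<open>The radial retraction onto the disc of radius M. The \<open>max\<close> in the
  denominator keeps it continuous at 0.\<close>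

definition clip :: "real \<Rightarrow> complex \<Rightarrow> complex" where
  "clip M z = (M / max M (norm z)) *\<^sub>R z"

lemma continuous_on_cutoff[continuous_intros]: "continuous_on S (cutoff M)"
  unfolding cutoff_def by (intro continuous_intros)

lemma borel_measurable_cutoff[measurable]: "cutoff M \<in> borel_measurable borel"
  by (intro borel_measurable_continuous_onI continuous_intros)

lemma cutoff_bounds: "0 \<le> cutoff M x" "cutoff M x \<le> 1"
  by (auto simp: cutoff_def)

lemma cutoff_eq_1: "norm x \<le> M \<Longrightarrow> cutoff M x = 1"
  by (simp add: cutoff_def)

lemma integrable_cutoff: "integrable lborel (cutoff M :: 'a::euclidean_space \<Rightarrow> real)"
proof (rule Bochner_Integration.integrable_bound)
  show "integrable lborel (indicator (cball 0 (M + 1)) :: 'a \<Rightarrow> real)"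
    by (rule integrable_real_indicator) (use emeasure_bounded_finite[OF bounded_cball] in simp_all)
  show "AE x in lborel. norm (cutoff M x) \<le> norm (indicator (cball (0::'a) (M + 1)) x :: real)"
    by (rule AE_I2) (auto simp: cutoff_def indicator_def)
qed simp

lemma continuous_on_clip:
  assumes "0 < M" "continuous_on S f"
  shows "continuous_on S (\<lambda>x. clip M (f x))"
  unfolding clip_def using assms by (intro continuous_intros) (auto simp: max_def)

lemma norm_clip_le:
  assumes "0 < M"
  shows "norm (clip M z) \<le> M" "norm (clip M z) \<le> norm z"
proof -
  have "norm (clip M z) = M * norm z / max M (norm z)"
    using assms by (simp add: clip_def max_def)
  moreover have "M * norm z \<le> M * max M (norm z)" "M * norm z \<le> norm z * max M (norm z)"
    using assms by (auto intro!: mult_left_mono simp: mult.commute[of M])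
  moreover have "0 < max M (norm z)" using assms by simp
  ultimately show "norm (clip M z) \<le> M" "norm (clip M z) \<le> norm z"
    by (simp_all add: divide_le_eq)
qed

lemma clip_eq: "0 < M \<Longrightarrow> norm z \<le> M \<Longrightarrow> clip M z = z"
  by (simp add: clip_def max_def)

text \<open>The library's \<open>measurable_on\<close> is defined through limits of continuous
  functions off a negligible set and coincides with Lebesgue measurability. The statement on the
  completion is then moved back to \<open>lborel\<close>.\<close>

lemma measurable_continuous_limit:
  fixes f :: "'a::euclidean_space \<Rightarrow> complex"
  assumes "f \<in> borel_measurable borel"
  obtains g where "\<And>n::nat. continuous_on UNIV (g n)" "AE x in lborel. (\<lambda>n. g n x) \<longlonglongrightarrow> f x"
proof -
  have "f \<in> borel_measurable lebesgue"
    using assms by (simp add: measurable_completion)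
  then have "f measurable_on UNIV"
    by (simp add: measurable_on_iff_borel_measurable lebesgue_on_UNIV_eq)
  then obtain N g where N: "negligible N" and g: "\<And>n. continuous_on UNIV (g n)"
    and lim: "\<And>x. x \<notin> N \<Longrightarrow> (\<lambda>n. g n x) \<longlonglongrightarrow> f x"
    unfolding measurable_on_def by auto
  have "AE x in lebesgue. x \<notin> N"
    using N by (simp add: negligible_iff_null_sets AE_not_in)
  then have "AE x in lebesgue. (\<lambda>n. g n x) \<longlonglongrightarrow> f x"
    by eventually_elim (rule lim)
  then have "AE x in lborel. (\<lambda>n. g n x) \<longlonglongrightarrow> f x"
    by (simp add: AE_completion_iff)
  with g show ?thesis by (rule that)
qed

text \<open>f is first truncated in height and in space, then the truncation is approximated by
  continuous functions. The same approximant serves both norms: the L2 distance is for Plancherel,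
  and the L1 distance controls the transforms pointwise.\<close>

lemma nice_dense:
  fixes f :: "'a::euclidean_space \<Rightarrow> complex"
  assumes f: "f \<in> L2" and e: "0 < e"
  obtains h where "nice h" "L2_dist h f < e"
    "integrable lborel f \<Longrightarrow> (\<integral>x. norm (h x - f x) \<partial>lborel) < e"
proof -
  have fm[measurable]: "f \<in> borel_measurable borel"
    using f by (rule L2_measurable)
  define u where "u k x = clip (real (Suc k)) (f x) * complex_of_real (cutoff (real (Suc k)) x)" for k x
  have [measurable]: "u k \<in> borel_measurable borel" for k
    unfolding u_def[abs_def] clip_def by measurable
  have u_le: "norm (u k x) \<le> norm (f x)" for k x
  proof -
    have "norm (u k x) \<le> norm (clip (real (Suc k)) (f x)) * 1"
      unfolding u_def norm_mult using cutoff_bounds[of "real (Suc k)" x] by (intro mult_left_mono) auto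
    also have "\<dots> \<le> norm (f x)"
      using norm_clip_le(2)[of "real (Suc k)" "f x"] by simp
    finally show ?thesis .
  qed
  have u_lim: "(\<lambda>k. u k x) \<longlonglongrightarrow> f x" for x
  proof (rule tendsto_eventually)
    obtain K where "norm (f x) + norm x \<le> real K"
      using real_arch_simple by blast
    then have "u k x = f x" if "k \<ge> K" for k
    proof -
      have "norm (f x) \<le> real (Suc k)" "norm x \<le> real (Suc k)"
        using that \<open>norm (f x) + norm x \<le> real K\<close> norm_ge_zero[of x] norm_ge_zero[of "f x"]
        by linarith+
      then show ?thesis by (simp add: u_def clip_eq cutoff_eq_1)
    qed
    then show "\<forall>\<^sub>F k in sequentially. u k x = f x"
      by (auto simp: eventually_sequentially)
  qed
  have u1: "(\<lambda>k. L2_dist (u k) f) \<longlonglongrightarrow> 0"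
    by (rule L2_dominated_convergence[where w="\<lambda>x. norm (f x)"])
      (use f u_le u_lim in \<open>auto simp: L2_iff\<close>)
  have u2: "(\<lambda>k. \<integral>x. norm (u k x - f x) \<partial>lborel) \<longlonglongrightarrow> 0" if "integrable lborel f"
  proof -
    have "(\<lambda>k. \<integral>x. norm (u k x - f x) \<partial>lborel) \<longlonglongrightarrow> integral\<^sup>L (lborel :: 'a measure) (\<lambda>_. 0)"
    proof (rule integral_dominated_convergence)
      show "integrable lborel (\<lambda>x. 2 * norm (f x))" using that by auto
      show "AE x in lborel. (\<lambda>k. norm (u k x - f x)) \<longlonglongrightarrow> 0"
        using tendsto_norm_zero[OF LIM_zero[OF u_lim]] by (intro AE_I2)
      show "AE x in lborel. norm (norm (u k x - f x)) \<le> 2 * norm (f x)" for k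
      proof (rule AE_I2)
        fix x
        show "norm (norm (u k x - f x)) \<le> 2 * norm (f x)"
          using norm_triangle_ineq4[of "u k x" "f x"] u_le[of k x] by simp
      qed
    qed measurable
    then show ?thesis by simp
  qed
  have "\<forall>\<^sub>F k in sequentially. L2_dist (u k) f < e / 2"
    using e by (intro order_tendstoD(2)[OF u1]) auto
  moreover have "\<forall>\<^sub>F k in sequentially. integrable lborel f \<longrightarrow> (\<integral>x. norm (u k x - f x) \<partial>lborel) < e / 2"
    using e order_tendstoD(2)[OF u2, of "e / 2"] by (cases "integrable lborel f") auto
  ultimately have "\<forall>\<^sub>F k in sequentially. L2_dist (u k) f < e / 2 \<and>
      (integrable lborel f \<longrightarrow> (\<integral>x. norm (u k x - f x) \<partial>lborel) < e / 2)"
    by (rule eventually_conj)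
  then obtain k where k: "L2_dist (u k) f < e / 2"
    "integrable lborel f \<Longrightarrow> (\<integral>x. norm (u k x - f x) \<partial>lborel) < e / 2"
    by (auto simp: eventually_sequentially)
  define M where "M = real (Suc k)"
  have M: "0 < M" by (simp add: M_def)
  obtain g where g: "\<And>n::nat. continuous_on UNIV (g n)" and g_lim: "AE x in lborel. (\<lambda>n. g n x) \<longlonglongrightarrow> f x"
    using measurable_continuous_limit[OF fm] by blast
  \<comment> \<open>The continuous approximants are clipped and cut off exactly like
    \<open>u k\<close>. They thus share its dominating function \<open>M * cutoff M x\<close>, which
    is integrable and square-integrable, and still converge to \<open>u k\<close>.\<close>
  define h where "h n x = clip M (g n x) * complex_of_real (cutoff M x)" for n x
  have h_cont: "continuous_on UNIV (h n)" for n
    unfolding h_def using M g by (intro continuous_intros continuous_on_clip)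
  have [measurable]: "h n \<in> borel_measurable borel" for n
    using h_cont by (rule borel_measurable_continuous_onI)
  have h_le: "norm (h n x) \<le> M * cutoff M x" for n x
    unfolding h_def norm_mult using norm_clip_le(1)[OF M] cutoff_bounds[of M x]
    by (auto intro!: mult_right_mono)
  have int_w: "integrable lborel (\<lambda>x::'a. M * cutoff M x)"
    by (simp add: integrable_cutoff)
  have int_w2: "integrable lborel (\<lambda>x::'a. (M * cutoff M x)\<^sup>2)"
  proof (rule Bochner_Integration.integrable_bound)
    show "integrable lborel (\<lambda>x::'a. M\<^sup>2 * cutoff M x)"
      by (simp add: integrable_cutoff)
    show "AE x in lborel. norm ((M * cutoff M (x::'a))\<^sup>2) \<le> norm (M\<^sup>2 * cutoff M x)"
    proof (rule AE_I2)
      fix x :: 'a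
      have "(cutoff M x)\<^sup>2 \<le> cutoff M x"
        using cutoff_bounds[of M x] by (simp add: power2_eq_square mult_left_le)
      then show "norm ((M * cutoff M x)\<^sup>2) \<le> norm (M\<^sup>2 * cutoff M x)"
        using cutoff_bounds[of M x] by (simp add: power_mult_distrib abs_mult mult_left_mono)
    qed
  qed measurable
  have h_nice: "nice (h n)" for n
    unfolding nice_def
  proof (intro conjI exI allI)
    show "norm (h n x) \<le> M" for x
      using h_le[of n x] cutoff_bounds[of M x] M mult_left_le[of "cutoff M x" M] by linarith
    show "integrable lborel (h n)"
    proof (rule Bochner_Integration.integrable_bound[OF int_w])
      show "AE x in lborel. norm (h n x) \<le> norm (M * cutoff M x)"
        using order_trans[OF h_le[of n] abs_ge_self] by (intro AE_I2) simp
    qed measurable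
  qed (rule h_cont)
  have h_lim: "AE x in lborel. (\<lambda>n. h n x) \<longlonglongrightarrow> u k x"
    using g_lim
  proof eventually_elim
    case (elim x)
    have "continuous_on UNIV (clip M)"
      using M continuous_on_clip[OF M continuous_on_id] by simp
    then have "isCont (clip M) (f x)"
      by (simp add: continuous_on_eq_continuous_at)
    then show ?case
      unfolding h_def u_def M_def[symmetric] using elim by (intro tendsto_mult tendsto_const isCont_tendsto_compose[of "f x" "clip M"])
  qed
  have h1: "(\<lambda>n. L2_dist (h n) (u k)) \<longlonglongrightarrow> 0"
    by (rule L2_dominated_convergence[OF _ _ int_w2 h_lim]) (use h_le in auto)
  have uk_le: "norm (u k x) \<le> M * cutoff M x" for x
    unfolding u_def M_def[symmetric] norm_mult using norm_clip_le(1)[OF M] cutoff_bounds[of M x]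
    by (auto intro!: mult_right_mono)
  have h2: "(\<lambda>n. \<integral>x. norm (h n x - u k x) \<partial>lborel) \<longlonglongrightarrow> 0"
  proof -
    have "(\<lambda>n. \<integral>x. norm (h n x - u k x) \<partial>lborel) \<longlonglongrightarrow> integral\<^sup>L (lborel :: 'a measure) (\<lambda>_. 0)"
    proof (rule integral_dominated_convergence)
      show "integrable lborel (\<lambda>x::'a. 2 * (M * cutoff M x))" using int_w by simp
      show "AE x in lborel. (\<lambda>n. norm (h n x - u k x)) \<longlonglongrightarrow> 0"
        using h_lim by eventually_elim (intro tendsto_norm_zero LIM_zero)
      show "AE x in lborel. norm (norm (h n x - u k x)) \<le> 2 * (M * cutoff M x)" for n
      proof (rule AE_I2)
        fix x
        show "norm (norm (h n x - u k x)) \<le> 2 * (M * cutoff M x)"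
          using norm_triangle_ineq4[of "h n x" "u k x"] h_le[of n x] uk_le[of x] by simp
      qed
    qed measurable
    then show ?thesis by simp
  qed
  have "\<forall>\<^sub>F n in sequentially. L2_dist (h n) (u k) < e / 2 \<and> (\<integral>x. norm (h n x - u k x) \<partial>lborel) < e / 2"
    using e by (intro eventually_conj order_tendstoD(2)[OF h1] order_tendstoD(2)[OF h2]) auto
  then obtain n where n: "L2_dist (h n) (u k) < e / 2" "(\<integral>x. norm (h n x - u k x) \<partial>lborel) < e / 2"
    by (auto simp: eventually_sequentially)
  have uL2: "u k \<in> L2"
    by (rule L2_bounded_by[where w="\<lambda>x. norm (f x)"]) (use f u_le in \<open>auto simp: L2_iff\<close>)
  show ?thesis
  proof (rule that[OF h_nice[of n]])
    show "L2_dist (h n) f < e"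
      using L2_norm_triangle_diff[OF nice_L2[OF h_nice] uL2 f, of n] k(1) n(1) by linarith
    show "(\<integral>x. norm (h n x - f x) \<partial>lborel) < e" if int: "integrable lborel f"
    proof -
      have int_h: "integrable lborel (h n)" using h_nice by (simp add: nice_def)
      have int_u: "integrable lborel (u k)"
        by (rule Bochner_Integration.integrable_bound[OF int]) (use u_le in auto)
      have "(\<integral>x. norm (h n x - f x) \<partial>lborel) \<le> (\<integral>x. norm (h n x - u k x) + norm (u k x - f x) \<partial>lborel)"
      proof (rule integral_mono)
        show "norm (h n x - f x) \<le> norm (h n x - u k x) + norm (u k x - f x)" for x
          using norm_triangle_ineq[of "h n x - u k x" "u k x - f x"] by simp
      qed (use int int_h int_u in auto)
      also have "\<dots> = (\<integral>x. norm (h n x - u k x) \<partial>lborel) + (\<integral>x. norm (u k x - f x) \<partial>lborel)"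
        using int int_h int_u by (intro Bochner_Integration.integral_add) auto
      also have "\<dots> < e"
        using k(2)[OF int] n(2) by linarith
      finally show ?thesis .
    qed
  qed
qed

subsection \<open>The Fourier transform on square-integrable functions\<close>

lemma fourier_lincomb:
  assumes "integrable lborel f" "integrable lborel g"
  shows "fourier (\<lambda>x. a * f x + b * g x) y = a * fourier f y + b * fourier g y"
proof -
  have "fourier (\<lambda>x. a * f x + b * g x) y = (\<integral>x. a * (f x * wave (- y) x) + b * (g x * wave (- y) x) \<partial>lborel)"
    unfolding fourier_eq_wave by (intro Bochner_Integration.integral_cong refl) (simp add: algebra_simps)
  also have "\<dots> = a * fourier f y + b * fourier g y"
    unfolding fourier_eq_wave
    by (subst Bochner_Integration.integral_add) (auto intro!: integrable_mult_wave assms)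
  finally show ?thesis .
qed

lemma fourier_diff:
  assumes "integrable lborel f" "integrable lborel g"
  shows "fourier (\<lambda>x. f x - g x) y = fourier f y - fourier g y"
  using fourier_lincomb[OF assms, of 1 "- 1"] by simp

lemma nice_diff:
  assumes "nice f" "nice g"
  shows "nice (\<lambda>x. f x - g x)"
proof -
  obtain A B where "\<And>x. norm (f x) \<le> A" "\<And>x. norm (g x) \<le> B"
    using assms unfolding nice_def by auto
  then have "norm (f x - g x) \<le> A + B" for x
    using norm_triangle_ineq4[of "f x" "g x"] by (meson add_mono order_trans)
  then show ?thesis
    using assms unfolding nice_def by (auto intro!: continuous_intros)
qed

lemma L2_norm_fourier_nice: "nice g \<Longrightarrow> L2_norm (fourier g) = L2_norm g"
  by (simp add: L2_norm_def plancherel_nice)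

lemma L2_norm_fourier_nice_diff:
  assumes "nice f" "nice g"
  shows "L2_dist (fourier f) (fourier g) = L2_dist f g"
  using L2_norm_fourier_nice[OF nice_diff[OF assms]] assms
  by (simp add: fourier_diff nice_def cong: L2_norm_def)

lemma L2_approximable:
  assumes "f \<in> L2"
  obtains h where "\<And>k. nice (h k)" "\<And>k. L2_dist (h k) f < (1 / 2) ^ k"
    "\<And>k. integrable lborel f \<Longrightarrow> (\<integral>x. norm (h k x - f x) \<partial>lborel) < (1 / 2) ^ k"
proof -
  have "\<exists>h. nice h \<and> L2_dist h f < (1 / 2) ^ k \<and>
      (integrable lborel f \<longrightarrow> (\<integral>x. norm (h x - f x) \<partial>lborel) < (1 / 2) ^ k)" for k :: nat
    using nice_dense[OF assms, of "(1 / 2) ^ k"] by (metis half_gt_zero_iff zero_less_one zero_less_power)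
  then show ?thesis using that by metis
qed

lemma tendsto_zero_half_power:
  assumes "\<And>k. norm (a k :: real) \<le> (1 / 2) ^ k"
  shows "a \<longlonglongrightarrow> 0"
  by (rule Lim_null_comparison[OF _ LIMSEQ_power_zero[of "1 / 2"]]) (use assms in auto)

text \<open>Nice approximants converge to f in L1 and in L2. The first makes their transforms
  converge pointwise to \<open>fourier f\<close>, the second makes them Cauchy in L2 by Plancherel,
  so \<open>fourier f\<close> is their L2 limit.\<close>

lemma
  assumes f: "f \<in> L2" and int: "integrable lborel f"
  shows fourier_in_L2: "fourier f \<in> L2"
    and plancherel: "L2_norm (fourier f) = L2_norm f"
proof -
  obtain h where h: "\<And>k. nice (h k)" and h1: "\<And>k. L2_dist (h k) f < (1 / 2) ^ k"
    and h2: "\<And>k. (\<integral>x. norm (h k x - f x) \<partial>lborel) < (1 / 2) ^ k"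
    using L2_approximable[OF f] int by metis
  have int_h: "integrable lborel (h k)" for k
    using h by (simp add: nice_def)
  have lim_f: "(\<lambda>k. L2_dist (h k) f) \<longlonglongrightarrow> 0"
    by (rule tendsto_zero_half_power) (use h1 in \<open>simp add: L2_norm_nonneg less_imp_le\<close>)
  have cauchy: "L2_Cauchy (\<lambda>k. fourier (h k))"
    using L2_convergent_imp_Cauchy[OF nice_L2[OF h] f lim_f]
    unfolding L2_Cauchy_def L2_norm_fourier_nice_diff[OF h h] .
  have pt: "(\<lambda>k. fourier (h k) y) \<longlonglongrightarrow> fourier f y" for y
  proof (rule LIM_zero_cancel, rule tendsto_norm_zero_cancel, rule tendsto_zero_half_power)
    fix k
    have "norm (fourier (h k) y - fourier f y) \<le> (\<integral>x. norm (h k x - f x) \<partial>lborel)"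
      unfolding fourier_diff[OF int_h int, symmetric] by (rule norm_fourier_le)
    then show "norm (norm (fourier (h k) y - fourier f y)) \<le> (1 / 2) ^ k"
      using h2[of k] by simp
  qed
  have meas: "fourier f \<in> borel_measurable borel"
    using L2_measurable[OF f] by measurable
  have *: "AE y in lborel. (\<lambda>k. fourier (h k) y) \<longlonglongrightarrow> fourier f y"
    using pt by simp
  show F: "fourier f \<in> L2"
    by (rule L2_Cauchy_limit[OF plancherel_nice(1)[OF h] meas * cauchy])
  have "(\<lambda>k. L2_norm (fourier (h k))) \<longlonglongrightarrow> L2_norm (fourier f)"
    by (rule L2_norm_tendsto[OF plancherel_nice(1)[OF h] F L2_Cauchy_tendsto[OF plancherel_nice(1)[OF h] meas * cauchy]])
  moreover have "(\<lambda>k. L2_norm (fourier (h k))) \<longlonglongrightarrow> L2_norm f"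
    unfolding L2_norm_fourier_nice[OF h] by (rule L2_norm_tendsto[OF nice_L2[OF h] f lim_f])
  ultimately show "L2_norm (fourier f) = L2_norm f"
    by (rule LIMSEQ_unique)
qed

lemma is_fourier_L2_norm:
  assumes "is_fourier_L2 f g"
  shows "L2_norm g = L2_norm f"
proof -
  obtain F where F: "\<And>k::nat. F k \<in> L2" "\<And>k. integrable lborel (F k)" "\<And>k. fourier (F k) \<in> L2"
    and fg: "f \<in> L2" "g \<in> L2"
    and lim: "(\<lambda>k. L2_dist (F k) f) \<longlonglongrightarrow> 0" "(\<lambda>k. L2_dist (fourier (F k)) g) \<longlonglongrightarrow> 0"
    using assms unfolding is_fourier_L2_def by blast
  have "(\<lambda>k. L2_norm (F k)) \<longlonglongrightarrow> L2_norm f"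
    by (rule L2_norm_tendsto[OF F(1) fg(1) lim(1)])
  moreover have "(\<lambda>k. L2_norm (F k)) \<longlonglongrightarrow> L2_norm g"
    using L2_norm_tendsto[OF F(3) fg(2) lim(2)] by (simp add: plancherel F)
  ultimately show ?thesis using LIMSEQ_unique by blast
qed

lemma L2_norm_lincomb_tendsto:
  assumes "\<And>k. F k \<in> L2" "\<And>k. G k \<in> L2" "f \<in> L2" "g \<in> L2"
    and "(\<lambda>k. L2_dist (F k) f) \<longlonglongrightarrow> 0" "(\<lambda>k. L2_dist (G k) g) \<longlonglongrightarrow> 0"
  shows "(\<lambda>k. L2_norm (\<lambda>x. (a * F k x + b * G k x) - (a * f x + b * g x))) \<longlonglongrightarrow> 0"
proof (rule tendsto_sandwich[OF _ _ tendsto_const])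
  show "\<forall>\<^sub>F k in sequentially. 0 \<le> L2_norm (\<lambda>x. (a * F k x + b * G k x) - (a * f x + b * g x))"
    by (simp add: L2_norm_nonneg)
  show "\<forall>\<^sub>F k in sequentially. L2_norm (\<lambda>x. (a * F k x + b * G k x) - (a * f x + b * g x)) \<le>
      norm a * L2_dist (F k) f + norm b * L2_dist (G k) g"
  proof (intro always_eventually allI)
    fix k
    have "(\<lambda>x. (a * F k x + b * G k x) - (a * f x + b * g x)) = (\<lambda>x. a * (F k x - f x) + b * (G k x - g x))"
      by (simp add: algebra_simps)
    then show "L2_norm (\<lambda>x. (a * F k x + b * G k x) - (a * f x + b * g x)) \<le>
        norm a * L2_dist (F k) f + norm b * L2_dist (G k) g"
      using L2_norm_triangle[OF L2_cmult[OF L2_diff[OF assms(1,3)], of a k] L2_cmult[OF L2_diff[OF assms(2,4)], of b k]]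
      by (simp add: L2_norm_cmult)
  qed
  show "(\<lambda>k. norm a * L2_dist (F k) f + norm b * L2_dist (G k) g) \<longlonglongrightarrow> 0"
    by (rule tendsto_eq_intros tendsto_mult_left assms(5,6) | simp)+
qed

lemma is_fourier_L2_lincomb:
  assumes "is_fourier_L2 f f'" "is_fourier_L2 g g'"
  shows "is_fourier_L2 (\<lambda>x. a * f x + b * g x) (\<lambda>x. a * f' x + b * g' x)"
proof -
  obtain F where F: "\<And>k::nat. F k \<in> L2" "\<And>k. integrable lborel (F k)" "\<And>k. fourier (F k) \<in> L2"
    and f: "f \<in> L2" "f' \<in> L2"
    and limf: "(\<lambda>k. L2_dist (F k) f) \<longlonglongrightarrow> 0" "(\<lambda>k. L2_norm (\<lambda>x. fourier (F k) x - f' x)) \<longlonglongrightarrow> 0"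
    using assms(1) unfolding is_fourier_L2_def by blast
  obtain G where G: "\<And>k::nat. G k \<in> L2" "\<And>k. integrable lborel (G k)" "\<And>k. fourier (G k) \<in> L2"
    and g: "g \<in> L2" "g' \<in> L2"
    and limg: "(\<lambda>k. L2_dist (G k) g) \<longlonglongrightarrow> 0" "(\<lambda>k. L2_norm (\<lambda>x. fourier (G k) x - g' x)) \<longlonglongrightarrow> 0"
    using assms(2) unfolding is_fourier_L2_def by blast
  have eq: "fourier (\<lambda>x. a * F k x + b * G k x) = (\<lambda>x. a * fourier (F k) x + b * fourier (G k) x)" for k
    by (intro ext fourier_lincomb F G)
  show ?thesis
    unfolding is_fourier_L2_def
  proof (intro conjI exI[of _ "\<lambda>k x. a * F k x + b * G k x"] allI)
    show "integrable lborel (\<lambda>x. a * F k x + b * G k x)" for k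
      using F(2) G(2) by auto
  qed (use F G f g limf limg in \<open>auto simp: eq intro!: L2_lincomb L2_norm_lincomb_tendsto\<close>)
qed

text \<open>Both directions are the isometry applied to the difference. From left to right the
  transform is well defined almost everywhere, from right to left it is injective. Every later
  identity about \<open>fourier_L2\<close> or about a chosen preimage passes through this
  equivalence.\<close>

lemma is_fourier_L2_unique:
  assumes "is_fourier_L2 f f'" "is_fourier_L2 g g'"
  shows "(AE x in lborel. f x = g x) \<longleftrightarrow> (AE x in lborel. f' x = g' x)"
proof -
  have "is_fourier_L2 (\<lambda>x. f x - g x) (\<lambda>x. f' x - g' x)"
    using is_fourier_L2_lincomb[OF assms, of 1 "- 1"] by simp
  note eq = is_fourier_L2_norm[OF this]
  have L2: "f \<in> L2" "f' \<in> L2" "g \<in> L2" "g' \<in> L2"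
    using assms by (auto simp: is_fourier_L2_def)
  have iff: "(AE x in lborel. u x = v x) \<longleftrightarrow> L2_dist u v = 0"
    if "u \<in> L2" "v \<in> L2" for u v :: "'a \<Rightarrow> complex"
  proof
    assume "AE x in lborel. u x = v x"
    then have "L2_dist u v = L2_norm (\<lambda>x::'a. 0)"
      using that by (intro L2_norm_cong_AE) (auto simp: L2_iff)
    then show "L2_dist u v = 0" by (simp add: L2_norm_def)
  next
    assume "L2_dist u v = 0"
    then show "AE x in lborel. u x = v x"
      using L2_norm_eq_0[OF L2_diff[OF that]] by simp
  qed
  show ?thesis
    using eq by (simp add: iff L2)
qed

lemma L2_reflect:
  fixes f :: "'a::euclidean_space \<Rightarrow> complex"
  assumes "f \<in> L2"
  shows "(\<lambda>x. f (- x)) \<in> L2" "L2_norm (\<lambda>x. f (- x)) = L2_norm f"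
proof -
  have [measurable]: "f \<in> borel_measurable borel" using assms by (rule L2_measurable)
  show "(\<lambda>x. f (- x)) \<in> L2"
    using assms integrable_lborel_affine[of "-1" "\<lambda>x. (norm (f x))\<^sup>2" 0] by (simp add: L2_iff)
  show "L2_norm (\<lambda>x. f (- x)) = L2_norm f"
    using integral_lborel_affine[of "-1" "\<lambda>x. (norm (f x))\<^sup>2" 0] by (simp add: L2_norm_def)
qed

text \<open>Regularise the transform of \<open>g\<close> itself by a Gaussian window.\<close>

lemma nice_approx_by_fourier:
  fixes g :: "'a::euclidean_space \<Rightarrow> complex"
  assumes g: "nice g" and e: "0 < e"
  obtains F where "F \<in> L2" "integrable lborel F"
    "L2_norm (\<lambda>y. F y - fourier g (- y)) < e" "L2_dist (fourier F) g < e"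
proof -
  obtain B where cont: "continuous_on UNIV g" and B: "\<And>x. norm (g x) \<le> B" and int: "integrable lborel g"
    using g unfolding nice_def by auto
  have [measurable]: "g \<in> borel_measurable borel"
    by (rule nice_measurable[OF g])
  define F where "F k y = fourier g (- y) * complex_of_real (window k y)"
    for k y
  have [measurable]: "F k \<in> borel_measurable borel" for k
    unfolding F_def[abs_def] by measurable
  have F0: "(\<lambda>y. fourier g (- y)) \<in> L2"
    by (rule L2_reflect(1)[OF plancherel_nice(1)[OF g]])
  have F_le: "norm (F k y) \<le> norm (fourier g (- y))" for k y
    unfolding F_def norm_mult norm_of_real abs_of_pos[OF gaussian_window_pos]
    by (rule mult_left_le) (auto simp: gaussian_window_le_1 simp del: of_nat_Suc)
  have F_L2: "F k \<in> L2" for k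
    by (rule L2_bounded_by[where w="\<lambda>y. norm (fourier g (- y))"]) (use F_le F0 in \<open>auto simp: L2_iff\<close>)
  have F_int: "integrable lborel (F k)" for k
  proof -
    have "integrable lborel (\<lambda>y. complex_of_real (window k y) * fourier g (- y))"
      by (rule integrable_mult_bounded[OF integrable_window, where B="\<integral>x. norm (g x) \<partial>lborel"])
        (auto intro: norm_fourier_le)
    then show ?thesis unfolding F_def by (simp add: mult.commute)
  qed
  \<comment> \<open>F k is a reflected windowed transform, so the substitution y to -y turns its
    forward transform into the windowed inversion of \<open>fourier g\<close>.\<close>
  have fourier_F: "fourier (F k) x = (gaussian_mean g (inverse (real (Suc k))) x)" for k x
  proof -
    define h where "h y = fourier g y * complex_of_real (window k y) * wave x y" for y
    have "fourier (F k) x = (\<integral>y. h (0 + (- 1) *\<^sub>R y) \<partial>lborel)"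
      unfolding fourier_eq_wave[of "F k"] F_def h_def
      by (simp add: gaussian_window_def wave_minus_left wave_minus_right)
    also have "\<dots> = (\<integral>y. h y \<partial>lborel)"
      using integral_lborel_affine[of "-1" h 0] by (simp add: h_def[abs_def])
    also have "\<dots> = (gaussian_mean g (inverse (real (Suc k))) x)"
      unfolding h_def by (rule integral_fourier_window[OF int]) simp
    finally show ?thesis .
  qed
  have lim1: "(\<lambda>k. L2_norm (\<lambda>y. F k y - fourier g (- y))) \<longlonglongrightarrow> 0"
  proof (rule L2_dominated_convergence[where w="\<lambda>y. norm (fourier g (- y))"])
    show "integrable lborel (\<lambda>y. (norm (fourier g (- y)))\<^sup>2)"
      using F0 by (simp add: L2_iff)
    show "AE y in lborel. (\<lambda>k. F k y) \<longlonglongrightarrow> fourier g (- y)"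
    proof (rule AE_I2)
      fix y
      have "(\<lambda>k. F k y) \<longlonglongrightarrow> fourier g (- y) * complex_of_real 1"
        unfolding F_def by (intro tendsto_intros window_tendsto)
      then show "(\<lambda>k. F k y) \<longlonglongrightarrow> fourier g (- y)" by simp
    qed
  qed (use F_le in auto)
  \<comment> \<open>Plancherel makes the transforms Cauchy because the F k converge in L2; the
    pointwise convergence of Gaussian means then identifies their limit as g.\<close>
  have "L2_Cauchy (\<lambda>k. fourier (F k))"
  proof -
    have "L2_dist (fourier (F i)) (fourier (F j)) = L2_dist (F i) (F j)" for i j
    proof -
      have "fourier (\<lambda>x. F i x - F j x) = (\<lambda>x. fourier (F i) x - fourier (F j) x)"
        by (intro ext fourier_diff F_int)
      then show ?thesis
        using plancherel[OF L2_diff[OF F_L2 F_L2] Bochner_Integration.integrable_diff[OF F_int F_int], of i j]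
        by (simp only:)
    qed
    then show ?thesis
      using L2_convergent_imp_Cauchy[OF F_L2 F0 lim1] unfolding L2_Cauchy_def by simp
  qed
  then have lim2: "(\<lambda>k. L2_dist (fourier (F k)) g) \<longlonglongrightarrow> 0"
  proof (rule L2_Cauchy_tendsto[OF fourier_in_L2[OF F_L2 F_int], rotated 2])
    show "AE x in lborel. (\<lambda>k. fourier (F k) x) \<longlonglongrightarrow> g x"
      unfolding fourier_F by (intro AE_I2 gaussian_mean_tendsto[OF cont B LIMSEQ_inverse_real_of_nat])
  qed measurable
  have "\<forall>\<^sub>F k in sequentially. L2_norm (\<lambda>y. F k y - fourier g (- y)) < e \<and> L2_dist (fourier (F k)) g < e"
    using e by (intro eventually_conj order_tendstoD(2)[OF lim1] order_tendstoD(2)[OF lim2]) auto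
  then show ?thesis
    using that F_L2 F_int by (auto simp: eventually_sequentially)
qed

text \<open>Existence is the completeness of L2 applied to transforms of nice approximants. For
  surjectivity the preimage is the reflected transform of f, as in the inversion formula.\<close>

lemma
  assumes f: "f \<in> L2"
  shows is_fourier_L2_exists: "\<exists>g. is_fourier_L2 f g"
    and is_fourier_L2_surj: "\<exists>g. is_fourier_L2 g f"
proof -
  obtain h where h: "\<And>k. nice (h k)" and h1: "\<And>k. L2_dist (h k) f < (1 / 2) ^ k"
    using L2_approximable[OF f] by metis
  have int_h: "integrable lborel (h k)" for k
    using h by (simp add: nice_def)
  have lim_f: "(\<lambda>k. L2_dist (h k) f) \<longlonglongrightarrow> 0"
    by (rule tendsto_zero_half_power) (use h1 in \<open>simp add: L2_norm_nonneg less_imp_le\<close>)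
  have step: "L2_norm (\<lambda>x. fourier (h (Suc k)) x - fourier (h k) x) \<le> 2 * (1 / 2) ^ k" for k
  proof -
    have "L2_dist (h (Suc k)) (h k) \<le> (1 / 2) ^ Suc k + (1 / 2) ^ k"
      using L2_norm_triangle_diff[OF nice_L2[OF h] f nice_L2[OF h], of "Suc k" k] h1[of "Suc k"] h1[of k]
      unfolding L2_norm_minus_commute[of f] by linarith
    also have "\<dots> \<le> 2 * (1 / 2) ^ k" by simp
    finally show ?thesis by (simp add: L2_norm_fourier_nice_diff h)
  qed
  obtain g where g: "g \<in> L2" and lim_g: "(\<lambda>k. L2_dist (fourier (h k)) g) \<longlonglongrightarrow> 0"
  proof (rule L2_complete[of "\<lambda>k. fourier (h k)" 2])
    show "fourier (h k) \<in> L2" for k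
      by (rule plancherel_nice(1)[OF h])
    show "L2_norm (\<lambda>x. fourier (h (Suc k)) x - fourier (h k) x) \<le> 2 * (1 / 2) ^ k" for k
      by (rule step)
  qed
  show "\<exists>g. is_fourier_L2 f g"
    unfolding is_fourier_L2_def
    by (intro exI[of _ g] exI[of _ h] conjI allI f g nice_L2 h plancherel_nice(1) int_h lim_f lim_g)
  have gm: "g \<in> borel_measurable borel" using g by (rule L2_measurable)
  have "\<exists>F. F \<in> L2 \<and> integrable lborel F \<and> L2_norm (\<lambda>y. F y - fourier (h k) (- y)) < (1 / 2) ^ k \<and>
      L2_dist (fourier F) (h k) < (1 / 2) ^ k" for k
    by (rule nice_approx_by_fourier[OF h, of "(1 / 2) ^ k" k]) (simp, blast)
  then obtain F where F: "\<And>k. F k \<in> L2" "\<And>k. integrable lborel (F k)"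
    and F1: "\<And>k. L2_norm (\<lambda>y. F k y - fourier (h k) (- y)) < (1 / 2) ^ k"
    and F2: "\<And>k. L2_dist (fourier (F k)) (h k) < (1 / 2) ^ k"
    by metis
  \<comment> \<open>Diagonal choice: F k is close to the reflected transform of h k while its
    transform is close to h k. Both errors are at most (1/2)^k and add to those of h k against f and
    of \<open>fourier (h k)\<close> against g.\<close>
  have "is_fourier_L2 (\<lambda>y. g (- y)) f"
    unfolding is_fourier_L2_def
  proof (intro conjI exI[of _ F] allI F fourier_in_L2 f L2_reflect(1)[OF g])
    show "(\<lambda>k. L2_norm (\<lambda>y. F k y - g (- y))) \<longlonglongrightarrow> 0"
    proof (rule tendsto_sandwich[OF _ _ tendsto_const])
      show "\<forall>\<^sub>F k in sequentially. L2_norm (\<lambda>y. F k y - g (- y)) \<le> (1 / 2) ^ k + L2_dist (fourier (h k)) g"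
      proof (intro always_eventually allI)
        fix k
        have "L2_norm (\<lambda>y. fourier (h k) (- y) - g (- y)) = L2_dist (fourier (h k)) g"
          by (rule L2_reflect(2)[OF L2_diff[OF plancherel_nice(1)[OF h] g]])
        then show "L2_norm (\<lambda>y. F k y - g (- y)) \<le> (1 / 2) ^ k + L2_dist (fourier (h k)) g"
          using L2_norm_triangle_diff[OF F(1) L2_reflect(1)[OF plancherel_nice(1)[OF h]] L2_reflect(1)[OF g], of k k]
            F1[of k] by linarith
      qed
      have "(\<lambda>k. (1 / 2) ^ k + L2_dist (fourier (h k)) g) \<longlonglongrightarrow> 0 + 0"
        by (intro tendsto_add lim_g LIMSEQ_power_zero) simp
      then show "(\<lambda>k. (1 / 2) ^ k + L2_dist (fourier (h k)) g) \<longlonglongrightarrow> 0" by simp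
    qed (simp add: L2_norm_nonneg)
    show "(\<lambda>k. L2_dist (fourier (F k)) f) \<longlonglongrightarrow> 0"
    proof (rule tendsto_sandwich[OF _ _ tendsto_const])
      show "\<forall>\<^sub>F k in sequentially. L2_dist (fourier (F k)) f \<le> (1 / 2) ^ k + L2_dist (h k) f"
      proof (intro always_eventually allI)
        fix k
        show "L2_dist (fourier (F k)) f \<le> (1 / 2) ^ k + L2_dist (h k) f"
          using L2_norm_triangle_diff[OF fourier_in_L2[OF F] nice_L2[OF h] f, of k k] F2[of k] by linarith
      qed
      have "(\<lambda>k. (1 / 2) ^ k + L2_dist (h k) f) \<longlonglongrightarrow> 0 + 0"
        by (intro tendsto_add lim_f LIMSEQ_power_zero) simp
      then show "(\<lambda>k. (1 / 2) ^ k + L2_dist (h k) f) \<longlonglongrightarrow> 0" by simp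
    qed (simp add: L2_norm_nonneg)
  qed
  then show "\<exists>g. is_fourier_L2 g f" by blast
qed

lemma is_fourier_L2_fourier_L2: "f \<in> L2 \<Longrightarrow> is_fourier_L2 f (fourier_L2 f)"
  unfolding fourier_L2_def by (rule someI_ex[OF is_fourier_L2_exists])

subsection \<open>Fourier transforms of derivatives, translates and dilates\<close>

lemma integrable_bounded_support:
  fixes f :: "'a::euclidean_space \<Rightarrow> 'b::euclidean_space"
  assumes cont: "continuous_on UNIV f" and supp: "\<And>x. R < norm x \<Longrightarrow> f x = 0"
  obtains B where "0 \<le> B" "\<And>x. norm (f x) \<le> B * indicator (cball 0 R) x" "integrable lborel f"
proof -
  have "compact (f ` cball 0 R)"
    by (intro compact_continuous_image continuous_on_subset[OF cont]) auto
  then obtain B where "\<forall>y\<in>f ` cball 0 R. norm y \<le> B"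
    using compact_imp_bounded bounded_iff by blast
  then have B: "\<And>x. x \<in> cball 0 R \<Longrightarrow> norm (f x) \<le> B"
    by blast
  have le: "norm (f x) \<le> max B 0 * indicator (cball 0 R) x" for x
    using B[of x] supp[of x] by (auto simp: indicator_def)
  have int: "integrable lborel (\<lambda>x::'a. max B 0 * indicator (cball 0 R) x)"
    by (intro integrable_mult_right integrable_real_indicator)
      (use emeasure_bounded_finite[OF bounded_cball] in auto)
  have "integrable lborel f"
  proof (rule Bochner_Integration.integrable_bound[OF int])
    show "f \<in> borel_measurable lborel"
      using borel_measurable_continuous_onI[OF cont] by simp
    show "AE x in lborel. norm (f x) \<le> norm (max B 0 * indicator (cball 0 R) x)"
      using order_trans[OF le abs_ge_self] by (intro AE_I2) simp
  qed
  then show ?thesis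
    using that[of "max B 0"] le by simp
qed

lemma fourier_translate:
  assumes [measurable]: "f \<in> borel_measurable borel"
  shows "fourier (\<lambda>x. f (x - w)) y = wave (- y) w * fourier f y"
proof -
  have "fourier (\<lambda>x. f (x - w)) y = (\<integral>x. f ((w + 1 *\<^sub>R x) - w) * wave (- y) (w + 1 *\<^sub>R x) \<partial>lborel)"
    unfolding fourier_eq_wave
    using integral_lborel_affine[of 1 "\<lambda>x. f (x - w) * wave (- y) x" w] by simp
  also have "\<dots> = (\<integral>x. wave (- y) w * (f x * wave (- y) x) \<partial>lborel)"
    by (intro Bochner_Integration.integral_cong refl) (simp add: wave_add_right)
  also have "\<dots> = wave (- y) w * fourier f y"
    unfolding fourier_eq_wave by (rule integral_mult_right_zero)
  finally show ?thesis .
qed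

lemma fourier_dilate:
  fixes f :: "'a::euclidean_space \<Rightarrow> complex"
  assumes [measurable]: "f \<in> borel_measurable borel" and r: "0 < r"
  shows "fourier (\<lambda>x. f ((1 / r) *\<^sub>R x)) y = complex_of_real (r ^ DIM('a)) * fourier f (r *\<^sub>R y)"
proof -
  have "fourier (\<lambda>x. f ((1 / r) *\<^sub>R x)) y =
      \<bar>r\<bar> ^ DIM('a) *\<^sub>R (\<integral>x. f ((1 / r) *\<^sub>R (0 + r *\<^sub>R x)) * wave (- y) (0 + r *\<^sub>R x) \<partial>lborel)"
    unfolding fourier_eq_wave
    by (rule integral_lborel_affine[symmetric]) (use r in auto)
  also have "\<dots> = complex_of_real (r ^ DIM('a)) * (\<integral>x. f x * wave (- (r *\<^sub>R y)) x \<partial>lborel)"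
    using r by (simp add: scaleR_conv_of_real wave_minus_left wave_scaleR)
  finally show ?thesis
    unfolding fourier_eq_wave .
qed

text \<open>The factor r^n from dilating the function is exactly the Jacobian of the substitution on
  the Fourier side. This invariance is why the size of the bumps does not enter the final
  estimate.\<close>

lemma
  fixes f :: "'a::euclidean_space \<Rightarrow> complex"
  assumes [measurable]: "f \<in> borel_measurable borel" and r: "0 < r"
  shows integrable_fourier_dilate: "integrable lborel (fourier (\<lambda>x. f ((1 / r) *\<^sub>R x))) \<longleftrightarrow> integrable lborel (fourier f)"
    and integral_norm_fourier_dilate:
      "(\<integral>y. norm (fourier (\<lambda>x. f ((1 / r) *\<^sub>R x)) y) \<partial>lborel) = (\<integral>y. norm (fourier f y) \<partial>lborel)"
proof -
  have eq: "fourier (\<lambda>x. f ((1 / r) *\<^sub>R x)) = (\<lambda>y. complex_of_real (r ^ DIM('a)) * fourier f (0 + r *\<^sub>R y))"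
    using fourier_dilate[OF assms] by auto
  have "integrable lborel (fourier (\<lambda>x. f ((1 / r) *\<^sub>R x))) \<longleftrightarrow> integrable lborel (\<lambda>y. fourier f (0 + r *\<^sub>R y))"
    unfolding eq
    using r integrable_mult_right[of "complex_of_real (1 / r ^ DIM('a))" lborel
        "\<lambda>y. complex_of_real (r ^ DIM('a)) * fourier f (0 + r *\<^sub>R y)"]
    by (auto simp del: of_real_power)
  also have "\<dots> \<longleftrightarrow> integrable lborel (fourier f)"
    by (rule integrable_lborel_affine) (use r in auto)
  finally show "integrable lborel (fourier (\<lambda>x. f ((1 / r) *\<^sub>R x))) \<longleftrightarrow> integrable lborel (fourier f)" .
  have "(\<integral>y. norm (fourier (\<lambda>x. f ((1 / r) *\<^sub>R x)) y) \<partial>lborel) =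
      \<bar>r\<bar> ^ DIM('a) *\<^sub>R (\<integral>y. norm (fourier f (0 + r *\<^sub>R y)) \<partial>lborel)"
    unfolding eq using r by (simp add: norm_mult norm_power)
  also have "\<dots> = (\<integral>y. norm (fourier f y) \<partial>lborel)"
    by (rule integral_lborel_affine) (use r in auto)
  finally show "(\<integral>y. norm (fourier (\<lambda>x. f ((1 / r) *\<^sub>R x)) y) \<partial>lborel) = (\<integral>y. norm (fourier f y) \<partial>lborel)" .
qed

lemma has_vector_derivative_quotient:
  fixes f :: "real \<Rightarrow> 'b::real_normed_vector"
  assumes "(f has_vector_derivative D) (at x)"
  shows "((\<lambda>h. (1 / h) *\<^sub>R (f (x + h) - f x)) \<longlongrightarrow> D) (at 0)"
proof (rule LIM_zero_cancel, rule tendsto_norm_zero_cancel)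
  have lim: "((\<lambda>h. norm (f (x + h) - f x - h *\<^sub>R D) / norm h) \<longlongrightarrow> 0) (at 0)"
    using assms by (simp add: has_vector_derivative_def has_derivative_at)
  show "((\<lambda>h. norm ((1 / h) *\<^sub>R (f (x + h) - f x) - D)) \<longlongrightarrow> 0) (at 0)"
  proof (rule Lim_transform_eventually[OF lim], rule eventually_mono[OF eventually_neq_at_within[of 0]])
    fix h :: real assume h: "h \<noteq> 0"
    then have "(1 / h) *\<^sub>R (f (x + h) - f x) - D = (1 / h) *\<^sub>R (f (x + h) - f x - h *\<^sub>R D)"
      by (simp add: scaleR_diff_right)
    then show "norm (f (x + h) - f x - h *\<^sub>R D) / norm h = norm ((1 / h) *\<^sub>R (f (x + h) - f x) - D)"
      by simp
  qed
qed

text \<open>Proved by transforming difference quotients.\<close>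

lemma fourier_directional_derivative:
  fixes g :: "'a::euclidean_space \<Rightarrow> complex"
  assumes deriv: "\<And>x. (g has_derivative (\<lambda>v. g' v x)) (at x)" and cont: "continuous_on UNIV (g' v)"
    and supp: "\<And>x. R < norm x \<Longrightarrow> g x = 0" "\<And>x. R < norm x \<Longrightarrow> g' v x = 0"
  shows "fourier (g' v) y = 2 * pi * \<i> * (y \<bullet> v) * fourier g y"
proof -
  have contg: "continuous_on UNIV g"
    using deriv by (rule has_derivative_continuous_on)
  have meas[measurable]: "g \<in> borel_measurable borel" "g' v \<in> borel_measurable borel"
    using contg cont by (auto intro: borel_measurable_continuous_onI)
  have g_int: "integrable lborel g"
    using integrable_bounded_support[OF contg supp(1)] by blast
  obtain B where B0: "0 \<le> B" and B': "\<And>x. norm (g' v x) \<le> B * indicator (cball 0 R) x"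
    using integrable_bounded_support[OF cont supp(2)] by blast
  have B: "norm (g' v x) \<le> B" for x
    using B'[of x] B0 by (auto simp: indicator_def of_bool_def split: if_splits)
  define e where "e k = inverse (real (Suc k))" for k
  have e: "0 < e k" "e k \<le> 1" for k
    by (auto simp: e_def inverse_le_1_iff)
  have e_lim: "e \<longlonglongrightarrow> 0"
    unfolding e_def by (rule LIMSEQ_inverse_real_of_nat)
  have e_at: "filterlim e (at 0) sequentially"
  proof -
    have "e k \<noteq> 0" for k using e(1)[of k] by simp
    then show ?thesis by (simp add: filterlim_at e_lim)
  qed
  have line: "((\<lambda>t. g (x + t *\<^sub>R v)) has_vector_derivative g' v (x + t *\<^sub>R v)) (at t)" for x t
  proof -
    have lin: "g' (s *\<^sub>R v) z = s *\<^sub>R g' v z" for s z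
      using linear_scale[OF has_derivative_linear[OF deriv]] .
    have "((\<lambda>t. g (x + t *\<^sub>R v)) has_derivative (\<lambda>s. g' (s *\<^sub>R v) (x + t *\<^sub>R v))) (at t)"
      by (rule has_derivative_compose[OF _ deriv]) (auto intro!: derivative_eq_intros)
    then show ?thesis
      unfolding has_vector_derivative_def lin .
  qed
  define Q where "Q k x = (1 / complex_of_real (e k)) * (g (x + e k *\<^sub>R v) - g x)" for k x
  \<comment> \<open>A dominating function that is uniform in k: the mean value inequality bounds the
    quotient by B, and since e k <= 1 its support grows by at most norm v.\<close>
  have Q_le: "norm (Q k x) \<le> B * indicator (cball 0 (R + norm v)) x" for k x
  proof (cases "norm x \<le> R + norm v")
    case True
    have "norm (g (x + e k *\<^sub>R v) - g (x + 0 *\<^sub>R v)) \<le> B * norm (e k - 0)"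
    proof (rule differentiable_bound[where S=UNIV and f="\<lambda>t. g (x + t *\<^sub>R v)"
          and f'="\<lambda>t s. s *\<^sub>R g' v (x + t *\<^sub>R v)"])
      show "((\<lambda>t. g (x + t *\<^sub>R v)) has_derivative (\<lambda>s. s *\<^sub>R g' v (x + t *\<^sub>R v))) (at t within UNIV)" for t
        using line[of x t] by (simp add: has_vector_derivative_def)
      show "onorm (\<lambda>s. s *\<^sub>R g' v (x + t *\<^sub>R v)) \<le> B" for t
      proof (rule onorm_bound[OF B0])
        show "norm (s *\<^sub>R g' v (x + t *\<^sub>R v)) \<le> B * norm s" for s
          using mult_right_mono[OF B[of "x + t *\<^sub>R v"], of "\<bar>s\<bar>"] by (simp add: mult.commute)
      qed
    qed auto
    then have "norm (g (x + e k *\<^sub>R v) - g x) / e k \<le> B"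
      using e(1)[of k] by (simp add: divide_le_eq)
    then have "norm (Q k x) \<le> B"
      using e(1)[of k] by (simp add: Q_def norm_mult norm_divide)
    then show ?thesis using True by simp
  next
    case False
    have "norm (e k *\<^sub>R v) \<le> norm v"
      using e[of k] by (simp add: mult_left_le_one_le)
    then have "R < norm (x + e k *\<^sub>R v)"
      using False norm_diff_ineq[of x "e k *\<^sub>R v"] by linarith
    moreover have "R < norm x"
      using False norm_ge_zero[of v] by linarith
    ultimately show ?thesis
      using B0 by (simp add: Q_def supp)
  qed
  have Q_lim: "(\<lambda>k. Q k x) \<longlonglongrightarrow> g' v x" for x
  proof -
    have "((\<lambda>t. (1 / t) *\<^sub>R (g (x + t *\<^sub>R v) - g x)) \<longlongrightarrow> g' v x) (at 0)"
      using has_vector_derivative_quotient[OF line[of x 0]] by simp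
    then have "((\<lambda>k. (1 / e k) *\<^sub>R (g (x + e k *\<^sub>R v) - g x)) \<longlongrightarrow> g' v x) sequentially"
      by (rule filterlim_compose[OF _ e_at])
    then show ?thesis
      by (simp add: Q_def scaleR_conv_of_real)
  qed
  have lim: "(\<lambda>k. \<integral>x. Q k x * wave (- y) x \<partial>lborel) \<longlonglongrightarrow> (\<integral>x. g' v x * wave (- y) x \<partial>lborel)"
  proof (rule integral_dominated_convergence)
    show "integrable lborel (\<lambda>x::'a. B * indicator (cball 0 (R + norm v)) x)"
      by (intro integrable_mult_right integrable_real_indicator)
        (use emeasure_bounded_finite[OF bounded_cball] in auto)
    show "AE x in lborel. (\<lambda>k. Q k x * wave (- y) x) \<longlonglongrightarrow> g' v x * wave (- y) x"
      by (intro AE_I2 tendsto_mult Q_lim tendsto_const)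
    show "AE x in lborel. norm (Q k x * wave (- y) x) \<le> B * indicator (cball 0 (R + norm v)) x" for k
      using Q_le by (intro AE_I2) (simp add: norm_mult)
    show "(\<lambda>x. Q k x * wave (- y) x) \<in> borel_measurable lborel" for k
      unfolding Q_def by measurable
  qed measurable
  \<comment> \<open>Translation multiplies the transform by a wave, so the transform of the quotient
    is \<open>fourier g\<close> times the difference quotient at 0 of t to exp (i c t), where c = 2
    pi (y . v).\<close>
  have Q_eq: "(\<integral>x. Q k x * wave (- y) x \<partial>lborel) =
      ((1 / complex_of_real (e k)) * (cis (e k * (2 * pi * (y \<bullet> v))) - 1)) * fourier g y" for k
  proof -
    have int1: "integrable lborel (\<lambda>x. g (x - - (e k *\<^sub>R v)))"
    proof -
      have "integrable lborel (\<lambda>x. g (e k *\<^sub>R v + 1 *\<^sub>R x))"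
        using integrable_lborel_affine[OF one_neq_zero meas(1)] g_int by blast
      moreover have "(\<lambda>x. g (x - - (e k *\<^sub>R v))) = (\<lambda>x. g (e k *\<^sub>R v + 1 *\<^sub>R x))"
        by (simp add: fun_eq_iff add.commute)
      ultimately show ?thesis by (simp only:)
    qed
    have "(\<integral>x. Q k x * wave (- y) x \<partial>lborel) =
        (\<integral>x. (1 / complex_of_real (e k)) * (g (x - - (e k *\<^sub>R v)) * wave (- y) x - g x * wave (- y) x) \<partial>lborel)"
      by (intro Bochner_Integration.integral_cong refl) (simp add: Q_def algebra_simps)
    also have "\<dots> = (1 / complex_of_real (e k)) * (fourier (\<lambda>x. g (x - - (e k *\<^sub>R v))) y - fourier g y)"
      unfolding fourier_eq_wave integral_mult_right_zero
      by (subst Bochner_Integration.integral_diff) (intro integrable_mult_wave int1 g_int refl)+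
    also have "fourier (\<lambda>x. g (x - - (e k *\<^sub>R v))) y = wave y (e k *\<^sub>R v) * fourier g y"
      by (subst fourier_translate) (simp_all add: wave_minus_left wave_minus_right)
    also have "wave y (e k *\<^sub>R v) = cis (e k * (2 * pi * (y \<bullet> v)))"
      by (simp add: wave_def algebra_simps)
    finally show ?thesis by (simp add: algebra_simps)
  qed
  have "(\<lambda>k. ((1 / complex_of_real (e k)) * (cis (e k * (2 * pi * (y \<bullet> v))) - 1)) * fourier g y)
      \<longlonglongrightarrow> (2 * pi * \<i> * (y \<bullet> v)) * fourier g y"
  proof (rule tendsto_mult[OF _ tendsto_const])
    define c where "c = 2 * pi * (y \<bullet> v)"
    have "((\<lambda>t. (1 / t) *\<^sub>R (cis (t * c) - 1)) \<longlongrightarrow> \<i> * c) (at 0)"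
    proof -
      have "((\<lambda>z. exp (\<i> * c * z)) has_field_derivative \<i> * c) (at (complex_of_real 0))"
        by (auto intro!: derivative_eq_intros)
      then have "((\<lambda>t. exp (\<i> * c * complex_of_real t)) has_vector_derivative \<i> * c) (at 0)"
        by (rule has_vector_derivative_real_field)
      from has_vector_derivative_quotient[OF this] show ?thesis
        by (simp add: cis_conv_exp mult_ac)
    qed
    then have "((\<lambda>k. (1 / e k) *\<^sub>R (cis (e k * c) - 1)) \<longlongrightarrow> \<i> * c) sequentially"
      by (rule filterlim_compose[OF _ e_at])
    then show "(\<lambda>k. (1 / complex_of_real (e k)) * (cis (e k * (2 * pi * (y \<bullet> v))) - 1))
        \<longlonglongrightarrow> 2 * pi * \<i> * (y \<bullet> v)"
      unfolding c_def by (simp add: scaleR_conv_of_real mult_ac)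
  qed
  then show ?thesis
    unfolding fourier_eq_wave[of "g' v"] using lim unfolding Q_eq by (rule LIMSEQ_unique[rotated])
qed

subsection \<open>Smooth bumps\<close>

text \<open>The case k = 0 is the classical flat function exp (-1/t). The powers in the denominator
  are included so that the family is closed, up to linear combinations, under
  differentiation.\<close>

definition bump_profile :: "nat \<Rightarrow> real \<Rightarrow> real" where
  "bump_profile k t = (if 0 < t then exp (- 1 / t) / t ^ k else 0)"

text \<open>With u = 1/t and n = k + 2, raising u/n <= exp (u/n) to the power n gives exp (-u) <=
  n^n t^n. Dividing by t^k leaves t^2, which is what makes the difference quotient at the origin
  vanish.\<close>

lemma bump_profile_le_square:
  "\<bar>bump_profile k t\<bar> \<le> real (k + 2) ^ (k + 2) * t\<^sup>2"
proof (cases "0 < t")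
  case True
  let ?n = "k + 2"
  define u where "u = 1 / t"
  have u: "0 < u" using True by (simp add: u_def)
  have "u / ?n \<le> exp (u / ?n)"
    using exp_ge_add_one_self[of "u / ?n"] by linarith
  then have "(u / ?n) ^ ?n \<le> exp (u / ?n) ^ ?n"
    using u by (intro power_mono) auto
  also have "\<dots> = exp (real ?n * (u / ?n))"
    by (rule exp_of_nat_mult[symmetric])
  also have "\<dots> = exp u"
    by simp
  finally have "inverse (exp u) \<le> inverse ((u / ?n) ^ ?n)"
    using u by (intro le_imp_inverse_le) auto
  then have "exp (- u) \<le> (?n / u) ^ ?n"
    by (simp only: exp_minus power_inverse[symmetric] inverse_divide)
  also have "?n / u = ?n * t"
    by (simp add: u_def)
  finally have "exp (- 1 / t) \<le> real ?n ^ ?n * t ^ ?n"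
    by (simp only: u_def power_mult_distrib minus_divide_left)
  then have "exp (- 1 / t) / t ^ k \<le> real ?n ^ ?n * t\<^sup>2"
    using True by (simp add: divide_le_eq power_add power2_eq_square mult_ac)
  then show ?thesis
    using True by (simp add: bump_profile_def)
qed (simp add: bump_profile_def)

lemma DERIV_bump_profile:
  "(bump_profile k has_real_derivative bump_profile (k + 2) t - real k * bump_profile (k + 1) t) (at t)"
proof (cases t "0::real" rule: linorder_cases)
  case less
  have "((\<lambda>_. 0) has_real_derivative 0) (at t)"
    by simp
  then have "(bump_profile k has_real_derivative 0) (at t)"
    by (rule has_field_derivative_transform_within_open[where S="{..<0}"]) (use less in \<open>auto simp: bump_profile_def\<close>)
  then show ?thesis using less by (simp add: bump_profile_def)
next
  case equal
  have "((\<lambda>h. bump_profile k h / h) \<longlongrightarrow> 0) (at 0)"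
  proof (rule Lim_null_comparison)
    show "\<forall>\<^sub>F h in at 0. norm (bump_profile k h / h) \<le> real (k + 2) ^ (k + 2) * \<bar>h\<bar>"
    proof (rule eventually_mono[OF eventually_neq_at_within[of 0]])
      fix h :: real assume "h \<noteq> 0"
      then show "norm (bump_profile k h / h) \<le> real (k + 2) ^ (k + 2) * \<bar>h\<bar>"
        using bump_profile_le_square[of k h]
        by (simp add: divide_le_eq power2_eq_square abs_mult_self_eq mult.assoc)
    qed
    show "((\<lambda>h. real (k + 2) ^ (k + 2) * \<bar>h\<bar>) \<longlongrightarrow> 0) (at 0)"
      by (auto intro!: tendsto_eq_intros)
  qed
  then show ?thesis
    using equal by (simp add: DERIV_def bump_profile_def)
next
  case greater
  have "((\<lambda>t. exp (- 1 / t) / t ^ k) has_real_derivative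
      (exp (- 1 / t) * (1 / t\<^sup>2)) / t ^ k - exp (- 1 / t) * (k / t ^ (k + 1))) (at t)"
  proof (cases k)
    case 0
    then show ?thesis
      using greater by (auto intro!: derivative_eq_intros simp: power2_eq_square)
  next
    case (Suc m)
    have e: "((\<lambda>t. exp (- 1 / t)) has_real_derivative exp (- 1 / t) * (1 / t\<^sup>2)) (at t)"
      using greater by (auto intro!: derivative_eq_intros simp: power2_eq_square)
    have p: "((\<lambda>t. t ^ k) has_real_derivative real k * t ^ m) (at t)"
      using DERIV_power_Suc[OF DERIV_ident, of m t UNIV] Suc by simp
    show ?thesis
      by (rule DERIV_cong[OF DERIV_divide[OF e p]]) (use greater Suc in \<open>auto simp: field_simps\<close>)
  qed
  then have "(bump_profile k has_real_derivative
      (exp (- 1 / t) * (1 / t\<^sup>2)) / t ^ k - exp (- 1 / t) * (k / t ^ (k + 1))) (at t)"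
    by (rule has_field_derivative_transform_within_open[where S="{0<..}"]) (use greater in \<open>auto simp: bump_profile_def\<close>)
  then show ?thesis
    using greater by (simp add: bump_profile_def power_add power2_eq_square mult_ac)
qed

text \<open>A class closed under directional derivatives: \<open>coord\<close> absorbs the linear
  factors produced by the chain rule. Here a is the centre and 1 / sqrt c the radius of the ball
  outside which every member vanishes, and neither changes under differentiation.\<close>

inductive_set bump_class :: "'a::euclidean_space \<Rightarrow> real \<Rightarrow> ('a \<Rightarrow> complex) set" for a c where
  base: "(\<lambda>x. complex_of_real (bump_profile k (1 - c * ((x - a) \<bullet> (x - a))))) \<in> bump_class a c"
| add: "f \<in> bump_class a c \<Longrightarrow> g \<in> bump_class a c \<Longrightarrow> (\<lambda>x. f x + g x) \<in> bump_class a c"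
| cmult: "f \<in> bump_class a c \<Longrightarrow> (\<lambda>x. z * f x) \<in> bump_class a c"
| coord: "f \<in> bump_class a c \<Longrightarrow> (\<lambda>x. complex_of_real (x \<bullet> v) * f x) \<in> bump_class a c"

lemma bump_class_eq_0:
  "f \<in> bump_class a c \<Longrightarrow> 1 \<le> c * ((x - a) \<bullet> (x - a)) \<Longrightarrow> f x = 0"
  by (induction rule: bump_class.induct) (simp_all add: bump_profile_def)

lemma bump_class_derivative:
  assumes "f \<in> bump_class a c"
  shows "\<exists>f'. (\<forall>x. (f has_derivative (\<lambda>v. f' v x)) (at x)) \<and> (\<forall>v. f' v \<in> bump_class a c)"
  using assms
proof induction
  case (base k)
  let ?q = "\<lambda>x. 1 - c * ((x - a) \<bullet> (x - a))"
  let ?B = "\<lambda>k x. complex_of_real (bump_profile k (?q x))"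
  define D where "D x = ?B (k + 2) x + (- of_nat k) * ?B (k + 1) x" for x
  \<comment> \<open>The chain rule gives the factor -2 c ((x - a) . v). It is split into a multiple
    of x . v and a constant, to match the rules \<open>coord\<close> and
    \<open>cmult\<close>.\<close>
  define f' where "f' v x = complex_of_real (- 2 * c) * (complex_of_real (x \<bullet> v) * D x) +
    complex_of_real (2 * c * (a \<bullet> v)) * D x" for v x
  have D: "D \<in> bump_class a c"
    unfolding D_def[abs_def] by (intro bump_class.intros)
  have "f' v \<in> bump_class a c" for v
    unfolding f'_def[abs_def] using D by (intro bump_class.add bump_class.cmult bump_class.coord)
  moreover have "(?B k has_derivative (\<lambda>v. f' v x)) (at x)" for x
  proof -
    have q: "(?q has_derivative (\<lambda>v. - 2 * c * ((x - a) \<bullet> v))) (at x)"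
      by (auto intro!: derivative_eq_intros simp: inner_commute algebra_simps)
    have "((\<lambda>x. bump_profile k (?q x)) has_derivative
        (\<lambda>v. (- 2 * c * ((x - a) \<bullet> v)) * (bump_profile (k + 2) (?q x) - real k * bump_profile (k + 1) (?q x)))) (at x)"
      using has_derivative_compose[OF q DERIV_bump_profile[unfolded has_field_derivative_def]]
      by (simp add: mult.commute)
    then have "(?B k has_derivative
        (\<lambda>v. complex_of_real ((- 2 * c * ((x - a) \<bullet> v)) * (bump_profile (k + 2) (?q x) - real k * bump_profile (k + 1) (?q x))))) (at x)"
      by (rule has_derivative_of_real)
    moreover have "complex_of_real ((- 2 * c * ((x - a) \<bullet> v)) * (bump_profile (k + 2) (?q x) - real k * bump_profile (k + 1) (?q x)))
        = f' v x" for v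
      unfolding f'_def D_def by (simp add: inner_diff_left algebra_simps)
    ultimately show ?thesis by simp
  qed
  ultimately show ?case by blast
next
  case (add f g)
  then obtain f' g' where "\<forall>x. (f has_derivative (\<lambda>v. f' v x)) (at x)" "\<forall>v. f' v \<in> bump_class a c"
    "\<forall>x. (g has_derivative (\<lambda>v. g' v x)) (at x)" "\<forall>v. g' v \<in> bump_class a c" by blast
  then show ?case
    by (intro exI[of _ "\<lambda>v x. f' v x + g' v x"]) (auto intro!: has_derivative_add bump_class.add)
next
  case (cmult f z)
  then obtain f' where "\<forall>x. (f has_derivative (\<lambda>v. f' v x)) (at x)" "\<forall>v. f' v \<in> bump_class a c" by blast
  then show ?case
    by (intro exI[of _ "\<lambda>v x. z * f' v x"]) (auto intro!: has_derivative_mult_right bump_class.cmult)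
next
  case (coord f w)
  then obtain f' where f': "\<forall>x. (f has_derivative (\<lambda>v. f' v x)) (at x)" "\<forall>v. f' v \<in> bump_class a c" by blast
  have "((\<lambda>x. complex_of_real (x \<bullet> w) * f x) has_derivative
      (\<lambda>v. complex_of_real (x \<bullet> w) * f' v x + complex_of_real (v \<bullet> w) * f x)) (at x)" for x
    using f'(1) by (intro has_derivative_mult has_derivative_of_real has_derivative_inner_left has_derivative_ident) blast
  moreover have "(\<lambda>x. complex_of_real (x \<bullet> w) * f' v x + complex_of_real (v \<bullet> w) * f x) \<in> bump_class a c" for v
    using f'(2) coord by (intro bump_class.intros) auto
  ultimately show ?case
    by (intro exI[of _ "\<lambda>v x. complex_of_real (x \<bullet> w) * f' v x + complex_of_real (v \<bullet> w) * f x"]) auto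
qed

text \<open>By induction on the list, all iterated partials stay in S, and every member of S is
  differentiable.\<close>

lemma smooth_if_closed_under_derivative:
  assumes closed: "\<And>f. f \<in> S \<Longrightarrow> \<exists>f'. (\<forall>x. (f has_derivative (\<lambda>v. f' v x)) (at x)) \<and> (\<forall>v. f' v \<in> S)"
    and "f \<in> S"
  shows "smooth f"
proof -
  have mem: "iter_partial vs f \<in> S" for vs
  proof (induction vs)
    case Nil
    then show ?case using \<open>f \<in> S\<close> by simp
  next
    case (Cons v vs)
    obtain f' where f': "\<forall>x. (iter_partial vs f has_derivative (\<lambda>v. f' v x)) (at x)" "\<forall>v. f' v \<in> S"
      using closed[OF Cons] by blast
    have "frechet_derivative (iter_partial vs f) (at x) v = f' v x" for x
      using frechet_derivative_at[of "iter_partial vs f" "\<lambda>v. f' v x" x] f'(1) by metis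
    then have "iter_partial (v # vs) f = f' v" by auto
    then show ?case using f'(2) by simp
  qed
  have "iter_partial vs f differentiable_on UNIV" for vs
    using closed[OF mem[of vs]] unfolding differentiable_on_def differentiable_def by auto
  then show ?thesis by (simp add: smooth_def)
qed

text \<open>Bumps with different centres lie in different classes, so the set closed under
  derivatives is that of the sums with one summand from each class.\<close>

lemma smooth_sum_bump_class:
  fixes F :: "nat \<Rightarrow> 'a::euclidean_space \<Rightarrow> complex"
  assumes "\<And>j. j < N \<Longrightarrow> F j \<in> bump_class (a j) c"
  shows "smooth (\<lambda>x. \<Sum>j<N. F j x)"
proof (rule smooth_if_closed_under_derivative)
  let ?S = "{(\<lambda>x. \<Sum>j<N. F j x) |F. \<forall>j<N. F j \<in> bump_class (a j) c}"
  show "(\<lambda>x. \<Sum>j<N. F j x) \<in> ?S" using assms by blast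
  fix f assume "f \<in> ?S"
  then obtain F where f: "f = (\<lambda>x. \<Sum>j<N. F j x)" and F: "\<And>j. j < N \<Longrightarrow> F j \<in> bump_class (a j) c"
    by blast
  obtain F' where F': "\<And>j x. j < N \<Longrightarrow> (F j has_derivative (\<lambda>v. F' j v x)) (at x)"
    "\<And>j v. j < N \<Longrightarrow> F' j v \<in> bump_class (a j) c"
    using bump_class_derivative[OF F] by metis
  show "\<exists>f'. (\<forall>x. (f has_derivative (\<lambda>v. f' v x)) (at x)) \<and> (\<forall>v. f' v \<in> ?S)"
  proof (intro exI[of _ "\<lambda>v x. \<Sum>j<N. F' j v x"] conjI allI)
    show "(f has_derivative (\<lambda>v. \<Sum>j<N. F' j v x)) (at x)" for x
      unfolding f by (intro has_derivative_sum F') auto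
    show "(\<lambda>x. \<Sum>j<N. F' j v x) \<in> ?S" for v
      using F'(2) by (intro CollectI exI[of _ "\<lambda>j. F' j v"]) auto
  qed
qed

lemma bump_class_eq_0_outside:
  assumes "f \<in> bump_class a c" "0 < c" "norm a + 1 / sqrt c < norm x"
  shows "f x = 0"
proof (rule bump_class_eq_0[OF assms(1)])
  have "1 / sqrt c \<le> norm (x - a)"
    using assms(3) norm_triangle_ineq2[of x a] by linarith
  then have "(1 / sqrt c)\<^sup>2 \<le> (norm (x - a))\<^sup>2"
    using assms(2) by (intro power_mono) auto
  then show "1 \<le> c * ((x - a) \<bullet> (x - a))"
    using assms(2) by (simp add: power2_norm_eq_inner power_divide field_simps)
qed

lemma continuous_on_bump_class:
  assumes "f \<in> bump_class a c"
  shows "continuous_on UNIV f"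
proof -
  obtain f' where "\<And>x. (f has_derivative (\<lambda>v. f' v x)) (at x)"
    using bump_class_derivative[OF assms] by blast
  then show ?thesis
    by (rule has_derivative_continuous_on)
qed

lemma nice_bump_class:
  assumes "f \<in> bump_class a c" "0 < c"
  shows "nice f"
proof -
  obtain B where "0 \<le> B" and B: "\<And>x. norm (f x) \<le> B * indicator (cball 0 (norm a + 1 / sqrt c)) x"
    and "integrable lborel f"
    using integrable_bounded_support[OF continuous_on_bump_class[OF assms(1)],
      of "norm a + 1 / sqrt c", OF bump_class_eq_0_outside[OF assms]] by metis
  have "norm (f x) \<le> B" for x
    using B[of x] \<open>0 \<le> B\<close> by (cases "x \<in> cball 0 (norm a + 1 / sqrt c)") auto
  with \<open>integrable lborel f\<close> show ?thesis
    using continuous_on_bump_class[OF assms(1)] unfolding nice_def by auto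
qed

abbreviation multiplier :: "'a::euclidean_space \<Rightarrow> 'a \<Rightarrow> complex" where
  "multiplier y v \<equiv> 1 + 2 * pi * \<i> * (y \<bullet> v)"

text \<open>Multiplying a transform by \<open>1 + 2 * pi * \<i> * (y \<bullet> v)\<close> amounts to applying \<open>1 + \<partial>\<^sub>v\<close>,
  which stays inside the class.\<close>

lemma bump_class_fourier_multiplier:
  fixes f :: "'a::euclidean_space \<Rightarrow> complex"
  assumes f: "f \<in> bump_class a c" and c: "0 < c"
  shows "\<exists>g\<in>bump_class a c. \<forall>y. fourier g y = (\<Prod>v\<leftarrow>vs. multiplier y v) * fourier f y"
proof (induction vs)
  case Nil
  show ?case by (rule bexI[OF _ f]) simp
next
  case (Cons v vs)
  then obtain g where g: "g \<in> bump_class a c"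
    and eq: "\<And>y. fourier g y = (\<Prod>v\<leftarrow>vs. multiplier y v) * fourier f y" by blast
  obtain g' where g': "\<And>x. (g has_derivative (\<lambda>v. g' v x)) (at x)" "\<And>v. g' v \<in> bump_class a c"
    using bump_class_derivative[OF g] by blast
  have int: "integrable lborel g" "integrable lborel (g' v)"
    using nice_bump_class[OF g c] nice_bump_class[OF g'(2) c] by (auto simp: nice_def)
  have "\<forall>y. fourier (\<lambda>x. 1 * g x + 1 * g' v x) y = (\<Prod>v\<leftarrow>v # vs. multiplier y v) * fourier f y"
  proof
    fix y
    have "fourier (g' v) y = 2 * pi * \<i> * (y \<bullet> v) * fourier g y"
    proof (rule fourier_directional_derivative[where R="norm a + 1 / sqrt c", OF g'(1)])
      show "continuous_on UNIV (g' v)"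
        by (rule continuous_on_bump_class[OF g'(2)])
      show "g x = 0" "g' v x = 0" if "norm a + 1 / sqrt c < norm x" for x
        using bump_class_eq_0_outside[OF g c that] bump_class_eq_0_outside[OF g'(2) c that] by auto
    qed
    then show "fourier (\<lambda>x. 1 * g x + 1 * g' v x) y = (\<Prod>v\<leftarrow>v # vs. multiplier y v) * fourier f y"
      unfolding fourier_lincomb[OF int] by (simp add: eq distrib_right mult.assoc)
  qed
  moreover have "(\<lambda>x. 1 * g x + 1 * g' v x) \<in> bump_class a c"
    by (intro bump_class.add bump_class.cmult g g'(2))
  ultimately show ?case by (rule bexI)
qed

text \<open>Applying 1 + the derivative once in each coordinate direction multiplies the transform
  by a factor of modulus at least \<open>1 / sqrt (decay_weight y)\<close>. One derivative per
  coordinate suffices because the square root of the weight is square-integrable, as Cauchy-Schwarz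
  will require; g keeps the support bound of f.\<close>

lemma bump_class_fourier_decay:
  fixes f :: "'a::euclidean_space \<Rightarrow> complex"
  assumes f: "f \<in> bump_class a c" and c: "0 < c"
  obtains g where "g \<in> bump_class a c" "\<And>y. norm (fourier f y) \<le> sqrt (decay_weight y) * norm (fourier g y)"
proof -
  obtain vs :: "'a list" where vs: "set vs = Basis" "distinct vs"
    using finite_distinct_list[OF finite_Basis] by blast
  obtain g where g: "g \<in> bump_class a c"
    and eq: "\<And>y. fourier g y = (\<Prod>v\<leftarrow>vs. multiplier y v) * fourier f y"
    using bump_class_fourier_multiplier[OF f c, of vs] by blast
  have le: "norm (fourier f y) \<le> sqrt (decay_weight y) * norm (fourier g y)" for y
  proof -
    have "(\<Prod>v\<leftarrow>vs. multiplier y v) = (\<Prod>v\<in>Basis. multiplier y v)"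
      unfolding vs(1)[symmetric] using vs(2) by (rule prod.distinct_set_conv_list[symmetric])
    then have "norm (\<Prod>v\<leftarrow>vs. multiplier y v) = (\<Prod>v\<in>Basis. norm (multiplier y v))"
      by (simp only: prod_norm)
    moreover have "(\<Prod>v\<in>Basis. sqrt (1 + (y \<bullet> v)\<^sup>2)) \<le> (\<Prod>v\<in>Basis. norm (multiplier y v))"
    proof (intro prod_mono conjI)
      fix v :: 'a
      have "1 * \<bar>y \<bullet> v\<bar> \<le> (2 * pi) * \<bar>y \<bullet> v\<bar>"
        using pi_gt3 by (intro mult_right_mono) auto
      then have "\<bar>y \<bullet> v\<bar> \<le> \<bar>2 * pi * (y \<bullet> v)\<bar>"
        by (simp add: abs_mult)
      then have "(y \<bullet> v)\<^sup>2 \<le> (2 * pi * (y \<bullet> v))\<^sup>2"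
        by (simp only: abs_le_square_iff)
      moreover have "norm (multiplier y v) = sqrt (1 + (2 * pi * (y \<bullet> v))\<^sup>2)"
        by (simp add: cmod_def)
      ultimately show "sqrt (1 + (y \<bullet> v)\<^sup>2) \<le> norm (multiplier y v)"
        by simp
    qed simp
    ultimately have le: "(\<Prod>v\<in>Basis. sqrt (1 + (y \<bullet> v)\<^sup>2)) \<le> norm (\<Prod>v\<leftarrow>vs. multiplier y v)"
      by (simp only:)
    have "(\<Prod>v\<in>Basis. sqrt (1 + (y \<bullet> v)\<^sup>2))\<^sup>2 = (\<Prod>v\<in>Basis. 1 + (y \<bullet> v)\<^sup>2)"
      unfolding prod_power_distrib by (intro prod.cong refl) (simp add: add_nonneg_nonneg)
    also have "\<dots> = inverse (decay_weight y)"
      unfolding decay_weight_def by (simp add: prod_inversef[symmetric])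
    finally have "sqrt (inverse (decay_weight y)) = (\<Prod>v\<in>Basis. sqrt (1 + (y \<bullet> v)\<^sup>2))"
      by (intro real_sqrt_unique prod_nonneg) auto
    then have "sqrt (decay_weight y) * (\<Prod>v\<in>Basis. sqrt (1 + (y \<bullet> v)\<^sup>2)) = sqrt (decay_weight y * inverse (decay_weight y))"
      by (simp only: real_sqrt_mult)
    also have "\<dots> = 1"
      using decay_weight_pos[of y] by simp
    finally have "1 \<le> sqrt (decay_weight y) * norm (\<Prod>v\<leftarrow>vs. multiplier y v)"
      using mult_left_mono[OF le, of "sqrt (decay_weight y)"] decay_weight_pos[of y] by (simp only: real_sqrt_ge_0_iff less_imp_le)
    from mult_right_mono[OF this norm_ge_zero, of "fourier f y"] show ?thesis
      by (simp only: eq norm_mult mult.assoc mult_1_left)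
  qed
  show ?thesis using that[OF g le] .
qed

subsection \<open>Sums of many disjoint bumps\<close>

definition bump :: "'a::euclidean_space \<Rightarrow> complex" where
  "bump x = complex_of_real (bump_profile 0 (1 - x \<bullet> x))"

lemma bump_0: "bump 0 \<noteq> 0"
  by (simp add: bump_def bump_profile_def)

lemma bump_eq_0: "1 \<le> norm x \<Longrightarrow> bump x = 0"
  using power_mono[of 1 "norm x" 2] by (simp add: bump_def bump_profile_def power2_norm_eq_inner)

lemma bump_in_bump_class: "bump \<in> bump_class 0 1"
  using bump_class.base[of 0 1 0] by (simp add: bump_def[abs_def])

lemma bump_affine_in_bump_class:
  assumes "r \<noteq> 0"
  shows "(\<lambda>x. bump ((1 / r) *\<^sub>R (x - p))) \<in> bump_class p (1 / r\<^sup>2)"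
proof -
  have "bump ((1 / r) *\<^sub>R (x - p)) = complex_of_real (bump_profile 0 (1 - 1 / r\<^sup>2 * ((x - p) \<bullet> (x - p))))" for x
    by (simp add: bump_def power2_eq_square)
  then show ?thesis
    by (simp only: bump_class.base)
qed

lemma fourier_sum:
  assumes "\<And>j. j \<in> J \<Longrightarrow> integrable lborel (f j)"
  shows "fourier (\<lambda>x. \<Sum>j\<in>J. f j x) y = (\<Sum>j\<in>J. fourier (f j) y)"
  unfolding fourier_eq_wave sum_distrib_right
  by (rule Bochner_Integration.integral_sum) (intro integrable_mult_wave assms)

lemma integrable_lborel_translate:
  fixes f :: "'a::euclidean_space \<Rightarrow> 'b::{banach,second_countable_topology}"
  assumes "integrable lborel f"
  shows "integrable lborel (\<lambda>x. f (x - w))"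
proof -
  have "f \<in> borel_measurable borel"
    using borel_measurable_integrable[OF assms] by simp
  then have "integrable lborel (\<lambda>x. f (- w + 1 *\<^sub>R x))"
    using integrable_lborel_affine[OF one_neq_zero] assms by blast
  then show ?thesis by simp
qed

lemma integral_lborel_translate:
  fixes f :: "'a::euclidean_space \<Rightarrow> 'b::{banach,second_countable_topology}"
  assumes "f \<in> borel_measurable borel"
  shows "(\<integral>x. f (x - w) \<partial>lborel) = (\<integral>x. f x \<partial>lborel)"
  using integral_lborel_affine[OF one_neq_zero assms, of "- w"] by simp

text \<open>The bound is of order \<open>sqrt N\<close>, not \<open>N\<close>, because the \<open>L2\<close> norms of disjointly supported functions
  add in squares.\<close>

lemma integral_norm_fourier_bumps_le:
  obtains C where "0 \<le> C"
    "\<And>N (w :: nat \<Rightarrow> 'a::euclidean_space).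
      (\<And>i j x. i < N \<Longrightarrow> j < N \<Longrightarrow> i \<noteq> j \<Longrightarrow> norm (x - w i) < 1 \<Longrightarrow> 1 \<le> norm (x - w j)) \<Longrightarrow>
      integrable lborel (fourier (\<lambda>x. \<Sum>j<N. bump (x - w j))) \<and>
      (\<integral>y. norm (fourier (\<lambda>x. \<Sum>j<N. bump (x - w j)) y) \<partial>lborel) \<le> C * sqrt (real N)"
proof -
  obtain g :: "'a \<Rightarrow> complex" where g: "g \<in> bump_class 0 1"
    and decay: "\<And>y. norm (fourier bump y) \<le> sqrt (decay_weight y) * norm (fourier g y)"
    using bump_class_fourier_decay[OF bump_in_bump_class zero_less_one] by metis
  have nice_g: "nice g" and nice_b: "nice (bump :: 'a \<Rightarrow> complex)"
    using nice_bump_class[OF g] nice_bump_class[OF bump_in_bump_class] by auto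
  have int_g: "integrable lborel g" and int_b: "integrable lborel (bump :: 'a \<Rightarrow> complex)"
    using nice_g nice_b by (auto simp: nice_def)
  have gm[measurable]: "g \<in> borel_measurable borel"
    and bm[measurable]: "(bump :: 'a \<Rightarrow> complex) \<in> borel_measurable borel"
    using nice_measurable[OF nice_g] nice_measurable[OF nice_b] by auto
  have g_0: "g x = 0" if "1 \<le> norm x" for x
    using bump_class_eq_0[OF g, of x] power_mono[OF that, of 2] by (simp add: power2_norm_eq_inner)
  define q where "q y = complex_of_real (sqrt (decay_weight y))" for y :: 'a
  have q: "q \<in> L2"
    unfolding L2_iff
  proof
    show "q \<in> borel_measurable borel" unfolding q_def[abs_def] by measurable
    show "integrable lborel (\<lambda>y. (norm (q y))\<^sup>2)"
      using integrable_decay_weight by (simp add: q_def less_imp_le[OF decay_weight_pos])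
  qed
  show ?thesis
  \<comment> \<open>Cauchy-Schwarz constant: q is the square root of the weight, and g depends only
    on the unit bump, not on N or the centres.\<close>
  proof (rule that[of "L2_norm q * L2_norm g"])
    show "0 \<le> L2_norm q * L2_norm g" by (simp add: L2_norm_nonneg)
    fix N and w :: "nat \<Rightarrow> 'a"
    assume disj: "\<And>i j x. i < N \<Longrightarrow> j < N \<Longrightarrow> i \<noteq> j \<Longrightarrow> norm (x - w i) < 1 \<Longrightarrow> 1 \<le> norm (x - w j)"
    define H where "H x = (\<Sum>j<N. g (x - w j))" for x
    define F where "F = fourier (\<lambda>x. \<Sum>j<N. bump (x - w j))"
    have Hm[measurable]: "H \<in> borel_measurable borel"
      unfolding H_def[abs_def] by measurable
    have int_H: "integrable lborel H"
      unfolding H_def[abs_def] by (intro Bochner_Integration.integrable_sum integrable_lborel_translate int_g)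
    have int_g2: "integrable lborel (\<lambda>x. (norm (g x))\<^sup>2)"
      using nice_L2[OF nice_g] by (simp add: L2_iff)
    \<comment> \<open>At every point at most one translate of g is non-zero, so the square of the
      sum is the sum of the squares.\<close>
    have sq: "(norm (H x))\<^sup>2 = (\<Sum>j<N. (norm (g (x - w j)))\<^sup>2)" for x
    proof (cases "\<exists>i<N. norm (x - w i) < 1")
      case True
      then obtain i where i: "i < N" "norm (x - w i) < 1" by blast
      have zero: "g (x - w j) = 0" if "j \<in> {..<N} - {i}" for j
        using g_0 disj[OF i(1) _ _ i(2), of j] that by auto
      have "H x = g (x - w i)"
        unfolding H_def using i(1) zero by (subst sum.remove[of _ i]) auto
      moreover have "(\<Sum>j<N. (norm (g (x - w j)))\<^sup>2) = (norm (g (x - w i)))\<^sup>2"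
        using i(1) zero by (subst sum.remove[of _ i]) auto
      ultimately show ?thesis by simp
    next
      case False
      then have "g (x - w j) = 0" if "j < N" for j
      proof -
        have "\<not> norm (x - w j) < 1" using False that by blast
        then show ?thesis by (intro g_0) linarith
      qed
      then show ?thesis by (simp add: H_def)
    qed
    have H_L2: "H \<in> L2"
      unfolding L2_iff sq by (intro conjI Hm Bochner_Integration.integrable_sum
          integrable_lborel_translate[where f="\<lambda>x. (norm (g x))\<^sup>2"] int_g2)
    have "(\<integral>x. (norm (H x))\<^sup>2 \<partial>lborel) = (\<Sum>j<N. \<integral>x. (norm (g (x - w j)))\<^sup>2 \<partial>lborel)"
      unfolding sq by (intro Bochner_Integration.integral_sum integrable_lborel_translate[where f="\<lambda>x. (norm (g x))\<^sup>2"] int_g2)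
    also have "\<dots> = real N * (L2_norm g)\<^sup>2"
      using integral_lborel_translate[of "\<lambda>x. (norm (g x))\<^sup>2"] by (simp add: L2_norm_power2)
    finally have "L2_norm H = sqrt (real N) * L2_norm g"
      using L2_norm_nonneg[of g] by (simp add: L2_norm_def[of H] real_sqrt_mult)
    then have norm_FH: "L2_norm (fourier H) = sqrt (real N) * L2_norm g"
      by (simp only: plancherel[OF H_L2 int_H])
    have FH_L2: "fourier H \<in> L2"
      by (rule fourier_in_L2[OF H_L2 int_H])
    \<comment> \<open>Translating by the same centres multiplies both transforms by the same
      exponential sum S. The pointwise bound for one bump therefore passes to the whole sum, with no
      estimate of S.\<close>
    have le: "norm (F y) \<le> norm (q y) * norm (fourier H y)" for y
    proof -
      define S where "S = (\<Sum>j<N. wave (- y) (w j))"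
      have 1: "fourier H y = S * fourier g y"
        unfolding H_def[abs_def] S_def
        by (subst fourier_sum) (simp_all add: integrable_lborel_translate int_g fourier_translate gm sum_distrib_right)
      have 2: "F y = S * fourier bump y"
        unfolding F_def S_def
        by (subst fourier_sum) (simp_all add: integrable_lborel_translate int_b fourier_translate bm sum_distrib_right)
      have "norm (F y) \<le> norm S * (sqrt (decay_weight y) * norm (fourier g y))"
        unfolding 2 norm_mult by (intro mult_left_mono decay) simp
      then show ?thesis
        unfolding 1 norm_mult q_def using decay_weight_pos[of y] by (simp add: mult_ac)
    qed
    have Fm: "F \<in> borel_measurable borel"
      unfolding F_def by measurable
    have int_qH: "integrable lborel (\<lambda>y. norm (q y) * norm (fourier H y))"
      using integrable_norm[OF integrable_mult_L2[OF q FH_L2]] by (simp add: norm_mult)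
    have int_F: "integrable lborel F"
    proof (rule Bochner_Integration.integrable_bound[OF int_qH])
      show "AE y in lborel. norm (F y) \<le> norm (norm (q y) * norm (fourier H y))"
        using le by (intro AE_I2) simp
    qed (use Fm in simp)
    have "(\<integral>y. norm (F y) \<partial>lborel) \<le> (\<integral>y. norm (q y) * norm (fourier H y) \<partial>lborel)"
      by (rule integral_mono[OF integrable_norm[OF int_F] int_qH le])
    also have "\<dots> \<le> L2_norm q * L2_norm (fourier H)"
      by (rule Cauchy_Schwarz_L2[OF q FH_L2])
    also have "\<dots> = L2_norm q * L2_norm g * sqrt (real N)"
      by (simp add: norm_FH)
    finally show "integrable lborel F \<and> (\<integral>y. norm (F y) \<partial>lborel) \<le> L2_norm q * L2_norm g * sqrt (real N)"
      using int_F by blast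
  qed
qed

abbreviation bump_sum :: "real \<Rightarrow> nat \<Rightarrow> (nat \<Rightarrow> 'a::euclidean_space) \<Rightarrow> 'a \<Rightarrow> complex" where
  "bump_sum r N p \<equiv> (\<lambda>x. \<Sum>j<N. bump ((1 / r) *\<^sub>R (x - p j)))"

text \<open>Rescaling by 1/r gives unit bumps centred at p j / r, still disjoint. Since the L1 norm
  of a transform is invariant under dilation, the constant is the same for all r.\<close>

lemma integral_norm_fourier_scaled_bumps_le:
  obtains C where "0 \<le> C"
    "\<And>N r (p :: nat \<Rightarrow> 'a::euclidean_space). 0 < r \<Longrightarrow>
      (\<And>i j x. i < N \<Longrightarrow> j < N \<Longrightarrow> i \<noteq> j \<Longrightarrow> norm (x - p i) < r \<Longrightarrow> r \<le> norm (x - p j)) \<Longrightarrow>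
      integrable lborel (fourier (bump_sum r N p)) \<and>
      (\<integral>y. norm (fourier (bump_sum r N p) y) \<partial>lborel) \<le> C * sqrt (real N)"
proof -
  obtain C where C: "0 \<le> C" and bound: "\<And>N (w :: nat \<Rightarrow> 'a).
      (\<And>i j x. i < N \<Longrightarrow> j < N \<Longrightarrow> i \<noteq> j \<Longrightarrow> norm (x - w i) < 1 \<Longrightarrow> 1 \<le> norm (x - w j)) \<Longrightarrow>
      integrable lborel (fourier (\<lambda>x. \<Sum>j<N. bump (x - w j))) \<and>
      (\<integral>y. norm (fourier (\<lambda>x. \<Sum>j<N. bump (x - w j)) y) \<partial>lborel) \<le> C * sqrt (real N)"
    by (rule integral_norm_fourier_bumps_le) blast
  show ?thesis
  proof (rule that[OF C])
    fix N and r :: real and p :: "nat \<Rightarrow> 'a"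
    assume r: "0 < r"
      and disj: "\<And>i j x. i < N \<Longrightarrow> j < N \<Longrightarrow> i \<noteq> j \<Longrightarrow> norm (x - p i) < r \<Longrightarrow> r \<le> norm (x - p j)"
    define w where "w j = (1 / r) *\<^sub>R p j" for j
    have norm_w: "norm (x - w j) = norm (r *\<^sub>R x - p j) / r" for x j
    proof -
      have "x - w j = (1 / r) *\<^sub>R (r *\<^sub>R x - p j)"
        using r by (simp add: w_def scaleR_diff_right)
      then show ?thesis using r by simp
    qed
    define G where "G x = (\<Sum>j<N. bump (x - w j))" for x :: 'a
    have eq: "(bump_sum r N p) = (\<lambda>x. G ((1 / r) *\<^sub>R x))"
      by (simp add: G_def w_def scaleR_diff_right)
    have [measurable]: "(bump :: 'a \<Rightarrow> complex) \<in> borel_measurable borel"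
      using nice_measurable[OF nice_bump_class[OF bump_in_bump_class zero_less_one]] .
    have Gm: "G \<in> borel_measurable borel"
      unfolding G_def[abs_def] by measurable
    have "1 \<le> norm (x - w j)" if "i < N" "j < N" "i \<noteq> j" "norm (x - w i) < 1" for i j x
      using disj[OF that(1-3), of "r *\<^sub>R x"] that(4) r unfolding norm_w by (simp add: divide_less_eq le_divide_eq)
    then have "integrable lborel (fourier G) \<and> (\<integral>y. norm (fourier G y) \<partial>lborel) \<le> C * sqrt (real N)"
      using bound[of N w] unfolding G_def[abs_def] by blast
    then show "integrable lborel (fourier (bump_sum r N p)) \<and>
        (\<integral>y. norm (fourier (bump_sum r N p) y) \<partial>lborel) \<le> C * sqrt (real N)"
      unfolding eq integrable_fourier_dilate[OF Gm r] integral_norm_fourier_dilate[OF Gm r] .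
  qed
qed

subsection \<open>A tempered distribution built from differences of point masses\<close>

abbreviation moment :: "('a::euclidean_space \<Rightarrow> complex) \<Rightarrow> real" where
  "moment F \<equiv> (\<integral>x. norm x * norm (F x) \<partial>lborel)"

lemma schwartz_seminorm_upper:
  assumes "F \<in> schwartz" "set vs \<subseteq> Basis"
  shows "norm x ^ k * norm (iter_partial vs F x) \<le> schwartz_seminorm k vs F"
  unfolding schwartz_seminorm_def
  by (rule cSUP_upper) (use assms in \<open>auto simp: schwartz_def\<close>)

lemma schwartz_seminorm_nonneg:
  assumes "F \<in> schwartz" "set vs \<subseteq> Basis"
  shows "0 \<le> schwartz_seminorm k vs F"
  using schwartz_seminorm_upper[OF assms, of 0 k] by (rule order_trans[rotated]) simp

lemma schwartz_measurable:
  assumes "F \<in> schwartz"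
  shows "F \<in> borel_measurable borel"
proof -
  have "iter_partial [] F differentiable_on UNIV"
    using assms unfolding schwartz_def smooth_def by (auto dest: spec[of _ "[]"])
  then show ?thesis
    by (intro borel_measurable_continuous_onI differentiable_imp_continuous_on) simp
qed

text \<open>In the factor 1 + |x|, the 1 yields integrability of F and the |x| yields its first
  moment; the integrable weight on the right serves both.\<close>

lemma schwartz_moment_le:
  fixes F :: "'a::euclidean_space \<Rightarrow> complex"
  assumes F: "F \<in> schwartz"
  shows "(1 + norm x) * norm (F x) \<le> decay_weight x * (2 ^ (DIM('a) + 1) *
    (schwartz_seminorm 0 [] F + schwartz_seminorm (2 * DIM('a) + 1) [] F))"
proof -
  let ?n = "2 * DIM('a) + 1" and ?A = "2 ^ (DIM('a) + 1) :: real"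
  have w: "0 < decay_weight x" by (rule decay_weight_pos)
  have "(1 + norm x) * inverse (decay_weight x) * norm (F x) \<le> ?A * (1 + norm x ^ ?n) * norm (F x)"
    by (intro mult_right_mono polynomial_le_inverse_decay_weight) simp
  also have "\<dots> = ?A * (norm x ^ 0 * norm (iter_partial [] F x) + norm x ^ ?n * norm (iter_partial [] F x))"
    by (simp add: algebra_simps)
  also have "\<dots> \<le> ?A * (schwartz_seminorm 0 [] F + schwartz_seminorm ?n [] F)"
    by (intro mult_left_mono add_mono schwartz_seminorm_upper[OF F]) auto
  finally have "decay_weight x * ((1 + norm x) * inverse (decay_weight x) * norm (F x)) \<le>
      decay_weight x * (?A * (schwartz_seminorm 0 [] F + schwartz_seminorm ?n [] F))"
    using w by (intro mult_left_mono) auto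
  moreover have "decay_weight x * ((1 + norm x) * inverse (decay_weight x) * norm (F x)) = (1 + norm x) * norm (F x)"
    using w by simp
  ultimately show ?thesis
    by (simp only:)
qed

lemma
  fixes F :: "'a::euclidean_space \<Rightarrow> complex"
  assumes F: "F \<in> schwartz"
  shows integrable_schwartz: "integrable lborel F"
    and integrable_schwartz_moment: "integrable lborel (\<lambda>x. norm x * norm (F x))"
    and integral_schwartz_moment_le: "moment F \<le>
      (\<integral>x. decay_weight (x::'a) \<partial>lborel) * (2 ^ (DIM('a) + 1) *
        (schwartz_seminorm 0 [] F + schwartz_seminorm (2 * DIM('a) + 1) [] F))"
proof -
  define A where "A = 2 ^ (DIM('a) + 1) * (schwartz_seminorm 0 [] F + schwartz_seminorm (2 * DIM('a) + 1) [] F)"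
  have le: "(1 + norm x) * norm (F x) \<le> decay_weight x * A" for x
    unfolding A_def by (rule schwartz_moment_le[OF F])
  have le1: "norm (F x) \<le> decay_weight x * A" for x
    using le[of x] mult_right_mono[of 1 "1 + norm x" "norm (F x)"] by simp
  have le2: "norm x * norm (F x) \<le> decay_weight x * A" for x
    using le[of x] mult_right_mono[of "norm x" "1 + norm x" "norm (F x)"] by simp
  have Fm[measurable]: "F \<in> borel_measurable borel"
    by (rule schwartz_measurable[OF F])
  have int: "integrable lborel (\<lambda>x::'a. decay_weight x * A)"
    by (simp add: integrable_decay_weight)
  show "integrable lborel F"
  proof (rule Bochner_Integration.integrable_bound[OF int])
    show "AE x in lborel. norm (F x) \<le> norm (decay_weight x * A)"
      using order_trans[OF le1 abs_ge_self] by (intro AE_I2) simp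
  qed simp
  show int2: "integrable lborel (\<lambda>x. norm x * norm (F x))"
  proof (rule Bochner_Integration.integrable_bound[OF int])
    show "AE x in lborel. norm (norm x * norm (F x)) \<le> norm (decay_weight x * A)"
      using order_trans[OF le2 abs_ge_self] by (intro AE_I2) simp
  qed simp
  have "moment F \<le> (\<integral>x. decay_weight (x::'a) * A \<partial>lborel)"
    by (rule integral_mono[OF int2 int le2])
  then show "moment F \<le> (\<integral>x. decay_weight (x::'a) \<partial>lborel) * A"
    by simp
qed

text \<open>As a functional before the Fourier transform, a point mass of the transformed symbol
  becomes evaluation of the inverse transform. Using \<open>fourier_inverse\<close> lets it be
  computed on \<open>fourier g\<close> for every nice g.\<close>

definition dipole_sum :: "(nat \<Rightarrow> 'a::euclidean_space) \<Rightarrow> (nat \<Rightarrow> 'a) \<Rightarrow> ('a \<Rightarrow> complex) \<Rightarrow> complex" where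
  "dipole_sum a b F = (\<Sum>j. fourier_inverse F (a j) - fourier_inverse F (b j))"

text \<open>Two waves differ at y by at most 2 pi |a - b| |y|. A dipole thus costs its length times
  the first moment of F, which is what makes a series of short dipoles converge.\<close>

lemma norm_fourier_inverse_diff_le:
  assumes F: "F \<in> schwartz"
  shows "norm (fourier_inverse F a - fourier_inverse F b) \<le> 2 * pi * norm (a - b) * moment F"
proof -
  have int: "integrable lborel F" by (rule integrable_schwartz[OF F])
  have "fourier_inverse F a - fourier_inverse F b = (\<integral>y. F y * wave a y - F y * wave b y \<partial>lborel)"
    unfolding fourier_inverse_eq_integral[OF int]
    by (rule Bochner_Integration.integral_diff[symmetric]) (rule integrable_mult_wave[OF int])+
  also have "norm \<dots> \<le> (\<integral>y. 2 * pi * norm (a - b) * (norm y * norm (F y)) \<partial>lborel)"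
  proof (rule Bochner_Integration.integral_norm_bound_integral)
    show "integrable lborel (\<lambda>y. F y * wave a y - F y * wave b y)"
      by (intro Bochner_Integration.integrable_diff integrable_mult_wave int)
    show "integrable lborel (\<lambda>y. 2 * pi * norm (a - b) * (norm y * norm (F y)))"
      by (intro integrable_mult_right integrable_schwartz_moment F)
    show "norm (F y * wave a y - F y * wave b y) \<le> 2 * pi * norm (a - b) * (norm y * norm (F y))" for y
    proof -
      have "norm (F y * wave a y - F y * wave b y) = norm (F y) * norm (wave a y - wave b y)"
        by (simp add: right_diff_distrib[symmetric] norm_mult)
      also have "\<dots> \<le> norm (F y) * (2 * pi * norm (a - b) * norm y)"
        by (intro mult_left_mono norm_wave_diff_le) simp
      finally show ?thesis by (simp add: mult_ac)
    qed
  qed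
  also have "\<dots> = 2 * pi * norm (a - b) * moment F"
    by (rule integral_mult_right_zero)
  finally show ?thesis .
qed

lemma fourier_inverse_lincomb:
  assumes F: "integrable lborel F" and G: "integrable lborel G"
  shows "fourier_inverse (\<lambda>x. c * F x + d * G x) y = c * fourier_inverse F y + d * fourier_inverse G y"
proof -
  have FG: "integrable lborel (\<lambda>x. c * F x + d * G x)"
    using F G by auto
  have "fourier_inverse (\<lambda>x. c * F x + d * G x) y = (\<integral>x. c * (F x * wave y x) + d * (G x * wave y x) \<partial>lborel)"
    unfolding fourier_inverse_eq_integral[OF FG]
    by (intro Bochner_Integration.integral_cong refl) (simp add: algebra_simps)
  also have "\<dots> = c * fourier_inverse F y + d * fourier_inverse G y"
    unfolding fourier_inverse_eq_integral[OF F] fourier_inverse_eq_integral[OF G]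
    by (subst Bochner_Integration.integral_add)
      (intro integrable_mult_right integrable_mult_wave F G | simp)+
  finally show ?thesis .
qed

text \<open>Termwise domination by a geometric series. The factor 2 in the hypothesis allows for the
  masses sitting at the doubled points 2 z and 2 p.\<close>

lemma tempered_distribution_dipole_sum:
  fixes a b :: "nat \<Rightarrow> 'a::euclidean_space"
  assumes ab: "\<And>j. norm (a j - b j) \<le> 2 * (1 / 2) ^ j"
  shows "tempered_distribution (dipole_sum a b)"
proof -
  have bound: "norm (fourier_inverse F (a j) - fourier_inverse F (b j)) \<le>
      (4 * pi * moment F) * (1 / 2) ^ j" if F: "F \<in> schwartz" for F j
  proof -
    have I: "0 \<le> moment F" by simp
    have "norm (fourier_inverse F (a j) - fourier_inverse F (b j)) \<le> 2 * pi * norm (a j - b j) * moment F"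
      by (rule norm_fourier_inverse_diff_le[OF F])
    also have "\<dots> \<le> 2 * pi * (2 * (1 / 2) ^ j) * moment F"
      by (intro mult_right_mono mult_left_mono ab I) auto
    finally show ?thesis by (simp add: mult_ac)
  qed
  have geom: "summable (\<lambda>j. (4 * pi * moment F) * (1 / 2) ^ j)" for F :: "'a \<Rightarrow> complex"
    by (intro summable_mult summable_geometric) simp
  have summ: "summable (\<lambda>j. fourier_inverse F (a j) - fourier_inverse F (b j))" if F: "F \<in> schwartz" for F
    by (rule summable_comparison_test'[OF geom[of F]]) (rule bound[OF F])
  let ?n = "2 * DIM('a) + 1"
  \<comment> \<open>8 pi is 2 pi from the wave estimate, times 2 from the dipole length, times 2 for
    the geometric sum; the rest is the constant of
    \<open>integral_schwartz_moment_le\<close>.\<close>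
  define D where "D = 8 * pi * ((\<integral>x. decay_weight (x::'a) \<partial>lborel) * 2 ^ (DIM('a) + 1))"
  have D0: "0 \<le> D"
    unfolding D_def by (intro mult_nonneg_nonneg) (auto intro!: integral_nonneg_AE less_imp_le[OF decay_weight_pos])
  show ?thesis
    unfolding tempered_distribution_def
  proof (intro conjI ballI allI exI[of _ D] exI[of _ ?n])
    fix F G :: "'a \<Rightarrow> complex" and c d
    assume F: "F \<in> schwartz" and G: "G \<in> schwartz"
    have "dipole_sum a b (\<lambda>x. c * F x + d * G x) =
        (\<Sum>j. c * (fourier_inverse F (a j) - fourier_inverse F (b j)) + d * (fourier_inverse G (a j) - fourier_inverse G (b j)))"
      unfolding dipole_sum_def fourier_inverse_lincomb[OF integrable_schwartz[OF F] integrable_schwartz[OF G]]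
      by (simp add: algebra_simps)
    also have "\<dots> = c * dipole_sum a b F + d * dipole_sum a b G"
      unfolding dipole_sum_def
      using summ[OF F] summ[OF G] by (simp add: suminf_add[symmetric] suminf_mult summable_mult)
    finally show "dipole_sum a b (\<lambda>x. c * F x + d * G x) = c * dipole_sum a b F + d * dipole_sum a b G" .
  next
    fix F :: "'a \<Rightarrow> complex" assume F: "F \<in> schwartz"
    let ?V = "{vs :: 'a list. set vs \<subseteq> Basis \<and> length vs \<le> ?n}"
    have finV: "finite ?V" by (rule finite_lists_length_le[OF finite_Basis])
    have nonneg: "0 \<le> schwartz_seminorm k vs F" if "vs \<in> ?V" for k vs
      using that by (intro schwartz_seminorm_nonneg[OF F]) simp
    have single: "schwartz_seminorm k [] F \<le> (\<Sum>vs\<in>?V. schwartz_seminorm k vs F)" for k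
      using finV nonneg by (intro member_le_sum) auto
    \<comment> \<open>Only the orders 0 and \<open>?n\<close> with the empty list are used. They are
      two different terms of the double sum, since \<open>?n\<close> is at least 1, and the
      remaining terms are non-negative.\<close>
    have "schwartz_seminorm 0 [] F + schwartz_seminorm ?n [] F \<le>
        (\<Sum>k\<in>{0, ?n}. \<Sum>vs\<in>?V. schwartz_seminorm k vs F)"
      using single[of 0] single[of ?n] by simp
    also have "\<dots> \<le> (\<Sum>k\<le>?n. \<Sum>vs\<in>?V. schwartz_seminorm k vs F)"
      by (intro sum_mono2 sum_nonneg nonneg) auto
    finally have semi: "schwartz_seminorm 0 [] F + schwartz_seminorm ?n [] F \<le> (\<Sum>k\<le>?n. \<Sum>vs\<in>?V. schwartz_seminorm k vs F)" .
    have "norm (dipole_sum a b F) \<le> (\<Sum>j. (4 * pi * moment F) * (1 / 2) ^ j)"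
      unfolding dipole_sum_def by (rule norm_suminf_le[OF bound[OF F] geom])
    also have "\<dots> = (4 * pi * moment F) * 2"
      by (subst suminf_mult) (simp_all add: suminf_geometric)
    also have "\<dots> = 8 * pi * moment F"
      by simp
    also have "\<dots> \<le> 8 * pi * ((\<integral>x. decay_weight (x::'a) \<partial>lborel) * (2 ^ (DIM('a) + 1) *
        (schwartz_seminorm 0 [] F + schwartz_seminorm ?n [] F)))"
      by (intro mult_left_mono integral_schwartz_moment_le[OF F]) auto
    also have "\<dots> = D * (schwartz_seminorm 0 [] F + schwartz_seminorm ?n [] F)"
      unfolding D_def by (simp only: mult.assoc)
    also have "\<dots> \<le> D * (\<Sum>k\<le>?n. \<Sum>vs\<in>?V. schwartz_seminorm k vs F)"
      by (rule mult_left_mono[OF semi D0])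
    finally show "norm (dipole_sum a b F) \<le> D * (\<Sum>k\<le>?n. \<Sum>vs | set vs \<subseteq> Basis \<and> length vs \<le> ?n. schwartz_seminorm k vs F)" .
  qed
qed

subsection \<open>Separated exposed points\<close>

text \<open>The intersection of \<Omega> with its reflection through z, that is, the points of
  \<Omega> that the reflection keeps in \<Omega>.\<close>

definition overlap :: "'a::euclidean_space set \<Rightarrow> 'a \<Rightarrow> 'a set" where
  "overlap \<Omega> z = {x \<in> \<Omega>. 2 *\<^sub>R z - x \<in> \<Omega>}"

text \<open>A slice of a closed convex set close to a hyperplane that exposes \<open>p\<close> lies close to \<open>p\<close>, even when
  the set is unbounded; and \<open>x\<close> and \<open>2 z - x\<close> both lie in such a slice when \<open>z\<close> is close to \<open>p\<close>.\<close>

lemma exposed_point_overlap_small: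
  fixes \<Omega> :: "'a::euclidean_space set"
  assumes "convex \<Omega>" and p: "p \<in> exposed_points (closure \<Omega>)" and e: "0 < e"
  obtains z where "z \<in> \<Omega>" "norm (z - p) < e" "overlap \<Omega> z \<subseteq> ball p e"
proof -
  let ?K = "closure \<Omega>"
  obtain a t where t: "p \<bullet> a = t" and K: "\<And>y. y \<in> ?K \<Longrightarrow> y \<bullet> a \<le> t"
    and only: "\<And>y. y \<in> ?K \<Longrightarrow> y \<bullet> a = t \<Longrightarrow> y = p"
    using p unfolding exposed_points_def supporting_hyperplane_at_def by blast
  have pK: "p \<in> ?K"
    using p frontier_subset_closed[of ?K] unfolding exposed_points_def by auto
  have convK: "convex ?K" using assms(1) by (rule convex_closure)
  have comp: "compact (?K \<inter> sphere p e)"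
    by (simp add: closed_Int_compact)
  \<comment> \<open>On the sphere around p the linear functional stays away from its maximum t: the
    slice is compact, and t is attained in the closure at p only. If the slice is empty, any m < t
    will do.\<close>
  obtain m where m: "m < t" and m_le: "\<And>y. y \<in> ?K \<inter> sphere p e \<Longrightarrow> y \<bullet> a \<le> m"
  proof (cases "?K \<inter> sphere p e = {}")
    case True
    then show ?thesis by (intro that[of "t - 1"]) auto
  next
    case False
    have cont: "continuous_on (?K \<inter> sphere p e) (\<lambda>x. x \<bullet> a)"
      by (intro continuous_intros)
    obtain y where y: "y \<in> ?K \<inter> sphere p e" and max: "\<And>x. x \<in> ?K \<inter> sphere p e \<Longrightarrow> x \<bullet> a \<le> y \<bullet> a"
      using continuous_attains_sup[OF comp False cont] by blast
    have "y \<noteq> p" using y e by auto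
    then have "y \<bullet> a < t"
      using K[of y] only[of y] y by force
    then show ?thesis using max by (rule that)
  qed
  \<comment> \<open>A distant point is pulled along the segment towards p onto the sphere. As the
    functional is at most t on the closure, this can only raise its value, so the bound m from the
    sphere holds for the distant point too.\<close>
  have far: "y \<bullet> a \<le> m" if y: "y \<in> ?K" and "e \<le> norm (y - p)" for y
  proof -
    define s where "s = e / norm (y - p)"
    have "0 < norm (y - p)" using e that(2) by linarith
    then have s: "0 < s" "s \<le> 1" "s * norm (y - p) = e"
      using e that(2) by (simp_all add: s_def divide_le_eq)
    let ?q = "(1 - s) *\<^sub>R p + s *\<^sub>R y"
    have "?q \<in> ?K"
      using convexD[OF convK pK y, of "1 - s" s] s by simp
    moreover have "?q \<in> sphere p e"
    proof -
      have "?q - p = s *\<^sub>R (y - p)" by (simp add: algebra_simps)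
      then have "norm (?q - p) = e" using s by simp
      then show ?thesis by (simp add: dist_norm norm_minus_commute)
    qed
    ultimately have "?q \<bullet> a \<le> m" by (intro m_le) simp
    then have "(1 - s) * t + s * (y \<bullet> a) \<le> m"
      by (simp add: inner_add_left t)
    then have "s * (y \<bullet> a - t) \<le> m - t"
      by (simp add: algebra_simps)
    moreover have "y \<bullet> a - t \<le> s * (y \<bullet> a - t)"
      using mult_right_mono_neg[of s 1 "y \<bullet> a - t"] s K[OF y] by simp
    ultimately show ?thesis by linarith
  qed
  obtain d where d: "0 < d" and near: "\<And>z. norm (z - p) < d \<Longrightarrow> \<bar>z \<bullet> a - t\<bar> < (t - m) / 2"
  proof (rule that[of "(t - m) / 2 / (norm a + 1)"])
    have "0 < norm a + 1" by (simp add: add_nonneg_pos)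
    then show "0 < (t - m) / 2 / (norm a + 1)" using m by simp
    fix z assume z: "norm (z - p) < (t - m) / 2 / (norm a + 1)"
    have "\<bar>z \<bullet> a - t\<bar> = \<bar>(z - p) \<bullet> a\<bar>" by (simp add: t inner_diff_left)
    also have "\<dots> \<le> norm (z - p) * norm a" by (rule Cauchy_Schwarz_ineq2)
    also have "\<dots> \<le> norm (z - p) * (norm a + 1)" by (intro mult_left_mono) auto
    also have "\<dots> < (t - m) / 2"
      using z unfolding pos_less_divide_eq[OF \<open>0 < norm a + 1\<close>] .
    finally show "\<bar>z \<bullet> a - t\<bar> < (t - m) / 2" .
  qed
  obtain z where z: "z \<in> \<Omega>" "dist z p < min d e"
    using pK d e unfolding closure_approachable by (metis min_less_iff_conj)
  have za: "(t + m) / 2 < z \<bullet> a"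
  proof -
    have "\<bar>z \<bullet> a - t\<bar> < (t - m) / 2"
      using near[of z] z(2) by (simp add: dist_norm)
    then have "t - (t - m) / 2 < z \<bullet> a"
      by (simp only: abs_diff_less_iff)
    moreover have "t - (t - m) / 2 = (t + m) / 2"
      by (simp add: field_simps)
    ultimately show ?thesis by (simp only:)
  qed
  have "overlap \<Omega> z \<subseteq> ball p e"
  proof
    fix x assume x: "x \<in> overlap \<Omega> z"
    then have xK: "x \<in> ?K" and x': "2 *\<^sub>R z - x \<in> ?K"
      using closure_subset by (auto simp: overlap_def)
    \<comment> \<open>The reflected point is at most at height t and z is above (t + m)/2, so x is
      above height m and \<open>far\<close> forces it into the ball.\<close>
    have "2 * (z \<bullet> a) - x \<bullet> a \<le> t"
      using K[OF x'] by (simp add: inner_diff_left)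
    then have "m < x \<bullet> a" using za by (simp add: field_simps)
    then have "norm (x - p) < e"
      using far[OF xK] by (meson not_le)
    then show "x \<in> ball p e" by (simp add: dist_norm norm_minus_commute)
  qed
  then show ?thesis
    using z by (intro that[of z]) (auto simp: dist_norm)
qed

text \<open>The points may accumulate at a chosen one, so a careless choice could leave nothing
  outside its balls. The recursion carries an infinite remaining set A inside an open set W disjoint
  from the earlier balls, and removes a ball only if infinitely many points of A survive.\<close>

lemma infinite_set_separated_balls:
  fixes E :: "'a::metric_space set"
  assumes "infinite E"
  obtains p :: "nat \<Rightarrow> 'a" and e :: "nat \<Rightarrow> real"
  where "\<And>n. p n \<in> E" "\<And>n. 0 < e n" "\<And>i j. i \<noteq> j \<Longrightarrow> cball (p i) (e i) \<inter> cball (p j) (e j) = {}"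
proof -
  define P where "P n X \<longleftrightarrow> infinite (fst X) \<and> fst X \<subseteq> E \<inter> snd X \<and> open (snd X)"
    for n :: nat and X :: "'a set \<times> 'a set"
  define R where "R n X Y \<longleftrightarrow> (\<exists>p e. p \<in> E \<and> 0 < e \<and> cball p e \<subseteq> snd X \<and> snd Y = snd X - cball p e)"
    for n :: nat and X Y :: "'a set \<times> 'a set"
  have start: "\<exists>X. P 0 X"
    using assms by (intro exI[of _ "(E, UNIV)"]) (simp add: P_def)
  have step: "\<exists>Y. P (Suc n) Y \<and> R n X Y" if "P n X" for X n
  proof -
    obtain A W where X: "X = (A, W)" by (cases X)
    have A: "infinite A" "A \<subseteq> E" "A \<subseteq> W" "open W"
      using that by (auto simp: P_def X)
    obtain p where p: "p \<in> A" using A(1) by (metis ex_in_conv finite.emptyI)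
    obtain q where q: "q \<in> A" "q \<noteq> p"
      using A(1) by (metis finite.emptyI finite_insert finite_subset insertI1 subsetI insert_iff)
    obtain e1 where e1: "0 < e1" "cball p e1 \<subseteq> W" using A p open_contains_cball by (metis subsetD)
    obtain e2 where e2: "0 < e2" "cball q e2 \<subseteq> W" using A q open_contains_cball by (metis subsetD)
    \<comment> \<open>A third of the distance makes the two closed balls disjoint.\<close>
    define e where "e = min (min e1 e2) (dist p q / 3)"
    have e: "0 < e" "cball p e \<subseteq> W" "cball q e \<subseteq> W"
      using e1 e2 q(2) subset_cball[of e e1 p] subset_cball[of e e2 q] by (auto simp: e_def)
    have disj: "cball p e \<inter> cball q e = {}"
    proof (rule ccontr)
      assume "cball p e \<inter> cball q e \<noteq> {}"
      then obtain y where "dist p y \<le> e" "dist q y \<le> e" by auto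
      then have "dist p q \<le> 2 * e"
        using dist_triangle2[of p q y] by linarith
      moreover have "e \<le> dist p q / 3" "0 < dist p q"
        using q(2) by (simp_all add: e_def)
      ultimately show False by linarith
    qed
    have choose: "\<exists>Y. P (Suc n) Y \<and> R n X Y" if "c \<in> A" "cball c e \<subseteq> W" "infinite (A - cball c e)" for c
    proof (intro exI[of _ "(A - cball c e, W - cball c e)"] conjI)
      show "P (Suc n) (A - cball c e, W - cball c e)"
        using that A by (auto simp: P_def intro!: open_Diff)
      show "R n X (A - cball c e, W - cball c e)"
        unfolding R_def using that A e(1) X by (intro exI[of _ c] exI[of _ e]) auto
    qed
    show ?thesis
    proof (cases "infinite (A - cball p e)")
      case True
      then show ?thesis using choose[of p] p e(2) by blast
    next
      case False
      \<comment> \<open>As no point lies in both balls, removing one of the two leaves infinitely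
        many points; that one is chosen.\<close>
      have "A \<subseteq> (A - cball p e) \<union> (A - cball q e)"
        using disj by auto
      then have "infinite (A - cball q e)"
        using False A(1) by (meson finite_UnI finite_subset)
      then show ?thesis using choose[of q] q(1) e(3) by blast
    qed
  qed
  obtain X where X: "\<And>n. P n (X n)" "\<And>n. R n (X n) (X (Suc n))"
    using dependent_nat_choice[of P R] start step by metis
  then obtain p e where pe: "\<And>n. p n \<in> E" "\<And>n. 0 < e n" "\<And>n. cball (p n) (e n) \<subseteq> snd (X n)"
    "\<And>n. snd (X (Suc n)) = snd (X n) - cball (p n) (e n)"
    unfolding R_def by metis
  have mono: "snd (X j) \<subseteq> snd (X (Suc i))" if "i < j" for i j
    using that
  proof (induction j)
    case (Suc j)
    show ?case
    proof (cases "i = j")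
      case False
      then have "snd (X j) \<subseteq> snd (X (Suc i))" using Suc by simp
      then show ?thesis using pe(4)[of j] by blast
    qed simp
  qed simp
  have lt: "cball (p i) (e i) \<inter> cball (p j) (e j) = {}" if "i < j" for i j
    using mono[OF that] pe(3)[of j] pe(4)[of i] by blast
  show ?thesis
  proof (rule that[of p e])
    show "cball (p i) (e i) \<inter> cball (p j) (e j) = {}" if "i \<noteq> j" for i j
      using lt[of i j] lt[of j i] that by (cases "i < j") auto
  qed (use pe in auto)
qed

lemma separated_exposed_points:
  fixes \<Omega> :: "'a::euclidean_space set"
  assumes "open \<Omega>" "convex \<Omega>" "infinite (exposed_points (closure \<Omega>))"
  obtains p z :: "nat \<Rightarrow> 'a" where "\<And>j. p j \<notin> \<Omega>" "\<And>j. z j \<in> \<Omega>"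
    "\<And>j. norm (z j - p j) \<le> (1 / 2) ^ j" "disjoint_family (\<lambda>j. overlap \<Omega> (z j))"
proof -
  obtain p :: "nat \<Rightarrow> 'a" and e :: "nat \<Rightarrow> real" where p: "\<And>n. p n \<in> exposed_points (closure \<Omega>)"
    and e: "\<And>n. 0 < e n" and disj: "\<And>i j. i \<noteq> j \<Longrightarrow> cball (p i) (e i) \<inter> cball (p j) (e j) = {}"
    using infinite_set_separated_balls[OF assms(3)] by metis
  \<comment> \<open>The bound e j keeps the overlaps in disjoint balls, and (1/2)^j makes the dipole
    series converge.\<close>
  have "\<exists>z. z \<in> \<Omega> \<and> norm (z - p j) < min (e j) ((1 / 2) ^ j) \<and> overlap \<Omega> z \<subseteq> ball (p j) (min (e j) ((1 / 2) ^ j))" for j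
  proof -
    have "0 < min (e j) ((1 / 2) ^ j)" using e[of j] by simp
    then show ?thesis
      using exposed_point_overlap_small[OF assms(2) p[of j]] by metis
  qed
  then obtain z where z: "\<And>j. z j \<in> \<Omega>" "\<And>j. norm (z j - p j) < min (e j) ((1 / 2) ^ j)"
    "\<And>j. overlap \<Omega> (z j) \<subseteq> ball (p j) (min (e j) ((1 / 2) ^ j))"
    by metis
  have sub: "overlap \<Omega> (z j) \<subseteq> cball (p j) (e j)" for j
    using z(3)[of j] by auto
  have pfr: "p j \<in> frontier (closure \<Omega>)" for j
    using p[of j] by (simp add: exposed_points_def)
  show ?thesis
  proof (rule that[of p z])
    \<comment> \<open>An open set lies in the interior of its closure, while p j is on the frontier
      of that closure.\<close>
    show "p j \<notin> \<Omega>" for j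
      using pfr[of j] interior_maximal[OF closure_subset assms(1)] by (auto simp: frontier_def)
    show "norm (z j - p j) \<le> (1 / 2) ^ j" for j
      using z(2)[of j] by simp
    have "overlap \<Omega> (z i) \<inter> overlap \<Omega> (z j) = {}" if "i \<noteq> j" for i j
      using disj[OF that] sub[of i] sub[of j] by blast
    then show "disjoint_family (\<lambda>j. overlap \<Omega> (z j))"
      by (simp add: disjoint_family_on_def)
  qed (rule z(1))
qed

subsection \<open>Reflecting the pieces of a function\<close>

text \<open>The Hankel operator seen on the Fourier side. When the overlaps are disjoint at most one
  term is non-zero; writing a sum makes measurability immediate.\<close>

definition reflection :: "'a::euclidean_space set \<Rightarrow> (nat \<Rightarrow> 'a) \<Rightarrow> ('a \<Rightarrow> complex) \<Rightarrow> 'a \<Rightarrow> complex" where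
  "reflection \<Omega> z G x = (\<Sum>j. indicator (overlap \<Omega> (z j)) x * G (2 *\<^sub>R z j - x))"

lemma overlap_reflect: "2 *\<^sub>R z - x \<in> overlap \<Omega> z \<longleftrightarrow> x \<in> overlap \<Omega> z"
  by (auto simp: overlap_def)

lemma open_overlap:
  assumes "open \<Omega>"
  shows "open (overlap \<Omega> z)"
proof -
  have "open ((\<lambda>x. 2 *\<^sub>R z - x) -` \<Omega>)"
    using assms by (intro open_vimage continuous_intros)
  moreover have "overlap \<Omega> z = \<Omega> \<inter> (\<lambda>x. 2 *\<^sub>R z - x) -` \<Omega>"
    by (auto simp: overlap_def)
  ultimately show ?thesis
    using assms by (simp add: open_Int)
qed

lemma disjoint_overlap_unique:
  "disjoint_family (\<lambda>j. overlap \<Omega> (z j)) \<Longrightarrow> x \<in> overlap \<Omega> (z i) \<Longrightarrow> x \<in> overlap \<Omega> (z j) \<Longrightarrow> i = j"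
  by (auto simp: disjoint_family_on_def)

lemma reflection_in:
  assumes disj: "disjoint_family (\<lambda>j. overlap \<Omega> (z j))"
    and x: "x \<in> overlap \<Omega> (z i)"
  shows "reflection \<Omega> z G x = G (2 *\<^sub>R z i - x)"
proof -
  have "indicator (overlap \<Omega> (z j)) x * G (2 *\<^sub>R z j - x) = (0::complex)" if "j \<notin> {i}" for j
    using disjoint_overlap_unique[OF disj x, of j] that by (auto simp: indicator_def)
  then have "reflection \<Omega> z G x = (\<Sum>j\<in>{i}. indicator (overlap \<Omega> (z j)) x * G (2 *\<^sub>R z j - x))"
    unfolding reflection_def by (intro suminf_finite) auto
  then show ?thesis using x by simp
qed

lemma reflection_out:
  assumes "\<And>i. x \<notin> overlap \<Omega> (z i)"
  shows "reflection \<Omega> z G x = 0"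
  using assms by (simp add: reflection_def)

lemma reflection_lincomb:
  assumes disj: "disjoint_family (\<lambda>j. overlap \<Omega> (z j))"
  shows "reflection \<Omega> z (\<lambda>y. a * G y + b * H y) x = a * reflection \<Omega> z G x + b * reflection \<Omega> z H x"
proof (cases "\<exists>i. x \<in> overlap \<Omega> (z i)")
  case True
  then obtain i where "x \<in> overlap \<Omega> (z i)" by blast
  then show ?thesis by (simp only: reflection_in[OF disj])
next
  case False
  then show ?thesis by (simp add: reflection_out)
qed

text \<open>Each overlap is invariant under the reflection through its centre, which preserves
  Lebesgue measure. The energy of each piece is therefore unchanged, and the pieces are disjoint
  parts of G.\<close>

lemma
  assumes \<Omega>: "open \<Omega>" and disj: "disjoint_family (\<lambda>j. overlap \<Omega> (z j))"
    and G: "G \<in> L2"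
  shows reflection_L2: "reflection \<Omega> z G \<in> L2"
    and L2_norm_reflection_le: "L2_norm (reflection \<Omega> z G) \<le> L2_norm G"
proof -
  have Gm[measurable]: "G \<in> borel_measurable borel" by (rule L2_measurable[OF G])
  have [measurable]: "overlap \<Omega> (z j) \<in> sets borel" for j
    by (rule borel_open[OF open_overlap[OF \<Omega>]])
  have meas[measurable]: "reflection \<Omega> z G \<in> borel_measurable borel"
    unfolding reflection_def[abs_def] by measurable
  let ?c = "\<lambda>j. indicator (overlap \<Omega> (z j)) :: 'a \<Rightarrow> ennreal"
  \<comment> \<open>Stated for arbitrary h because it is used twice: before the reflection, to write
    the squared norm as a sum over pieces, and after it, to bound the recombined pieces by the whole
    of G.\<close>
  have single: "(\<Sum>j. ?c j x * h j) = (if \<exists>i. x \<in> overlap \<Omega> (z i) then h (THE i. x \<in> overlap \<Omega> (z i)) else 0)"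
    for x and h :: "nat \<Rightarrow> ennreal"
  proof (cases "\<exists>i. x \<in> overlap \<Omega> (z i)")
    case True
    then obtain i where i: "x \<in> overlap \<Omega> (z i)" by blast
    have uniq: "j = i" if "x \<in> overlap \<Omega> (z j)" for j
      by (rule disjoint_overlap_unique[OF disj that i])
    have "(\<Sum>j. ?c j x * h j) = (\<Sum>j\<in>{i}. ?c j x * h j)"
      using uniq by (intro suminf_finite) (auto simp: indicator_def)
    moreover have "(THE i. x \<in> overlap \<Omega> (z i)) = i"
      using i uniq by (rule the_equality)
    ultimately show ?thesis using True i by simp
  next
    case False
    then show ?thesis by simp
  qed
  have "ennreal ((norm (reflection \<Omega> z G x))\<^sup>2) = (\<Sum>j. ?c j x * ennreal ((norm (G (2 *\<^sub>R z j - x)))\<^sup>2))" for x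
  proof (cases "\<exists>i. x \<in> overlap \<Omega> (z i)")
    case True
    then obtain i where i: "x \<in> overlap \<Omega> (z i)" by blast
    have "(THE i. x \<in> overlap \<Omega> (z i)) = i"
      using i disjoint_overlap_unique[OF disj _ i] by (rule the_equality)
    then show ?thesis
      unfolding single using True i by (simp only: reflection_in[OF disj i] if_True)
  next
    case False
    then show ?thesis unfolding single by (simp add: reflection_out)
  qed
  then have "(\<integral>\<^sup>+x. ennreal ((norm (reflection \<Omega> z G x))\<^sup>2) \<partial>lborel) =
      (\<integral>\<^sup>+x. (\<Sum>j. ?c j x * ennreal ((norm (G (2 *\<^sub>R z j - x)))\<^sup>2)) \<partial>lborel)"
    by simp
  also have "\<dots> = (\<Sum>j. \<integral>\<^sup>+x. ?c j x * ennreal ((norm (G (2 *\<^sub>R z j - x)))\<^sup>2) \<partial>lborel)"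
    by (rule nn_integral_suminf) measurable
  also have "\<dots> = (\<Sum>j. \<integral>\<^sup>+x. ?c j x * ennreal ((norm (G x))\<^sup>2) \<partial>lborel)"
  proof (rule arg_cong[where f=suminf], rule ext)
    fix j
    have ind: "?c j x = ?c j (2 *\<^sub>R z j - x)" for x
      by (simp add: indicator_def overlap_reflect)
    have "(\<integral>\<^sup>+x. ?c j x * ennreal ((norm (G (2 *\<^sub>R z j - x)))\<^sup>2) \<partial>lborel) =
        (\<integral>\<^sup>+x. ?c j (2 *\<^sub>R z j - x) * ennreal ((norm (G (2 *\<^sub>R z j - x)))\<^sup>2) \<partial>lborel)"
      by (simp only: ind[symmetric])
    also have "\<dots> = (\<integral>\<^sup>+x. ?c j x * ennreal ((norm (G x))\<^sup>2) \<partial>lborel)"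
      by (rule nn_integral_lborel_reflect[where f="\<lambda>x. ?c j x * ennreal ((norm (G x))\<^sup>2)"]) measurable
    finally show "(\<integral>\<^sup>+x. ?c j x * ennreal ((norm (G (2 *\<^sub>R z j - x)))\<^sup>2) \<partial>lborel) =
        (\<integral>\<^sup>+x. ?c j x * ennreal ((norm (G x))\<^sup>2) \<partial>lborel)" .
  qed
  also have "\<dots> = (\<integral>\<^sup>+x. (\<Sum>j. ?c j x * ennreal ((norm (G x))\<^sup>2)) \<partial>lborel)"
    by (rule nn_integral_suminf[symmetric]) measurable
  also have "\<dots> \<le> (\<integral>\<^sup>+x. ennreal ((norm (G x))\<^sup>2) \<partial>lborel)"
    unfolding single by (intro nn_integral_mono) simp
  also have "\<dots> = ennreal ((L2_norm G)\<^sup>2)"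
    unfolding L2_norm_power2 by (rule nn_integral_eq_integral) (use G in \<open>auto simp: L2_iff\<close>)
  finally have le: "(\<integral>\<^sup>+x. ennreal ((norm (reflection \<Omega> z G x))\<^sup>2) \<partial>lborel) \<le> ennreal ((L2_norm G)\<^sup>2)" .
  have int: "integrable lborel (\<lambda>x. (norm (reflection \<Omega> z G x))\<^sup>2)"
    using le by (intro integrableI_bounded) (auto intro: le_less_trans)
  then show "reflection \<Omega> z G \<in> L2" by (simp add: L2_iff meas)
  have "ennreal ((L2_norm (reflection \<Omega> z G))\<^sup>2) \<le> ennreal ((L2_norm G)\<^sup>2)"
    using le int unfolding L2_norm_power2[of "reflection \<Omega> z G"] by (simp add: nn_integral_eq_integral)
  then have "(L2_norm (reflection \<Omega> z G))\<^sup>2 \<le> (L2_norm G)\<^sup>2"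
    by (simp add: ennreal_le_iff)
  then show "L2_norm (reflection \<Omega> z G) \<le> L2_norm G"
    by (rule power2_le_imp_le) (rule L2_norm_nonneg)
qed

text \<open>The norm bound applied to the difference, which is null, replaces an argument about
  reflected null sets. It makes the reflection usable on transforms that are known only almost
  everywhere.\<close>

lemma reflection_cong_AE:
  assumes \<Omega>: "open \<Omega>" and disj: "disjoint_family (\<lambda>j. overlap \<Omega> (z j))"
    and G: "G \<in> L2" and H: "H \<in> L2" and eq: "AE x in lborel. G x = H x"
  shows "AE x in lborel. reflection \<Omega> z G x = reflection \<Omega> z H x"
proof -
  let ?D = "\<lambda>x. G x - H x"
  have D: "?D \<in> L2" by (rule L2_diff[OF G H])
  have "L2_norm ?D = L2_norm (\<lambda>x::'a. 0)"
    using eq L2_measurable[OF D] by (intro L2_norm_cong_AE) auto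
  then have "L2_norm ?D = 0" by (simp add: L2_norm_def)
  then have "L2_norm (reflection \<Omega> z ?D) = 0"
    using L2_norm_reflection_le[OF \<Omega> disj D] L2_norm_nonneg[of "reflection \<Omega> z ?D"]
    by (simp only: order_antisym)
  then have "AE x in lborel. reflection \<Omega> z ?D x = 0"
    by (rule L2_norm_eq_0[OF reflection_L2[OF \<Omega> disj D]])
  moreover have "reflection \<Omega> z ?D x = reflection \<Omega> z G x - reflection \<Omega> z H x" for x
    using reflection_lincomb[OF disj, of 1 G "- 1" H x] by simp
  ultimately show ?thesis by simp
qed

subsection \<open>The bounded Hankel operator\<close>

lemma test_function_continuous: "test_function U g \<Longrightarrow> continuous_on UNIV g"
  unfolding test_function_def smooth_def
  by (metis differentiable_imp_continuous_on empty_set empty_subsetI iter_partial.simps(1))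

lemma test_function_eq_0: "test_function U g \<Longrightarrow> x \<notin> U \<Longrightarrow> g x = 0"
  unfolding test_function_def using closure_subset[of "{x. g x \<noteq> 0}"] by auto

lemma nice_test_function:
  assumes "test_function U g"
  shows "nice g"
proof -
  have "bounded (closure {x. g x \<noteq> 0})"
    using assms unfolding test_function_def by (blast intro: compact_imp_bounded)
  then obtain R where R: "\<And>x. x \<in> closure {x. g x \<noteq> 0} \<Longrightarrow> norm x \<le> R"
    unfolding bounded_iff by blast
  have supp: "g x = 0" if "R < norm x" for x
    using R[of x] closure_subset[of "{x. g x \<noteq> 0}"] that by fastforce
  obtain B where B: "0 \<le> B" "\<And>x. norm (g x) \<le> B * indicator (cball 0 R) x" "integrable lborel g"
    using integrable_bounded_support[OF test_function_continuous[OF assms], of R, OF supp] by metis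
  have "norm (g x) \<le> B" for x
    using B(1) B(2)[of x] by (cases "x \<in> cball 0 R") auto
  then show ?thesis
    using B(3) test_function_continuous[OF assms] unfolding nice_def by auto
qed

lemma fourier_inverse_fourier_nice:
  assumes "nice g"
  shows "fourier_inverse (fourier g) x = g x"
proof -
  obtain B where "continuous_on UNIV g" "\<And>x. norm (g x) \<le> B" "integrable lborel g"
    using assms unfolding nice_def by blast
  then show ?thesis by (rule fourier_inverse_fourier)
qed

text \<open>Inversion is exact in every term, so both sides are the same series and no question of
  convergence arises.\<close>

lemma fourier_distribution_dipole_sum:
  assumes "nice g"
  shows "fourier_distribution (dipole_sum a b) g = (\<Sum>j. g (a j) - g (b j))"
  by (simp add: fourier_distribution_def dipole_sum_def fourier_inverse_fourier_nice[OF assms])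

lemma nice_translate:
  assumes "nice g"
  shows "nice (\<lambda>y. g (y - x))"
proof -
  have "continuous_on UNIV (\<lambda>y. g (y - x))"
    using assms continuous_on_compose2[of UNIV g UNIV "\<lambda>y. y - x"]
    unfolding nice_def by (simp add: continuous_intros)
  then show ?thesis
    using assms integrable_lborel_translate[of g x] unfolding nice_def by auto
qed

abbreviation hankel_symbol :: "(nat \<Rightarrow> 'a::euclidean_space) \<Rightarrow> (nat \<Rightarrow> 'a) \<Rightarrow> ('a \<Rightarrow> complex) \<Rightarrow> complex" where
  "hankel_symbol z p \<equiv> dipole_sum (\<lambda>j. 2 *\<^sub>R z j) (\<lambda>j. 2 *\<^sub>R p j)"

text \<open>If x and 2 p - x were both in the convex set \<Omega>, so would be their midpoint p;
  hence the masses at 2 p contribute nothing. The mass at 2 z contributes the value of g at the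
  reflected point, non-zero only for x in the overlap.\<close>

lemma hankel_integral_dipole_sum:
  assumes \<Omega>: "convex \<Omega>" and p: "\<And>j. p j \<notin> \<Omega>"
    and disj: "disjoint_family (\<lambda>j. overlap \<Omega> (z j))"
    and g: "test_function \<Omega> g" and x: "x \<in> \<Omega>"
  shows "hankel_integral (fourier_distribution (hankel_symbol z p)) g x = reflection \<Omega> z g x"
proof -
  have "g (2 *\<^sub>R p j - x) = 0" for j
  proof (rule test_function_eq_0[OF g], rule notI)
    assume "2 *\<^sub>R p j - x \<in> \<Omega>"
    then have "(1 / 2) *\<^sub>R (2 *\<^sub>R p j - x) + (1 / 2) *\<^sub>R x \<in> \<Omega>"
      using x by (intro convexD[OF \<Omega>]) auto
    then show False using p[of j] by (simp add: scaleR_diff_right)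
  qed
  moreover have "g (2 *\<^sub>R z j - x) = indicator (overlap \<Omega> (z j)) x * g (2 *\<^sub>R z j - x)" for j
    using test_function_eq_0[OF g, of "2 *\<^sub>R z j - x"] x by (auto simp: overlap_def indicator_def)
  ultimately have "g (2 *\<^sub>R z j - x) - g (2 *\<^sub>R p j - x) = indicator (overlap \<Omega> (z j)) x * g (2 *\<^sub>R z j - x)" for j
    by simp
  then show ?thesis
    unfolding hankel_integral_def fourier_distribution_dipole_sum[OF nice_translate[OF nice_test_function[OF g]]]
      reflection_def by (simp only:)
qed

text \<open>T is the reflection conjugated by the L2 Fourier transform, with a preimage chosen by
  surjectivity. The isometry makes it a contraction, and its linearity holds almost everywhere by
  uniqueness of transforms.\<close>

lemma generates_bounded_hankel_dipole_sum:
  fixes \<Omega> :: "'a::euclidean_space set"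
  assumes \<Omega>: "open \<Omega>" "convex \<Omega>" and p: "\<And>j. p j \<notin> \<Omega>"
    and disj: "disjoint_family (\<lambda>j. overlap \<Omega> (z j))"
  shows "generates_bounded_hankel \<Omega> (hankel_symbol z p)"
proof -
  let ?A = "reflection \<Omega> z"
  define T where "T f = (SOME h. is_fourier_L2 h (?A (fourier_L2 f)))" for f
  have F: "is_fourier_L2 f (fourier_L2 f)" "fourier_L2 f \<in> L2" if "f \<in> L2" for f :: "'a \<Rightarrow> complex"
    using is_fourier_L2_fourier_L2[OF that] by (auto simp: is_fourier_L2_def)
  have A_L2: "?A (fourier_L2 f) \<in> L2" if "f \<in> L2" for f
    by (rule reflection_L2[OF \<Omega>(1) disj F(2)[OF that]])
  have T: "is_fourier_L2 (T f) (?A (fourier_L2 f))" if "f \<in> L2" for f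
    unfolding T_def by (rule someI_ex[OF is_fourier_L2_surj[OF A_L2[OF that]]])
  have T_L2: "T f \<in> L2" if "f \<in> L2" for f
    using T[OF that] by (simp add: is_fourier_L2_def)
  have FT: "AE x in lborel. fourier_L2 (T f) x = ?A (fourier_L2 f) x" if "f \<in> L2" for f
    using is_fourier_L2_unique[OF F(1)[OF T_L2[OF that]] T[OF that]] by simp
  have PW_L2: "f \<in> L2" if "f \<in> paley_wiener \<Omega>" for f
    using that by (simp add: paley_wiener_def)
  have T_PW: "T f \<in> paley_wiener \<Omega>" if "f \<in> L2" for f
  proof -
    have "?A (fourier_L2 f) x = 0" if "x \<notin> \<Omega>" for x
      using that by (intro reflection_out) (simp add: overlap_def)
    then have "AE x in lborel. x \<notin> \<Omega> \<longrightarrow> fourier_L2 (T f) x = 0"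
      using FT[OF that] by auto
    then show ?thesis
      using T_L2[OF that] by (simp add: paley_wiener_def)
  qed
  have "bounded_operator_on (paley_wiener \<Omega>) T"
    unfolding bounded_operator_on_def
  proof (intro conjI ballI allI exI[of _ 1])
    fix f assume "f \<in> paley_wiener \<Omega>"
    then have f: "f \<in> L2" by (rule PW_L2)
    show "T f \<in> paley_wiener \<Omega>" by (rule T_PW[OF f])
    have "L2_norm (T f) = L2_norm (?A (fourier_L2 f))"
      by (rule is_fourier_L2_norm[OF T[OF f], symmetric])
    also have "\<dots> \<le> L2_norm (fourier_L2 f)"
      by (rule L2_norm_reflection_le[OF \<Omega>(1) disj F(2)[OF f]])
    also have "\<dots> = L2_norm f"
      by (rule is_fourier_L2_norm[OF F(1)[OF f]])
    finally show "L2_norm (T f) \<le> 1 * L2_norm f" by simp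
    fix g a b assume "g \<in> paley_wiener \<Omega>"
    then have g: "g \<in> L2" by (rule PW_L2)
    let ?h = "\<lambda>y. a * f y + b * g y"
    have h: "?h \<in> L2" by (rule L2_lincomb[OF f g])
    have "AE x in lborel. fourier_L2 ?h x = a * fourier_L2 f x + b * fourier_L2 g x"
      using is_fourier_L2_unique[OF F(1)[OF h] is_fourier_L2_lincomb[OF F(1)[OF f] F(1)[OF g], of a b]] by simp
    then have "AE x in lborel. ?A (fourier_L2 ?h) x = ?A (\<lambda>x. a * fourier_L2 f x + b * fourier_L2 g x) x"
      by (rule reflection_cong_AE[OF \<Omega>(1) disj F(2)[OF h] L2_lincomb[OF F(2)[OF f] F(2)[OF g]]])
    then have "AE x in lborel. ?A (fourier_L2 ?h) x = a * ?A (fourier_L2 f) x + b * ?A (fourier_L2 g) x"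
      unfolding reflection_lincomb[OF disj] .
    then show "AE x in lborel. T ?h x = a * T f x + b * T g x"
      using is_fourier_L2_unique[OF T[OF h] is_fourier_L2_lincomb[OF T[OF f] T[OF g], of a b]] by simp
  qed
  moreover have "is_hankel \<Omega> (hankel_symbol z p) f (T f)" if fD: "f \<in> hankel_domain \<Omega>" for f
  proof -
    have f: "f \<in> L2"
      using fD PW_L2 by (simp add: hankel_domain_def)
    obtain g where g: "test_function \<Omega> g" and fg: "AE x in lborel. fourier_L2 f x = g x"
      using fD unfolding hankel_domain_def by blast
    have "AE x in lborel. ?A (fourier_L2 f) x = ?A g x"
      by (rule reflection_cong_AE[OF \<Omega>(1) disj F(2)[OF f] nice_L2[OF nice_test_function[OF g]] fg])
    with FT[OF f] have "AE x in lborel. x \<in> \<Omega> \<longrightarrow> fourier_L2 (T f) x =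
        hankel_integral (fourier_distribution (hankel_symbol z p)) g x"
    proof eventually_elim
      case (elim x)
      then show ?case
        using hankel_integral_dipole_sum[OF \<Omega>(2) p disj g, of x] by auto
    qed
    then show ?thesis
      unfolding is_hankel_def using T_PW[OF f] g fg by blast
  qed
  ultimately show ?thesis
    unfolding generates_bounded_hankel_def by blast
qed

subsection \<open>No bounded symbol\<close>

text \<open>The bump sum picks up exactly one mass per bump, so the pairing grows like N, while a
  bounded symbol permits only a multiple of the L1 norm of the transform. The radius may be chosen
  after N because that norm bound does not involve it.\<close>

lemma dipole_sum_no_bounded_symbol:
  fixes \<Omega> :: "'a::euclidean_space set"
  assumes \<Omega>: "open \<Omega>" and p: "\<And>j. p j \<notin> \<Omega>" and z: "\<And>j. z j \<in> \<Omega>"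
    and disj: "disjoint_family (\<lambda>j. overlap \<Omega> (z j))"
    and \<psi>: "\<psi> \<in> Linfty"
    and eq: "distribution_eq_on ((\<lambda>x. 2 *\<^sub>R x) ` \<Omega>)
      (fourier_distribution (hankel_symbol z p)) (fourier_distribution (regular_distribution \<psi>))"
  shows False
proof -
  obtain C where C: "0 \<le> C" and bound: "\<And>N r (q :: nat \<Rightarrow> 'a). 0 < r \<Longrightarrow>
      (\<And>i j x. i < N \<Longrightarrow> j < N \<Longrightarrow> i \<noteq> j \<Longrightarrow> norm (x - q i) < r \<Longrightarrow> r \<le> norm (x - q j)) \<Longrightarrow>
      integrable lborel (fourier (bump_sum r N q)) \<and>
      (\<integral>y. norm (fourier (bump_sum r N q) y) \<partial>lborel) \<le> C * sqrt (real N)"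
    by (rule integral_norm_fourier_scaled_bumps_le) blast
  have [measurable]: "\<psi> \<in> borel_measurable borel"
    using \<psi> by (simp add: Linfty_def)
  obtain B where B: "AE x in lborel. norm (\<psi> x) \<le> B"
    using \<psi> unfolding Linfty_def by blast
  define \<beta> where "\<beta> = norm (bump (0::'a))"
  have \<beta>: "0 < \<beta>" using bump_0 by (simp add: \<beta>_def)
  have zo: "z j \<in> overlap \<Omega> (z j)" for j
    using z[of j] by (simp add: overlap_def scaleR_2)
  have main: "real N * \<beta> \<le> max B 0 * (C * sqrt (real N))" for N
  proof -
    have "\<exists>e>0. cball (z j) e \<subseteq> overlap \<Omega> (z j)" for j
      using open_overlap[OF \<Omega>, of "z j"] zo[of j] open_contains_cball by blast
    then obtain e where e: "\<And>j. 0 < e j" "\<And>j. cball (z j) (e j) \<subseteq> overlap \<Omega> (z j)" by metis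
    \<comment> \<open>The inserted 1 keeps the minimum over a non-empty set when N = 0.\<close>
    define r where "r = Min (insert 1 (e ` {..<N}))"
    have r: "0 < r" using e(1) by (auto simp: r_def)
    have re: "r \<le> e j" if "j < N" for j
      using that by (auto simp: r_def intro!: Min_le)
    \<comment> \<open>Halving carries the ball of radius r about 2 z j into the ball of radius r/2
      about z j, hence into the overlap. The doubled overlaps are disjoint, which separates the
      bumps and keeps their supports in \<open>2 \<Omega>\<close>.\<close>
    have ball: "x \<in> (\<lambda>y. 2 *\<^sub>R y) ` overlap \<Omega> (z j)" if "j < N" "norm (x - 2 *\<^sub>R z j) \<le> r" for x j
    proof -
      have "(1 / 2) *\<^sub>R x - z j = (1 / 2) *\<^sub>R (x - 2 *\<^sub>R z j)"
        by (simp add: scaleR_diff_right)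
      then have "norm ((1 / 2) *\<^sub>R x - z j) = norm (x - 2 *\<^sub>R z j) / 2" by simp
      then have "(1 / 2) *\<^sub>R x \<in> cball (z j) (e j)"
        using that re[OF that(1)] r by (simp add: dist_norm norm_minus_commute)
      then have "(1 / 2) *\<^sub>R x \<in> overlap \<Omega> (z j)" using e(2) by blast
      then have "2 *\<^sub>R ((1 / 2) *\<^sub>R x) \<in> (\<lambda>y. 2 *\<^sub>R y) ` overlap \<Omega> (z j)" by (rule imageI)
      then show ?thesis by simp
    qed
    have disj2: "i = j" if "x \<in> (\<lambda>y. 2 *\<^sub>R y) ` overlap \<Omega> (z i)" "x \<in> (\<lambda>y. 2 *\<^sub>R y) ` overlap \<Omega> (z j)" for x i j
    proof -
      have "(1 / 2) *\<^sub>R x \<in> overlap \<Omega> (z i)" "(1 / 2) *\<^sub>R x \<in> overlap \<Omega> (z j)"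
        using that by auto
      then show ?thesis by (rule disjoint_overlap_unique[OF disj])
    qed
    define q where "q j = 2 *\<^sub>R z j" for j
    define f where "f x = (\<Sum>j<N. bump ((1 / r) *\<^sub>R (x - q j)))" for x
    have sep: "r \<le> norm (x - q j)" if "i < N" "j < N" "i \<noteq> j" "norm (x - q i) < r" for i j x
      using ball[of i x] ball[of j x] disj2[of x i j] that unfolding q_def by fastforce
    have "integrable lborel (fourier f) \<and> (\<integral>y. norm (fourier f y) \<partial>lborel) \<le> C * sqrt (real N)"
      unfolding f_def[abs_def]
    proof (rule bound[OF r])
      fix i j x assume "i < N" "j < N" "i \<noteq> j" "norm (x - q i) < r"
      then show "r \<le> norm (x - q j)" by (rule sep)
    qed
    then have int: "integrable lborel (fourier f)" and le: "(\<integral>y. norm (fourier f y) \<partial>lborel) \<le> C * sqrt (real N)"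
      by simp_all
    have bump_far: "bump ((1 / r) *\<^sub>R (x - q j)) = 0" if "r \<le> norm (x - q j)" for x j
      using that r by (intro bump_eq_0) (simp add: le_divide_eq)
    have f_supp: "{x. f x \<noteq> 0} \<subseteq> (\<Union>j<N. cball (q j) r)"
    proof
      fix x assume "x \<in> {x. f x \<noteq> 0}"
      then have "(\<Sum>j<N. bump ((1 / r) *\<^sub>R (x - q j))) \<noteq> 0" by (simp add: f_def)
      then obtain j where j: "j < N" "bump ((1 / r) *\<^sub>R (x - q j)) \<noteq> 0"
        by (meson lessThan_iff sum.not_neutral_contains_not_neutral)
      then have "\<not> r \<le> norm (x - q j)"
        using bump_far by blast
      then have "x \<in> cball (q j) r"
        by (simp add: dist_norm norm_minus_commute)
      then show "x \<in> (\<Union>j<N. cball (q j) r)"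
        using j(1) by blast
    qed
    have clo: "closed (\<Union>j<N. cball (q j) r)"
      by (intro closed_UN) auto
    have f_clo: "closure {x. f x \<noteq> 0} \<subseteq> (\<Union>j<N. cball (q j) r)"
      by (rule closure_minimal[OF f_supp clo])
    have U_sub: "(\<Union>j<N. cball (q j) r) \<subseteq> (\<lambda>x. 2 *\<^sub>R x) ` \<Omega>"
    proof
      fix x assume "x \<in> (\<Union>j<N. cball (q j) r)"
      then obtain j where "j < N" "norm (x - 2 *\<^sub>R z j) \<le> r"
        by (auto simp: q_def dist_norm norm_minus_commute)
      then have "x \<in> (\<lambda>y. 2 *\<^sub>R y) ` overlap \<Omega> (z j)" by (rule ball)
      then show "x \<in> (\<lambda>x. 2 *\<^sub>R x) ` \<Omega>" by (auto simp: overlap_def)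
    qed
    have "bounded (closure {x. f x \<noteq> 0})"
      by (rule bounded_subset[OF _ f_clo]) (intro bounded_UN, auto)
    then have "compact (closure {x. f x \<noteq> 0})"
      by (simp add: compact_eq_bounded_closed)
    moreover have "smooth f"
      unfolding f_def[abs_def]
      by (rule smooth_sum_bump_class[where a=q and c="1 / r\<^sup>2"], rule bump_affine_in_bump_class) (use r in simp)
    ultimately have test: "test_function ((\<lambda>x. 2 *\<^sub>R x) ` \<Omega>) f"
      unfolding test_function_def using f_clo U_sub by blast
    \<comment> \<open>2 p j lies outside \<open>2 \<Omega>\<close>, which contains the support of
      f.\<close>
    have f_p: "f (2 *\<^sub>R p j) = 0" for j
      using p[of j] by (intro test_function_eq_0[OF test]) auto
    have bump_q: "bump ((1 / r) *\<^sub>R (q i - q j)) = (if i = j then bump (0::'a) else 0)" if "j < N" for i j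
    proof (cases "i = j")
      case False
      have "r \<le> norm (q i - q j)"
      proof (rule ccontr)
        assume "\<not> r \<le> norm (q i - q j)"
        then have "q i \<in> (\<lambda>y. 2 *\<^sub>R y) ` overlap \<Omega> (z j)"
          using ball[OF that, of "q i"] by (simp add: q_def)
        moreover have "q i \<in> (\<lambda>y. 2 *\<^sub>R y) ` overlap \<Omega> (z i)"
          using zo[of i] by (simp add: q_def)
        ultimately show False using disj2 False by blast
      qed
      then show ?thesis using False bump_far by simp
    qed simp
    \<comment> \<open>The masses with index at least N also lie off all the bumps, so the series of
      point masses reduces to N equal values.\<close>
    have f_q: "f (q i) = (if i < N then bump (0::'a) else 0)" for i
    proof -
      have "f (q i) = (\<Sum>j<N. if i = j then bump (0::'a) else 0)"
        unfolding f_def by (intro sum.cong refl bump_q) simp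
      then show ?thesis by simp
    qed
    have "(\<integral>x. \<psi> x * fourier f x \<partial>lborel) =
        fourier_distribution (hankel_symbol z p) f"
      using eq test unfolding distribution_eq_on_def
      by (simp add: fourier_distribution_def[of "regular_distribution \<psi>"] regular_distribution_def)
    also have "\<dots> = (\<Sum>j. f (q j) - f (2 *\<^sub>R p j))"
      unfolding q_def by (rule fourier_distribution_dipole_sum[OF nice_test_function[OF test]])
    also have "\<dots> = (\<Sum>j. if j < N then bump (0::'a) else 0)"
      by (simp add: f_p f_q)
    also have "\<dots> = (\<Sum>j<N. if j < N then bump (0::'a) else 0)"
      by (rule suminf_finite) auto
    also have "\<dots> = of_nat N * bump (0::'a)" by simp
    finally have pairing: "(\<integral>x. \<psi> x * fourier f x \<partial>lborel) = of_nat N * bump (0::'a)" .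
    have "real N * \<beta> = norm (\<integral>x. \<psi> x * fourier f x \<partial>lborel)"
      unfolding pairing by (simp add: \<beta>_def norm_mult)
    also have "\<dots> \<le> (\<integral>x. norm (\<psi> x * fourier f x) \<partial>lborel)"
      by (rule integral_norm_bound)
    also have "\<dots> \<le> (\<integral>x. max B 0 * norm (fourier f x) \<partial>lborel)"
    proof (rule integral_mono_AE')
      show "integrable lborel (\<lambda>x. max B 0 * norm (fourier f x))"
        using int by auto
      show "AE x in lborel. norm (\<psi> x * fourier f x) \<le> max B 0 * norm (fourier f x)"
        using B by eventually_elim (auto simp: norm_mult intro!: mult_right_mono)
      show "AE x in lborel. 0 \<le> max B 0 * norm (fourier f x)"
        by simp
    qed
    also have "\<dots> = max B 0 * (\<integral>x. norm (fourier f x) \<partial>lborel)"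
      by (rule integral_mult_right_zero)
    also have "\<dots> \<le> max B 0 * (C * sqrt (real N))"
      by (rule mult_left_mono[OF le]) simp
    finally show ?thesis .
  qed
  \<comment> \<open>Dividing the estimate by sqrt N and by the height of the bump bounds sqrt N by a
    constant independent of N.\<close>
  define D where "D = max B 0 * C / \<beta>"
  have D: "sqrt (real N) \<le> D" if "0 < N" for N
  proof -
    have "sqrt (real N) * (sqrt (real N) * \<beta>) = real N * \<beta>"
      by (simp flip: mult.assoc)
    also have "\<dots> \<le> sqrt (real N) * (max B 0 * C)"
      using main[of N] by (simp only: mult_ac)
    finally have "sqrt (real N) * (sqrt (real N) * \<beta>) \<le> sqrt (real N) * (max B 0 * C)" .
    then have "sqrt (real N) * \<beta> \<le> max B 0 * C"
      using that by (simp only: mult_le_cancel_left_pos real_sqrt_gt_0_iff of_nat_0_less_iff)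
    then show ?thesis using \<beta> by (simp add: D_def le_divide_eq)
  qed
  obtain N :: nat where "D\<^sup>2 < real N"
    using reals_Archimedean2 by blast
  moreover from this have "0 < N"
    by (metis gr0I not_less of_nat_0 zero_le_power2)
  ultimately have "\<bar>D\<bar> < sqrt (real N)"
    by (simp add: real_less_rsqrt)
  then show False using D[OF \<open>0 < N\<close>] by linarith
qed

theorem theorem6:
  fixes \<Omega> :: "(real ^ 'n) set"
  assumes "\<Omega> \<noteq> {}" and "open \<Omega>" and "convex \<Omega>"
    and "infinite (exposed_points (closure \<Omega>))"
  shows "\<not> nehari_true \<Omega>"
proof
  assume nehari: "nehari_true \<Omega>"
  obtain p z :: "nat \<Rightarrow> real ^ 'n" where p: "\<And>j. p j \<notin> \<Omega>" and z: "\<And>j. z j \<in> \<Omega>"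
    and zp: "\<And>j. norm (z j - p j) \<le> (1 / 2) ^ j"
    and disj: "disjoint_family (\<lambda>j. overlap \<Omega> (z j))"
    using separated_exposed_points[OF assms(2-4)] by metis
  let ?\<phi> = "hankel_symbol z p"
  have "norm (2 *\<^sub>R z j - 2 *\<^sub>R p j) \<le> 2 * (1 / 2) ^ j" for j
    using zp[of j] by (simp flip: scaleR_diff_right)
  then have "tempered_distribution ?\<phi>"
    by (rule tempered_distribution_dipole_sum)
  moreover have "generates_bounded_hankel \<Omega> ?\<phi>"
    by (rule generates_bounded_hankel_dipole_sum[OF assms(2,3) p disj])
  ultimately obtain \<psi> where "\<psi> \<in> Linfty"
    "distribution_eq_on ((\<lambda>x. 2 *\<^sub>R x) ` \<Omega>) (fourier_distribution ?\<phi>) (fourier_distribution (regular_distribution \<psi>))"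
    using nehari unfolding nehari_true_def by blast
  then show False
    by (rule dipole_sum_no_bounded_symbol[OF assms(2) p z disj])
qed

end
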